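(* Let $E=\lambda(A)$ be a nuclear Köthe space with a regular basis of type $(d_1)$, and let $T:E\to E$ be a continuous linear operator whose range $T(E)$ is closed in $E$. Then $T(E)$, with the topology induced by $E$, has a (Schauder) basis.
   Context: Scalars are real or complex. Let $A=(a_{k,n})_{k,n\in\mathbb{N}}$ be a matrix of positive reals with $a_{k,n}\le a_{k+1,n}$ for all $k,n$. The Köthe space is $\lambda(A)=\{x=(x_n)_{n}:\ \sum_n |x_n|a_{k,n}<\infty \text{ for all } k\}$, a Fréchet space with the norms $x\mapsto\sum_n|x_n|a_{k,n}$, $k\in\mathbb{N}$. It is nuclear iff for every $k$ there is $m$ with $\sum_n a_{k,n}/a_{m,n}<\infty$; in that case the norms $\sup_n|x_n|a_{k,n}$, $k\in\mathbb N$, define the same space and topology. The canonical basis is called regular if (for the given matrix $A$) $\frac{a_{k,n+1}}{a_{k+1,n+1}}\le\frac{a_{k,n}}{a_{k+1,n}}$ for all $k,n$. It is of type $(d_1)$ if there is $p$ such that for every $q$ there are $r\in\mathbb{N}$ and $C>0$ with $a_{q,n}^2\le C\,a_{p,n}a_{r,n}$ for all $n$ (equivalently, $\lambda(A)$ has property (DN)). A (Schauder) basis of a Fréchet space $F$ is a sequence $(f_j)_j$ in $F$ (finite if $F$ is finite dimensional) such that every $x\in F$ has a unique expansion $x=\sum_j c_jf_j$ with scalars $c_j$, converging in $F$. *)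

theory Defs
  imports "HOL-Analysis.Analysis" "HOL-Library.Function_Algebras"
begin

text \<open>
  Scalar sequences are functions \<open>nat \<Rightarrow> 'a\<close> with \<open>'a\<close> a real normed field, intended to be \<open>real\<close>
  or \<open>complex\<close>. Addition, subtraction and zero of sequences are the pointwise ones.
\<close>

definition scale_seq :: "'a::real_normed_field \<Rightarrow> (nat \<Rightarrow> 'a) \<Rightarrow> (nat \<Rightarrow> 'a)"
  where "scale_seq c x = (\<lambda>n. c * x n)"

definition linear_map_on ::
  "(nat \<Rightarrow> 'a::real_normed_field) set \<Rightarrow> ((nat \<Rightarrow> 'a) \<Rightarrow> (nat \<Rightarrow> 'a)) \<Rightarrow> bool"
  where "linear_map_on V T \<longleftrightarrow>
    (\<forall>x\<in>V. \<forall>y\<in>V. T (x + y) = T x + T y) \<and> (\<forall>c. \<forall>x\<in>V. T (scale_seq c x) = scale_seq c (T x))"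

definition linear_functional_on ::
  "(nat \<Rightarrow> 'a::real_normed_field) set \<Rightarrow> ((nat \<Rightarrow> 'a) \<Rightarrow> 'a) \<Rightarrow> bool"
  where "linear_functional_on V \<phi> \<longleftrightarrow>
    (\<forall>x\<in>V. \<forall>y\<in>V. \<phi> (x + y) = \<phi> x + \<phi> y) \<and> (\<forall>c. \<forall>x\<in>V. \<phi> (scale_seq c x) = c * \<phi> x)"

definition seminorm_on ::
  "(nat \<Rightarrow> 'a::real_normed_field) set \<Rightarrow> ((nat \<Rightarrow> 'a) \<Rightarrow> real) \<Rightarrow> bool"
  where "seminorm_on V p \<longleftrightarrow>
    (\<forall>x\<in>V. \<forall>y\<in>V. p (x + y) \<le> p x + p y) \<and> (\<forall>c. \<forall>x\<in>V. p (scale_seq c x) = norm c * p x)"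

definition continuous_seminorm ::
  "(nat \<Rightarrow> 'a::real_normed_field) topology \<Rightarrow> ((nat \<Rightarrow> 'a) \<Rightarrow> real) \<Rightarrow> bool"
  where "continuous_seminorm X p \<longleftrightarrow>
    seminorm_on (topspace X) p \<and> continuous_map X euclideanreal p"


subsection \<open>Koethe spaces\<close>

definition kothe_matrix :: "(nat \<Rightarrow> nat \<Rightarrow> real) \<Rightarrow> bool"
  where "kothe_matrix A \<longleftrightarrow> (\<forall>k n. 0 < A k n) \<and> (\<forall>k n. A k n \<le> A (Suc k) n)"

definition kothe :: "(nat \<Rightarrow> nat \<Rightarrow> real) \<Rightarrow> (nat \<Rightarrow> 'a::real_normed_field) set"
  where "kothe A = {x. \<forall>k. summable (\<lambda>n. norm (x n) * A k n)}"

definition kothe_norm :: "(nat \<Rightarrow> nat \<Rightarrow> real) \<Rightarrow> nat \<Rightarrow> (nat \<Rightarrow> 'a::real_normed_field) \<Rightarrow> real"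
  where "kothe_norm A k x = (\<Sum>n. norm (x n) * A k n)"

definition kothe_topology :: "(nat \<Rightarrow> nat \<Rightarrow> real) \<Rightarrow> (nat \<Rightarrow> 'a::real_normed_field) topology"
  where "kothe_topology A = topology_generated_by
    {{y \<in> kothe A. kothe_norm A k (y - x) < e} | x k e. x \<in> kothe A \<and> 0 < e}"

definition regular_matrix :: "(nat \<Rightarrow> nat \<Rightarrow> real) \<Rightarrow> bool"
  where "regular_matrix A \<longleftrightarrow>
    (\<forall>k n. A k (Suc n) / A (Suc k) (Suc n) \<le> A k n / A (Suc k) n)"

definition type_d1 :: "(nat \<Rightarrow> nat \<Rightarrow> real) \<Rightarrow> bool"
  where "type_d1 A \<longleftrightarrow> (\<exists>p. \<forall>q. \<exists>r. \<exists>C>0. \<forall>n. (A q n)\<^sup>2 \<le> C * A p n * A r n)"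


subsection \<open>Nuclear spaces and Schauder bases\<close>

text \<open>
  \<open>X\<close> is nuclear if every continuous seminorm \<open>p\<close> is dominated by a continuous seminorm \<open>q\<close> such
  that the canonical map of the local Banach spaces, from that of \<open>q\<close> to that of \<open>p\<close>, is nuclear,
  i.e. of the form \<open>x \<mapsto> \<Sum>j. \<phi> j x \<cdot> y j\<close> with \<open>\<Sum>j. \<parallel>\<phi> j\<parallel> * p (y j) < \<infinity>\<close>; here \<open>b j\<close> bounds the dual
  \<open>q\<close>-norm of \<open>\<phi> j\<close>. By density, the \<open>y j\<close> may be taken in the space itself rather than in the
  completion with respect to \<open>p\<close>. Lemma \<open>nuclear_kothe_iff\<close> below shows that for Koethe spaces
  this is the Grothendieck--Pietsch condition on the matrix.
\<close>

definition nuclear_space :: "(nat \<Rightarrow> 'a::real_normed_field) topology \<Rightarrow> bool"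
  where "nuclear_space X \<longleftrightarrow>
    (\<forall>p. continuous_seminorm X p \<longrightarrow>
      (\<exists>q. continuous_seminorm X q \<and> (\<forall>x\<in>topspace X. p x \<le> q x) \<and>
        (\<exists>(\<phi> :: nat \<Rightarrow> (nat \<Rightarrow> 'a) \<Rightarrow> 'a) (y :: nat \<Rightarrow> nat \<Rightarrow> 'a) (b :: nat \<Rightarrow> real).
          (\<forall>j. linear_functional_on (topspace X) (\<phi> j)) \<and>
          (\<forall>j. y j \<in> topspace X) \<and>
          (\<forall>j. 0 \<le> b j \<and> (\<forall>x\<in>topspace X. norm (\<phi> j x) \<le> b j * q x)) \<and>
          summable (\<lambda>j. b j * p (y j)) \<and>
          (\<forall>x\<in>topspace X. (\<lambda>N. p (x - (\<Sum>j<N. scale_seq (\<phi> j x) (y j)))) \<longlonglongrightarrow> 0))))"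

text \<open>
  A basis of length \<open>N\<close>, finite or infinite. Coefficients beyond the length are required to vanish,
  so that for finite \<open>N\<close> the partial sums are eventually \<open>\<Sum>j<N. c j \<cdot> f j\<close>.
\<close>

definition schauder_basis ::
  "(nat \<Rightarrow> 'a::real_normed_field) topology \<Rightarrow> enat \<Rightarrow> (nat \<Rightarrow> nat \<Rightarrow> 'a) \<Rightarrow> bool"
  where "schauder_basis X N f \<longleftrightarrow>
    (\<forall>j. enat j < N \<longrightarrow> f j \<in> topspace X) \<and>
    (\<forall>x\<in>topspace X. \<exists>!c :: nat \<Rightarrow> 'a.
       (\<forall>j. N \<le> enat j \<longrightarrow> c j = 0) \<and>
       limitin X (\<lambda>n. \<Sum>j<n. scale_seq (c j) (f j)) x sequentially)"

definition has_schauder_basis :: "(nat \<Rightarrow> 'a::real_normed_field) topology \<Rightarrow> bool"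
  where "has_schauder_basis X \<longleftrightarrow> (\<exists>N f. schauder_basis X N f)"


subsection \<open>Basic facts\<close>

lemma kothe_matrix_mono:
  assumes "kothe_matrix A" "k \<le> m"
  shows "A k n \<le> A m n"
  using assms(2)
proof (induction rule: dec_induct)
  case base
  then show ?case by simp
next
  case (step m)
  then show ?case using assms(1) unfolding kothe_matrix_def by (meson order_trans)
qed

lemma kothe_zero: "0 \<in> kothe A"
  by (simp add: kothe_def)

lemma kothe_scale: "x \<in> kothe A \<Longrightarrow> scale_seq c x \<in> kothe A"
  by (auto simp: kothe_def scale_seq_def norm_mult mult.assoc intro: summable_mult)

lemma kothe_add:
  assumes A: "kothe_matrix A" and "x \<in> kothe A" "y \<in> kothe A"
  shows "x + y \<in> kothe A"
  unfolding kothe_def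
proof safe
  fix k
  have "summable (\<lambda>n. norm (x n) * A k n + norm (y n) * A k n)"
    using assms by (intro summable_add) (auto simp: kothe_def)
  moreover have "norm (norm ((x + y) n) * A k n) \<le> norm (x n) * A k n + norm (y n) * A k n" for n
    using A norm_triangle_ineq[of "x n" "y n"]
    by (auto simp: kothe_matrix_def abs_mult less_imp_le mult_right_mono simp flip: distrib_right)
  ultimately show "summable (\<lambda>n. norm ((x + y) n) * A k n)"
    by (blast intro: summable_comparison_test')
qed

lemma kothe_diff:
  assumes A: "kothe_matrix A" and "x \<in> kothe A" "y \<in> kothe A"
  shows "x - y \<in> kothe A"
proof -
  have "x - y = x + scale_seq (-1) y"
    by (auto simp: scale_seq_def)
  then show ?thesis using kothe_add[OF A assms(2) kothe_scale[OF assms(3)], of "-1"] by metis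
qed

lemma kothe_sum:
  assumes "kothe_matrix A" "\<And>j. j \<in> J \<Longrightarrow> f j \<in> kothe A"
  shows "(\<Sum>j\<in>J. f j) \<in> kothe A"
  using assms(2)
  by (induction J rule: infinite_finite_induct) (auto simp: kothe_zero intro: kothe_add[OF assms(1)])

lemma kothe_norm_nonneg: "kothe_matrix A \<Longrightarrow> x \<in> kothe A \<Longrightarrow> 0 \<le> kothe_norm A k x"
  unfolding kothe_norm_def
  by (rule suminf_nonneg) (auto simp: kothe_def kothe_matrix_def less_imp_le)

lemma kothe_norm_zero [simp]: "kothe_norm A k 0 = 0"
  by (simp add: kothe_norm_def)

lemma kothe_norm_scale: "x \<in> kothe A \<Longrightarrow> kothe_norm A k (scale_seq c x) = norm c * kothe_norm A k x"
  by (simp add: kothe_norm_def scale_seq_def norm_mult mult.assoc kothe_def suminf_mult)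

lemma kothe_norm_triangle:
  assumes A: "kothe_matrix A" and "x \<in> kothe A" "y \<in> kothe A"
  shows "kothe_norm A k (x + y) \<le> kothe_norm A k x + kothe_norm A k y"
proof -
  have s: "summable (\<lambda>n. norm (x n) * A k n)" "summable (\<lambda>n. norm (y n) * A k n)"
    "summable (\<lambda>n. norm ((x + y) n) * A k n)"
    using assms kothe_add[OF assms] by (auto simp: kothe_def)
  have "norm ((x + y) n) * A k n \<le> norm (x n) * A k n + norm (y n) * A k n" for n
    using A norm_triangle_ineq[of "x n" "y n"]
    by (auto simp: kothe_matrix_def less_imp_le mult_right_mono simp flip: distrib_right)
  then show ?thesis
    unfolding kothe_norm_def suminf_add[OF s(1,2)]
    by (intro suminf_le s summable_add)
qed

lemma kothe_norm_minus_commute: "kothe_norm A k (x - y) = kothe_norm A k (y - x)"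
  by (simp add: kothe_norm_def norm_minus_commute)

lemma kothe_norm_mono:
  assumes "kothe_matrix A" "k \<le> m" "x \<in> kothe A"
  shows "kothe_norm A k x \<le> kothe_norm A m x"
  unfolding kothe_norm_def using assms
  by (intro suminf_le) (auto simp: kothe_def kothe_matrix_mono mult_left_mono)

lemma kothe_norm_dist_triangle:
  assumes "kothe_matrix A" "x \<in> kothe A" "y \<in> kothe A" "z \<in> kothe A"
  shows "kothe_norm A k (x - z) \<le> kothe_norm A k (x - y) + kothe_norm A k (y - z)"
proof -
  have "x - z = (x - y) + (y - z)" by auto
  then show ?thesis
    using kothe_norm_triangle[OF assms(1) kothe_diff kothe_diff, of x y y z] assms by simp
qed

lemma kothe_norm_coord:
  assumes "kothe_matrix A" "x \<in> kothe A"
  shows "norm (x n) * A k n \<le> kothe_norm A k x"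
  using sum_le_suminf[of "\<lambda>n. norm (x n) * A k n" "{n}"] assms
  by (auto simp: kothe_norm_def kothe_def kothe_matrix_def less_imp_le)

lemma topspace_kothe [simp]: "topspace (kothe_topology A) = kothe A"
  unfolding kothe_topology_def topology_generated_by_topspace
proof (rule equalityI; rule subsetI)
  fix x :: "nat \<Rightarrow> 'a" assume "x \<in> kothe A"
  then show "x \<in> \<Union>{{y \<in> kothe A. kothe_norm A k (y - x) < e} | x k e. x \<in> kothe A \<and> 0 < e}"
    by (intro UnionI[of "{y \<in> kothe A. kothe_norm A 0 (y - x) < 1}"] CollectI exI[of _ x] exI[of _ 0] exI[of _ 1])
       (simp_all add: kothe_norm_def)
qed auto

lemma openin_kothe_iff:
  assumes A: "kothe_matrix A"
  shows "openin (kothe_topology A) U \<longleftrightarrow>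
    U \<subseteq> kothe A \<and> (\<forall>x\<in>U. \<exists>k. \<exists>e>0. \<forall>y\<in>kothe A. kothe_norm A k (y - x) < e \<longrightarrow> y \<in> U)"
    (is "_ \<longleftrightarrow> ?R U")
proof
  assume "openin (kothe_topology A) U"
  then have "generate_topology_on
    {{y \<in> kothe A. kothe_norm A k (y - x) < e} | x k e. x \<in> kothe A \<and> 0 < e} U"
    unfolding kothe_topology_def openin_topology_generated_by_iff .
  then show "?R U"
  proof induction
    case Empty
    then show ?case by simp
  next
    case (Int U V)
    show ?case
    proof (intro conjI ballI)
      show "U \<inter> V \<subseteq> kothe A" using Int by blast
      fix x assume x: "x \<in> U \<inter> V"
      obtain k e where k: "e > 0" "\<forall>y\<in>kothe A. kothe_norm A k (y - x) < e \<longrightarrow> y \<in> U"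
        using Int x by blast
      obtain l d where l: "d > 0" "\<forall>y\<in>kothe A. kothe_norm A l (y - x) < d \<longrightarrow> y \<in> V"
        using Int x by blast
      have "x \<in> kothe A" using Int x by blast
      then have "kothe_norm A k (y - x) \<le> kothe_norm A (max k l) (y - x)"
        "kothe_norm A l (y - x) \<le> kothe_norm A (max k l) (y - x)" if "y \<in> kothe A" for y
        using that by (auto intro!: kothe_norm_mono A kothe_diff)
      then have "\<forall>y\<in>kothe A. kothe_norm A (max k l) (y - x) < min e d \<longrightarrow> y \<in> U \<inter> V"
        using k l by (metis Int_iff le_less_trans min_less_iff_conj)
      then show "\<exists>k. \<exists>e>0. \<forall>y\<in>kothe A. kothe_norm A k (y - x) < e \<longrightarrow> y \<in> U \<inter> V"
        using k(1) l(1) by (meson min_less_iff_conj)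
    qed
  next
    case (UN K)
    show ?case
    proof (intro conjI ballI)
      show "\<Union>K \<subseteq> kothe A" using UN by blast
      fix x assume "x \<in> \<Union>K"
      then obtain V where V: "V \<in> K" "x \<in> V" by blast
      then obtain k e where "e > 0" "\<forall>y\<in>kothe A. kothe_norm A k (y - x) < e \<longrightarrow> y \<in> V"
        using UN by blast
      then show "\<exists>k. \<exists>e>0. \<forall>y\<in>kothe A. kothe_norm A k (y - x) < e \<longrightarrow> y \<in> \<Union>K"
        using V(1) by blast
    qed
  next
    case (Basis U)
    then obtain z k e where U: "U = {y \<in> kothe A. kothe_norm A k (y - z) < e}"
      and z: "z \<in> kothe A" "0 < e" by auto
    show ?case
    proof (intro conjI ballI)
      show "U \<subseteq> kothe A" using U by blast
      fix x assume x: "x \<in> U"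
      define d where "d = e - kothe_norm A k (x - z)"
      have "d > 0" using x U d_def by simp
      moreover have "y \<in> U" if "y \<in> kothe A" "kothe_norm A k (y - x) < d" for y
        using kothe_norm_dist_triangle[OF A, of y x z k] that x z unfolding U d_def by auto
      ultimately show "\<exists>k. \<exists>e>0. \<forall>y\<in>kothe A. kothe_norm A k (y - x) < e \<longrightarrow> y \<in> U" by blast
    qed
  qed
next
  assume R: "?R U"
  define K where "K = {V. V \<subseteq> U \<and> openin (kothe_topology A) V}"
  have "U \<subseteq> \<Union>K"
  proof
    fix x assume x: "x \<in> U"
    then obtain k e where ke: "e > 0" "\<forall>y\<in>kothe A. kothe_norm A k (y - x) < e \<longrightarrow> y \<in> U"
      using R by blast
    have xA: "x \<in> kothe A" using R x by blast
    have "openin (kothe_topology A) {y \<in> kothe A. kothe_norm A k (y - x) < e}"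
      unfolding kothe_topology_def using xA ke(1) by (intro topology_generated_by_Basis) blast
    then have "{y \<in> kothe A. kothe_norm A k (y - x) < e} \<in> K" using ke K_def by blast
    moreover have "x \<in> {y \<in> kothe A. kothe_norm A k (y - x) < e}" using xA ke(1) by simp
    ultimately show "x \<in> \<Union>K" by blast
  qed
  then have "U = \<Union>K" using K_def by blast
  then show "openin (kothe_topology A) U" using K_def by (metis (mono_tags) mem_Collect_eq openin_Union)
qed

lemma continuous_seminorm_bounded:
  assumes A: "kothe_matrix A" and p: "continuous_seminorm (kothe_topology A) p"
  obtains k C where "C > 0" "\<And>x. x \<in> kothe A \<Longrightarrow> p x \<le> C * kothe_norm A k x"
proof -
  have sn: "\<And>c x. x \<in> kothe A \<Longrightarrow> p (scale_seq c x) = norm c * p x"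
    using p by (auto simp: continuous_seminorm_def seminorm_on_def)
  have p0: "p 0 = 0" using sn[OF kothe_zero, of 0] by (simp add: scale_seq_def zero_fun_def)
  have "openin (kothe_topology A) {x \<in> topspace (kothe_topology A). p x \<in> {..<1}}"
    using p unfolding continuous_seminorm_def
    by (intro openin_continuous_map_preimage[of _ euclideanreal]) auto
  then have "openin (kothe_topology A) {x \<in> kothe A. p x < 1}" by simp
  moreover have "0 \<in> {x \<in> kothe A. p x < 1}" using p0 by (simp add: kothe_zero)
  ultimately obtain k e where e: "e > 0"
    "\<And>y. y \<in> kothe A \<Longrightarrow> kothe_norm A k (y - 0) < e \<Longrightarrow> y \<in> {x \<in> kothe A. p x < 1}"
    unfolding openin_kothe_iff[OF A] by meson
  have "p x \<le> (2 / e) * kothe_norm A k x" if x: "x \<in> kothe A" for x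
  proof -
    have *: "r * p x < 1" if "r \<ge> 0" "r * kothe_norm A k x < e" for r
    proof -
      have "kothe_norm A k (scale_seq (of_real r) x) < e"
        using that by (simp add: kothe_norm_scale[OF x])
      then have "p (scale_seq (of_real r) x) < 1"
        using e(2)[of "scale_seq (of_real r) x"] kothe_scale[OF x] by simp
      then show ?thesis using that by (simp add: sn[OF x])
    qed
    show ?thesis
    proof (cases "kothe_norm A k x = 0")
      case True
      have "p x \<le> 0"
      proof (rule ccontr)
        assume "\<not> p x \<le> 0"
        then show False using *[of "1 / p x"] True e(1) by simp
      qed
      then show ?thesis using True by simp
    next
      case False
      then have pos: "kothe_norm A k x > 0" using kothe_norm_nonneg[OF A x, of k] by simp
      have "e / (2 * kothe_norm A k x) * p x < 1"
        by (rule *) (use pos e(1) in auto)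
      then show ?thesis using pos e(1) by (simp add: field_simps)
    qed
  qed
  then show ?thesis using that[of "2 / e" k] e(1) by simp
qed

lemma continuous_seminorm_kothe_norm:
  assumes A: "kothe_matrix A" and C: "0 < C"
  shows "continuous_seminorm (kothe_topology A) (\<lambda>x :: nat \<Rightarrow> 'a::real_normed_field. C * kothe_norm A k x)"
  unfolding continuous_seminorm_def
proof
  show "seminorm_on (topspace (kothe_topology A)) (\<lambda>x :: nat \<Rightarrow> 'a. C * kothe_norm A k x)"
    using C by (auto simp: seminorm_on_def kothe_norm_scale kothe_norm_triangle[OF A] simp flip: distrib_left)
  have lip: "\<bar>kothe_norm A k y - kothe_norm A k x\<bar> \<le> kothe_norm A k (y - x)"
    if "x \<in> kothe A" "y \<in> kothe A" for x y :: "nat \<Rightarrow> 'a"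
    using kothe_norm_triangle[OF A that(1) kothe_diff[OF A that(2,1)], of k]
      kothe_norm_triangle[OF A that(2) kothe_diff[OF A that], of k]
      kothe_norm_minus_commute[of A k x y] by simp
  show "continuous_map (kothe_topology A) euclideanreal (\<lambda>x :: nat \<Rightarrow> 'a. C * kothe_norm A k x)"
    unfolding continuous_map_def
  proof (intro conjI allI impI)
    fix U :: "real set" assume "openin euclideanreal U"
    then have U: "open U" by simp
    show "openin (kothe_topology A) {x \<in> topspace (kothe_topology A). C * kothe_norm A k (x :: nat \<Rightarrow> 'a) \<in> U}"
      unfolding openin_kothe_iff[OF A]
    proof (intro conjI ballI)
      fix x :: "nat \<Rightarrow> 'a"
      assume "x \<in> {x \<in> topspace (kothe_topology A). C * kothe_norm A k x \<in> U}"
      then have x: "x \<in> kothe A" "C * kothe_norm A k x \<in> U" by auto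
      obtain e where e: "e > 0" "\<And>t. \<bar>t - C * kothe_norm A k x\<bar> < e \<Longrightarrow> t \<in> U"
        using U x(2) by (auto simp: open_dist dist_real_def)
      have "C * kothe_norm A k y \<in> U" if y: "y \<in> kothe A" "kothe_norm A k (y - x) < e / C" for y
      proof (rule e(2))
        have "\<bar>C * kothe_norm A k y - C * kothe_norm A k x\<bar> = C * \<bar>kothe_norm A k y - kothe_norm A k x\<bar>"
          using C by (simp add: abs_mult flip: right_diff_distrib)
        also have "\<dots> \<le> C * kothe_norm A k (y - x)" using lip[OF x(1) y(1)] C by simp
        also have "\<dots> < e" using y(2) C by (simp add: field_simps)
        finally show "\<bar>C * kothe_norm A k y - C * kothe_norm A k x\<bar> < e" .
      qed
      then show "\<exists>k'. \<exists>e>0. \<forall>y\<in>kothe A. kothe_norm A k' (y - x) < e \<longrightarrow>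
          y \<in> {x \<in> topspace (kothe_topology A). C * kothe_norm A k x \<in> U}"
        using e(1) C by (intro exI[of _ k] exI[of _ "e / C"]) auto
    qed auto
  qed auto
qed

definition unit_seq :: "nat \<Rightarrow> nat \<Rightarrow> 'a::real_normed_field"
  where "unit_seq n = (\<lambda>i. if i = n then 1 else 0)"

lemma unit_seq_sums: "(\<lambda>i. norm (unit_seq n i :: 'a::real_normed_field) * A k i) sums A k n"
proof -
  have "(\<lambda>i. norm (unit_seq n i :: 'a) * A k i) = (\<lambda>i. if i = n then A k i else 0)"
    by (auto simp: unit_seq_def)
  then show ?thesis using sums_single[of n "A k"] by (simp only:)
qed

lemma unit_seq_kothe: "unit_seq n \<in> kothe A"
  by (auto simp: kothe_def intro: sums_summable[OF unit_seq_sums])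

lemma kothe_norm_unit_seq: "kothe_norm A k (unit_seq n) = A k n"
  unfolding kothe_norm_def by (rule sums_unique[OF unit_seq_sums, symmetric])

lemma sum_fun_apply: "(\<Sum>j\<in>J. f j) i = (\<Sum>j\<in>J. f j i)"
  by (induction J rule: infinite_finite_induct) auto

lemma kothe_norm_tail:
  assumes A: "kothe_matrix A" and x: "x \<in> kothe A"
  shows "(\<lambda>N. kothe_norm A k (x - (\<Sum>j<N. scale_seq (x j) (unit_seq j)))) \<longlonglongrightarrow> 0"
proof -
  have s: "summable (\<lambda>n. norm (x n) * A k n)" using x by (simp add: kothe_def)
  have "kothe_norm A k (x - (\<Sum>j<N. scale_seq (x j) (unit_seq j))) =
      kothe_norm A k x - (\<Sum>n<N. norm (x n) * A k n)" for N
  proof -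
    have "(x - (\<Sum>j<N. scale_seq (x j) (unit_seq j))) i = (if i < N then 0 else x i)" for i
      by (simp add: sum_fun_apply scale_seq_def unit_seq_def if_distrib cong: if_cong)
    then have "kothe_norm A k (x - (\<Sum>j<N. scale_seq (x j) (unit_seq j))) =
        (\<Sum>n. if n < N then 0 else norm (x n) * A k n)"
      unfolding kothe_norm_def by (intro suminf_cong) simp
    also have "\<dots> = (\<Sum>n. norm (x n) * A k n - (if n \<in> {..<N} then norm (x n) * A k n else 0))"
      by (intro suminf_cong) auto
    also have "\<dots> = (\<Sum>n. norm (x n) * A k n) - (\<Sum>n. if n \<in> {..<N} then norm (x n) * A k n else 0)"
      using sums_If_finite_set[of "{..<N}" "\<lambda>n. norm (x n) * A k n"]
      by (intro suminf_diff[symmetric] s) (auto simp: sums_iff)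
    also have "\<dots> = kothe_norm A k x - (\<Sum>n<N. norm (x n) * A k n)"
      using sums_If_finite_set[of "{..<N}" "\<lambda>n. norm (x n) * A k n"]
      by (auto simp: sums_iff kothe_norm_def)
    finally show ?thesis .
  qed
  moreover have "(\<lambda>N. kothe_norm A k x - (\<Sum>n<N. norm (x n) * A k n)) \<longlonglongrightarrow> kothe_norm A k x - kothe_norm A k x"
    unfolding kothe_norm_def by (intro tendsto_diff tendsto_const summable_LIMSEQ s)
  ultimately show ?thesis by simp
qed

theorem nuclear_kothe_iff:
  assumes A: "kothe_matrix A"
  shows "nuclear_space (kothe_topology A :: (nat \<Rightarrow> 'a::real_normed_field) topology) \<longleftrightarrow>
    (\<forall>k. \<exists>m. summable (\<lambda>n. A k n / A m n))"
proof
  assume nuc: "nuclear_space (kothe_topology A :: (nat \<Rightarrow> 'a) topology)"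
  have Apos: "\<And>k n. 0 < A k n" using A by (simp add: kothe_matrix_def)
  show "\<forall>k. \<exists>m. summable (\<lambda>n. A k n / A m n)"
  proof
    fix k
    define p where "p = (\<lambda>x :: nat \<Rightarrow> 'a. kothe_norm A k x)"
    have "continuous_seminorm (kothe_topology A) p"
      using continuous_seminorm_kothe_norm[OF A, of 1 k] by (simp add: p_def)
    note ex = nuc[unfolded nuclear_space_def topspace_kothe, rule_format, OF this]
    obtain q and \<phi> :: "nat \<Rightarrow> (nat \<Rightarrow> 'a) \<Rightarrow> 'a" and y :: "nat \<Rightarrow> nat \<Rightarrow> 'a" and b :: "nat \<Rightarrow> real"
      where q: "continuous_seminorm (kothe_topology A) q"
      and y': "\<forall>j. y j \<in> kothe A"
      and b': "\<forall>j. 0 \<le> b j \<and> (\<forall>x\<in>kothe A. norm (\<phi> j x) \<le> b j * q x)"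
      and s: "summable (\<lambda>j. b j * p (y j))"
      and lim': "\<forall>x\<in>kothe A. (\<lambda>N. p (x - (\<Sum>j<N. scale_seq (\<phi> j x) (y j)))) \<longlonglongrightarrow> 0"
      by (rule exE[OF ex], elim exE conjE, rule that; assumption)
    have y: "\<And>j. y j \<in> kothe A" and b: "\<And>j. 0 \<le> b j"
      "\<And>j x. x \<in> kothe A \<Longrightarrow> norm (\<phi> j x) \<le> b j * q x"
      and lim: "\<And>x. x \<in> kothe A \<Longrightarrow> (\<lambda>N. p (x - (\<Sum>j<N. scale_seq (\<phi> j x) (y j)))) \<longlonglongrightarrow> 0"
      using y' b' lim' by simp_all
    obtain m C where C: "C > 0" "\<And>x. x \<in> kothe A \<Longrightarrow> q x \<le> C * kothe_norm A m x"
      using continuous_seminorm_bounded[OF A q] by blast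
    have yco: "norm (y j n) * A k n \<le> p (y j)" for j n
      unfolding p_def by (rule kothe_norm_coord[OF A y])
    have sb: "summable (\<lambda>j. b j * (norm (y j n) * A k n))" for n
      using yco b(1) Apos[of k n]
      by (intro summable_comparison_test'[OF s, of 0])
         (auto simp: abs_mult intro!: mult_left_mono)
    have diag: "A k n / A m n \<le> C * (\<Sum>j. b j * (norm (y j n) * A k n))" for n
    proof -
      define u where "u = (unit_seq n :: nat \<Rightarrow> 'a)"
      have u: "u \<in> kothe A" by (simp add: u_def unit_seq_kothe)
      have qu: "q u \<le> C * A m n" using C(2)[OF u] by (simp add: u_def kothe_norm_unit_seq)
      define S where "S = (\<Sum>j. b j * (norm (y j n) * A k n))"
      have le: "A k n \<le> p (u - (\<Sum>j<N. scale_seq (\<phi> j u) (y j))) + C * A m n * S" for N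
      proof -
        let ?z = "\<Sum>j<N. scale_seq (\<phi> j u) (y j)"
        have z: "u - ?z \<in> kothe A" by (intro kothe_diff kothe_sum kothe_scale A u y)
        have "A k n = norm (u n) * A k n" by (simp add: u_def unit_seq_def)
        also have "\<dots> \<le> (norm ((u - ?z) n) + norm (?z n)) * A k n"
          using Apos[of k n] norm_triangle_sub[of "u n" "?z n"] by (intro mult_right_mono) auto
        also have "\<dots> \<le> p (u - ?z) + norm (?z n) * A k n"
          using kothe_norm_coord[OF A z, of n k] by (simp add: p_def distrib_right)
        also have "norm (?z n) * A k n \<le> (\<Sum>j<N. norm (\<phi> j u * y j n)) * A k n"
          using Apos[of k n] by (intro mult_right_mono)
            (auto simp: sum_fun_apply scale_seq_def intro: norm_sum)
        also have "\<dots> = (\<Sum>j<N. norm (\<phi> j u) * (norm (y j n) * A k n))"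
          by (simp add: sum_distrib_right norm_mult mult.assoc)
        also have "\<dots> \<le> (\<Sum>j<N. (b j * (C * A m n)) * (norm (y j n) * A k n))"
        proof (intro sum_mono mult_right_mono)
          fix j
          have "norm (\<phi> j u) \<le> b j * q u" by (rule b(2)[OF u])
          also have "\<dots> \<le> b j * (C * A m n)" using b(1) qu by (intro mult_left_mono)
          finally show "norm (\<phi> j u) \<le> b j * (C * A m n)" .
        qed (use Apos[of k n] in auto)
        also have "\<dots> = C * A m n * (\<Sum>j<N. b j * (norm (y j n) * A k n))"
          by (simp add: sum_distrib_left mult_ac)
        also have "\<dots> \<le> C * A m n * S"
          unfolding S_def using C(1) Apos[of m n] Apos[of k n] b(1)
          by (intro mult_left_mono sum_le_suminf sb) auto
        finally show ?thesis by (simp add: fun_diff_def)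
      qed
      have "(\<lambda>N. p (u - (\<Sum>j<N. scale_seq (\<phi> j u) (y j))) + C * A m n * S) \<longlonglongrightarrow> 0 + C * A m n * S"
        by (intro tendsto_add lim u tendsto_const)
      then have "A k n \<le> 0 + C * A m n * S"
        by (rule LIMSEQ_le_const) (intro exI[of _ 0] allI impI le)
      then show ?thesis using Apos[of m n] unfolding S_def by (simp add: field_simps)
    qed
    have "summable (\<lambda>n. A k n / A m n)"
    proof (rule summableI_nonneg_bounded)
      fix N
      have "(\<Sum>n<N. A k n / A m n) \<le> (\<Sum>n<N. C * (\<Sum>j. b j * (norm (y j n) * A k n)))"
        by (intro sum_mono diag)
      also have "\<dots> = C * (\<Sum>j. \<Sum>n<N. b j * (norm (y j n) * A k n))"
        unfolding suminf_sum[OF sb] by (rule sum_distrib_left[symmetric])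
      also have "\<dots> \<le> C * (\<Sum>j. b j * p (y j))"
      proof (intro mult_left_mono suminf_le summable_sum sb s)
        fix j
        have "(\<Sum>n<N. norm (y j n) * A k n) \<le> p (y j)"
          unfolding p_def kothe_norm_def using y[of j] Apos
          by (intro sum_le_suminf) (auto simp: kothe_def less_imp_le)
        then show "(\<Sum>n<N. b j * (norm (y j n) * A k n)) \<le> b j * p (y j)"
          using b(1) by (simp add: mult_left_mono flip: sum_distrib_left)
      qed (use C in auto)
      finally show "(\<Sum>n<N. A k n / A m n) \<le> C * (\<Sum>j. b j * p (y j))" .
    qed (use Apos in \<open>auto simp: less_imp_le\<close>)
    then show "\<exists>m. summable (\<lambda>n. A k n / A m n)" ..
  qed
next
  assume GP: "\<forall>k. \<exists>m. summable (\<lambda>n. A k n / A m n)"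
  have Apos: "\<And>k n. 0 < A k n" using A by (simp add: kothe_matrix_def)
  show "nuclear_space (kothe_topology A :: (nat \<Rightarrow> 'a) topology)"
    unfolding nuclear_space_def topspace_kothe
  proof (intro allI impI)
    fix p :: "(nat \<Rightarrow> 'a) \<Rightarrow> real"
    assume p: "continuous_seminorm (kothe_topology A) p"
    obtain k C where C: "C > 0" "\<And>x. x \<in> kothe A \<Longrightarrow> p x \<le> C * kothe_norm A k x"
      using continuous_seminorm_bounded[OF A p] by blast
    obtain m0 where "summable (\<lambda>n. A k n / A m0 n)" using GP by blast
    define m where "m = max k m0"
    have sm: "summable (\<lambda>n. A k n / A m n)"
      using Apos by (intro summable_comparison_test'[OF \<open>summable (\<lambda>n. A k n / A m0 n)\<close>, of 0])
        (auto simp: m_def less_imp_le intro!: divide_left_mono kothe_matrix_mono[OF A])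
    have p_nonneg: "0 \<le> p x" if x: "x \<in> kothe A" for x
    proof -
      have h: "p (scale_seq c x) = norm c * p x" for c
        using p x by (auto simp: continuous_seminorm_def seminorm_on_def)
      have "p (x + scale_seq (-1) x) \<le> p x + p (scale_seq (-1) x)"
        using p x kothe_scale[OF x]
        unfolding continuous_seminorm_def seminorm_on_def topspace_kothe by blast
      moreover have "x + scale_seq (-1) x = scale_seq 0 x" by (auto simp: scale_seq_def)
      ultimately show ?thesis by (simp add: h)
    qed
    define q where "q = (\<lambda>x :: nat \<Rightarrow> 'a. C * kothe_norm A m x)"
    define \<phi> where "\<phi> = (\<lambda>j (x :: nat \<Rightarrow> 'a). x j)"
    define b where "b = (\<lambda>j. 1 / (C * A m j))"
    show "\<exists>q. continuous_seminorm (kothe_topology A) q \<and> (\<forall>x\<in>kothe A. p x \<le> q x) \<and>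
        (\<exists>(\<phi> :: nat \<Rightarrow> (nat \<Rightarrow> 'a) \<Rightarrow> 'a) (y :: nat \<Rightarrow> nat \<Rightarrow> 'a) (b :: nat \<Rightarrow> real).
          (\<forall>j. linear_functional_on (kothe A) (\<phi> j)) \<and>
          (\<forall>j. y j \<in> kothe A) \<and>
          (\<forall>j. 0 \<le> b j \<and> (\<forall>x\<in>kothe A. norm (\<phi> j x) \<le> b j * q x)) \<and>
          summable (\<lambda>j. b j * p (y j)) \<and>
          (\<forall>x\<in>kothe A. (\<lambda>N. p (x - (\<Sum>j<N. scale_seq (\<phi> j x) (y j)))) \<longlonglongrightarrow> 0))"
    proof (intro exI[of _ q] exI[of _ \<phi>] exI[of _ unit_seq] exI[of _ b] conjI allI ballI)
      show "continuous_seminorm (kothe_topology A) q"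
        unfolding q_def by (rule continuous_seminorm_kothe_norm[OF A C(1)])
      show "p x \<le> q x" if "x \<in> kothe A" for x
        using C(2)[OF that] kothe_norm_mono[OF A _ that, of k m] C(1)
        unfolding q_def m_def by (smt (verit) max.cobounded1 mult_left_mono)
      show "linear_functional_on (kothe A) (\<phi> j)" for j
        by (auto simp: linear_functional_on_def \<phi>_def scale_seq_def)
      show "unit_seq j \<in> kothe A" for j by (rule unit_seq_kothe)
      show "0 \<le> b j" for j using C(1) Apos[of m j] by (simp add: b_def)
      show "norm (\<phi> j x) \<le> b j * q x" if "x \<in> kothe A" for j x
        using kothe_norm_coord[OF A that, of j m] C(1) Apos[of m j]
        by (simp add: b_def q_def \<phi>_def field_simps)
      show "summable (\<lambda>j. b j * p (unit_seq j))"
      proof (rule summable_comparison_test'[OF sm, of 0])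
        fix n
        have "p (unit_seq n) \<le> C * A k n" using C(2)[OF unit_seq_kothe, of n] by (simp add: kothe_norm_unit_seq)
        then show "norm (b n * p (unit_seq n)) \<le> A k n / A m n"
          using p_nonneg[OF unit_seq_kothe, of n] C(1) Apos[of m n] by (simp add: b_def field_simps)
      qed
      show "(\<lambda>N. p (x - (\<Sum>j<N. scale_seq (\<phi> j x) (unit_seq j)))) \<longlonglongrightarrow> 0" if x: "x \<in> kothe A" for x
      proof (rule tendsto_sandwich[OF _ _ tendsto_const])
        have in_kothe: "x - (\<Sum>j<N. scale_seq (\<phi> j x) (unit_seq j)) \<in> kothe A" for N
          by (intro kothe_diff kothe_sum kothe_scale A x unit_seq_kothe)
        show "\<forall>\<^sub>F N in sequentially. 0 \<le> p (x - (\<Sum>j<N. scale_seq (\<phi> j x) (unit_seq j)))"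
          by (intro always_eventually allI p_nonneg in_kothe)
        show "\<forall>\<^sub>F N in sequentially. p (x - (\<Sum>j<N. scale_seq (\<phi> j x) (unit_seq j)))
            \<le> C * kothe_norm A k (x - (\<Sum>j<N. scale_seq (\<phi> j x) (unit_seq j)))"
          by (intro always_eventually allI C(2) in_kothe)
        show "(\<lambda>N. C * kothe_norm A k (x - (\<Sum>j<N. scale_seq (\<phi> j x) (unit_seq j)))) \<longlonglongrightarrow> 0"
          using tendsto_mult[OF tendsto_const[of C] kothe_norm_tail[OF A x, of k]] by (simp add: \<phi>_def)
      qed
    qed
  qed
qed

end

theory Submission
  imports Defs
begin

text \<open>
  Condition (d1) provides a Hilbert norm \<open>n0\<close> on the range that is dominating in the sense of (DN).
  For large \<open>t\<close> the range contains a finite-dimensional cut \<open>S t\<close> which satisfies, for finitely many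
  \<open>k\<close> at once, a Bernstein inequality (on \<open>S t\<close> the norm \<open>k\<close> is at most \<open>b (k + 1) t\<close> times \<open>n0\<close>)
  and a Jackson inequality (the \<open>n0\<close>-distance to \<open>S t\<close> is at most the norm \<open>k + 1\<close> over \<open>b k t\<close>).
  It is an orthogonal sum of layers, one for each \<open>k\<close>, obtained by truncating the singular values of
  \<open>T\<close> on the first unit vectors; regularity and a pigeonhole argument give an order of the layers in
  which the estimates for one do not spoil those for the others.
  These cuts are not nested, but tilting a cut so as to contain an earlier one costs little.
  Refining pairs of cuts, by induction on the number of norms taken care of, gives an increasing flag
  \<open>U i\<close> such that the Bernstein constant of \<open>U (i + 1)\<close> times the Jackson constant of \<open>U i\<close> tends to 0
  for every norm. By (DN), orthogonal expansions along the flag, and also within its steps, then converge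
  in every norm, so that an \<open>n0\<close>-orthonormal basis adapted to the flag is a Schauder basis.
\<close>

subsection \<open>Inner product spaces\<close>

text \<open>Between two distant levels intermediate cuts are needed, but how many depends on the
  norm: a step that is short when measured by \<open>b k\<close> may be long when measured by
  \<open>b (k + 1)\<close>. Hence no single sequence of levels is prepared for all norms, and links
  must survive later insertions. The number of insertions is not bounded in advance, so errors must
  not pile up. Levels are therefore inserted from the right end downwards, each new cut being tilted
  against the same left cut, and each insertion takes a square root of the level: one more
  projection in \<open>\<Phi>\<close> then stays within the weaker bound required at the lower
  level. Inside one cut the obstacle is that truncating singular values controls a single norm, and
  layers for different norms disturb each other unless their positions are separated by powers of
  the thresholds. Regularity gives bounds in lower norms by splitting the coordinates at a position.
  Nuclearity makes sup norms, summed norms and Hilbert norms interchangeable, so that orthogonality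
  and coordinatewise bounds are both at hand.\<close>

text \<open>The identity for real scalars, conjugation for complex ones.\<close>

locale conj_scalar =
  fixes cj :: "'a::{real_normed_field,heine_borel} \<Rightarrow> 'a"
  assumes cj_add: "cj (x + y) = cj x + cj y"
    and cj_mult: "cj (x * y) = cj x * cj y"
    and cj_cj: "cj (cj x) = x"
    and cj_of_real: "cj (of_real r) = of_real r"
    and mult_cj: "x * cj x = of_real ((norm x)\<^sup>2)"
begin

lemma cj_0 [simp]: "cj 0 = 0"
  using cj_of_real[of 0] by simp

lemma cj_minus: "cj (- x) = - cj x"
  using cj_add[of x "- x"] by (simp add: add_eq_0_iff)

lemma cj_diff: "cj (x - y) = cj x - cj y"
  using cj_add[of x "- y"] by (simp add: cj_minus)

lemma cj_sum: "cj (sum f J) = (\<Sum>j\<in>J. cj (f j))"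
  by (induction J rule: infinite_finite_induct) (auto simp: cj_add)

lemma norm_cj [simp]: "norm (cj x) = norm x"
proof (cases "x = 0")
  case False
  have "norm x * norm (cj x) = (norm x)\<^sup>2"
    using arg_cong[OF mult_cj[of x], of norm] unfolding norm_of_real norm_mult by simp
  then show ?thesis using False by (simp add: power2_eq_square)
qed simp

lemma cj_eq_0_iff [simp]: "cj x = 0 \<longleftrightarrow> x = 0"
  by (metis norm_cj norm_eq_zero)

lemma continuous_on_cj: "continuous_on S cj"
  unfolding continuous_on_iff
proof (intro ballI allI impI)
  fix x e assume "x \<in> S" "(0::real) < e"
  then show "\<exists>d>0. \<forall>x'\<in>S. dist x' x < d \<longrightarrow> dist (cj x') (cj x) < e"
    by (intro exI[of _ e]) (simp add: dist_norm flip: cj_diff)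
qed

end

text \<open>The range is only a subset of a type of sequences, hence everything is relative to a
  carrier \<open>V\<close>. Positivity is phrased through \<open>of_real\<close>, as the scalar type
  carries no order.\<close>

locale ips = conj_scalar cj + vector_space sc
  for cj :: "'a::{real_normed_field,heine_borel} \<Rightarrow> 'a" and sc :: "'a \<Rightarrow> 'v::ab_group_add \<Rightarrow> 'v" +
  fixes V :: "'v set" and ip :: "'v \<Rightarrow> 'v \<Rightarrow> 'a"
  assumes V_sub: "subspace V"
    and ip_add: "x \<in> V \<Longrightarrow> y \<in> V \<Longrightarrow> z \<in> V \<Longrightarrow> ip (x + y) z = ip x z + ip y z"
    and ip_sc: "x \<in> V \<Longrightarrow> z \<in> V \<Longrightarrow> ip (sc c x) z = c * ip x z"
    and ip_cj: "x \<in> V \<Longrightarrow> y \<in> V \<Longrightarrow> ip y x = cj (ip x y)"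
    and ip_real: "x \<in> V \<Longrightarrow> \<exists>r\<ge>0. ip x x = of_real r"
    and ip_def: "x \<in> V \<Longrightarrow> ip x x = 0 \<Longrightarrow> x = 0"
begin

definition n0 :: "'v \<Rightarrow> real" where "n0 x = sqrt (norm (ip x x))"

lemma V_0 [simp]: "0 \<in> V" using V_sub by (rule subspace_0)
lemma V_add: "x \<in> V \<Longrightarrow> y \<in> V \<Longrightarrow> x + y \<in> V" using V_sub by (rule subspace_add)
lemma V_diff: "x \<in> V \<Longrightarrow> y \<in> V \<Longrightarrow> x - y \<in> V" using V_sub by (rule subspace_diff)
lemma V_sc: "x \<in> V \<Longrightarrow> sc c x \<in> V" using V_sub by (rule subspace_scale)
lemma V_sum: "(\<And>i. i \<in> I \<Longrightarrow> f i \<in> V) \<Longrightarrow> sum f I \<in> V" using V_sub by (rule subspace_sum)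

lemma span_V: "B \<subseteq> V \<Longrightarrow> span B \<subseteq> V"
  using V_sub by (rule span_minimal[rotated])

lemma ip_add2: "x \<in> V \<Longrightarrow> y \<in> V \<Longrightarrow> z \<in> V \<Longrightarrow> ip x (y + z) = ip x y + ip x z"
  using ip_cj[of "y + z" x] ip_cj[of y x] ip_cj[of z x] ip_add[of y z x] V_add[of y z]
  by (simp add: cj_add)

lemma ip_sc2: "x \<in> V \<Longrightarrow> y \<in> V \<Longrightarrow> ip x (sc c y) = cj c * ip x y"
  using ip_cj[of "sc c y" x] ip_cj[of y x] ip_sc[of y x c] V_sc[of y c]
  by (simp add: cj_mult)

lemma ip_zero [simp]: "z \<in> V \<Longrightarrow> ip 0 z = 0" "z \<in> V \<Longrightarrow> ip z 0 = 0"
  using ip_add[of 0 0 z] ip_add2[of z 0 0] by auto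

lemma ip_diff: "x \<in> V \<Longrightarrow> y \<in> V \<Longrightarrow> z \<in> V \<Longrightarrow> ip (x - y) z = ip x z - ip y z"
  using ip_add[of "x - y" y z] V_diff[of x y] by simp

lemma ip_diff2: "x \<in> V \<Longrightarrow> y \<in> V \<Longrightarrow> z \<in> V \<Longrightarrow> ip x (y - z) = ip x y - ip x z"
  using ip_add2[of x "y - z" z] V_diff[of y z] by simp

lemma ip_sum: "(\<And>i. i \<in> I \<Longrightarrow> f i \<in> V) \<Longrightarrow> z \<in> V \<Longrightarrow> ip (sum f I) z = (\<Sum>i\<in>I. ip (f i) z)"
  by (induction I rule: infinite_finite_induct) (auto simp: ip_add V_sum)

lemma ip_sum2: "(\<And>i. i \<in> I \<Longrightarrow> f i \<in> V) \<Longrightarrow> z \<in> V \<Longrightarrow> ip z (sum f I) = (\<Sum>i\<in>I. ip z (f i))"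
  by (induction I rule: infinite_finite_induct) (auto simp: ip_add2 V_sum)

lemma ip_0_sym: "x \<in> V \<Longrightarrow> y \<in> V \<Longrightarrow> ip x y = 0 \<longleftrightarrow> ip y x = 0"
  using ip_cj[of x y] by simp

lemma n0_sq: "x \<in> V \<Longrightarrow> ip x x = of_real ((n0 x)\<^sup>2)"
  using ip_real[of x] by (auto simp: n0_def)

lemma n0_ge0 [simp]: "0 \<le> n0 x" by (simp add: n0_def)

lemma n0_0 [simp]: "n0 0 = 0" by (simp add: n0_def)

lemma n0_eq0: "x \<in> V \<Longrightarrow> n0 x = 0 \<longleftrightarrow> x = 0"
  using ip_def[of x] by (auto simp: n0_def)

lemma n0_eqI: "x \<in> V \<Longrightarrow> ip x x = of_real r \<Longrightarrow> (n0 x)\<^sup>2 = r"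
  using n0_sq[of x] of_real_eq_iff[where 'a='a] by metis

lemma n0_sc: "x \<in> V \<Longrightarrow> n0 (sc c x) = norm c * n0 x"
proof -
  assume x: "x \<in> V"
  have "ip (sc c x) (sc c x) = (c * cj c) * ip x x"
    using x by (simp add: ip_sc ip_sc2 V_sc mult_ac)
  also have "\<dots> = of_real ((norm c * n0 x)\<^sup>2)"
    unfolding mult_cj n0_sq[OF x] by (simp add: power_mult_distrib)
  finally have "(n0 (sc c x))\<^sup>2 = (norm c * n0 x)\<^sup>2" using n0_eqI V_sc[OF x] by blast
  then show ?thesis by (simp add: power2_eq_iff_nonneg)
qed

lemma n0_minus: "x \<in> V \<Longrightarrow> n0 (- x) = n0 x"
  using n0_sc[of x "-1"] by simp

lemma n0_diff_commute: "x \<in> V \<Longrightarrow> y \<in> V \<Longrightarrow> n0 (x - y) = n0 (y - x)"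
  using n0_minus[of "x - y"] V_diff by simp

lemma n0_add_real:
  assumes "x \<in> V" "y \<in> V" "ip x y = of_real r"
  shows "(n0 (x + y))\<^sup>2 = (n0 x)\<^sup>2 + (n0 y)\<^sup>2 + 2 * r"
proof (rule n0_eqI)
  show "x + y \<in> V" using assms V_add by blast
  have "ip y x = of_real r" using ip_cj[OF assms(1,2)] assms(3) cj_of_real by simp
  then show "ip (x + y) (x + y) = of_real ((n0 x)\<^sup>2 + (n0 y)\<^sup>2 + 2 * r)"
    using assms by (simp add: ip_add ip_add2 V_add n0_sq[OF assms(1)] n0_sq[OF assms(2)] del: of_real_power)
qed

lemma pythagoras: "x \<in> V \<Longrightarrow> y \<in> V \<Longrightarrow> ip x y = 0 \<Longrightarrow> (n0 (x + y))\<^sup>2 = (n0 x)\<^sup>2 + (n0 y)\<^sup>2"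
  using n0_add_real[of x y 0] by simp

lemma pythagoras_le: "x \<in> V \<Longrightarrow> y \<in> V \<Longrightarrow> ip x y = 0 \<Longrightarrow> n0 x \<le> n0 (x + y)"
  using pythagoras[of x y] power2_le_imp_le[of "n0 x" "n0 (x + y)"] by simp

lemma pythagoras_le2: "x \<in> V \<Longrightarrow> y \<in> V \<Longrightarrow> ip x y = 0 \<Longrightarrow> n0 y \<le> n0 (x + y)"
  using pythagoras[of x y] power2_le_imp_le[of "n0 y" "n0 (x + y)"] by simp

lemma cauchy_schwarz:
  assumes "x \<in> V" "y \<in> V"
  shows "norm (ip x y) \<le> n0 x * n0 y"
proof (cases "y = 0")
  case False
  then have ny: "n0 y > 0" using n0_eq0[OF assms(2)] n0_ge0[of y] by linarith
  define c where "c = ip x y / of_real ((n0 y)\<^sup>2)"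
  have ip0: "ip (x - sc c y) y = 0"
    using assms ny by (simp add: ip_diff V_sc ip_sc n0_sq c_def del: of_real_power)
  have "ip (x - sc c y) (sc c y) = 0"
    using ip0 assms by (simp add: ip_sc2 V_diff V_sc)
  then have "n0 (sc c y) \<le> n0 (x - sc c y + sc c y)"
    by (intro pythagoras_le2) (auto intro: V_diff V_sc assms)
  then have "norm c * n0 y \<le> n0 x" by (simp add: n0_sc assms)
  moreover have "norm c = norm (ip x y) / (n0 y)\<^sup>2" by (simp add: c_def norm_divide del: of_real_power)
  ultimately show ?thesis using ny by (simp add: field_simps power2_eq_square)
qed (use assms in simp)

lemma n0_triangle:
  assumes "x \<in> V" "y \<in> V"
  shows "n0 (x + y) \<le> n0 x + n0 y"
proof (rule power2_le_imp_le)
  have "of_real ((n0 (x + y))\<^sup>2) = ip (x + y) (x + y)" using n0_sq V_add assms by metis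
  also have "\<dots> = of_real ((n0 x)\<^sup>2) + of_real ((n0 y)\<^sup>2) + (ip x y + ip y x)"
    using assms by (simp add: ip_add ip_add2 V_add n0_sq[OF assms(1)] n0_sq[OF assms(2)] del: of_real_power)
  finally have "norm (of_real ((n0 (x + y))\<^sup>2) :: 'a) \<le>
      norm (of_real ((n0 x)\<^sup>2) :: 'a) + norm (of_real ((n0 y)\<^sup>2) :: 'a) + (norm (ip x y) + norm (ip y x))"
    by (metis (no_types, lifting) norm_triangle_le add_mono_thms_linordered_semiring(1) norm_triangle_ineq)
  then have "(n0 (x + y))\<^sup>2 \<le> (n0 x)\<^sup>2 + (n0 y)\<^sup>2 + (norm (ip x y) + norm (ip y x))"
    unfolding norm_of_real by simp
  also have "\<dots> \<le> (n0 x + n0 y)\<^sup>2"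
    using cauchy_schwarz[OF assms] cauchy_schwarz[OF assms(2,1)]
    by (simp add: power2_sum mult_ac)
  finally show "(n0 (x + y))\<^sup>2 \<le> (n0 x + n0 y)\<^sup>2" .
qed simp

lemma n0_triangle_diff: "x \<in> V \<Longrightarrow> y \<in> V \<Longrightarrow> n0 (x - y) \<le> n0 x + n0 y"
  using n0_triangle[of x "- y"] n0_minus[of y] V_sc[of y "-1"] by simp

lemma n0_triangle3: "x \<in> V \<Longrightarrow> y \<in> V \<Longrightarrow> z \<in> V \<Longrightarrow> n0 (x - z) \<le> n0 (x - y) + n0 (y - z)"
  using n0_triangle[of "x - y" "y - z"] V_diff by simp

subsection \<open>Finite-dimensional subspaces and orthogonal projections\<close>

definition orthn :: "'v set \<Rightarrow> bool" where
  "orthn B \<longleftrightarrow> finite B \<and> B \<subseteq> V \<and> (\<forall>u\<in>B. \<forall>v\<in>B. ip u v = (if u = v then 1 else 0))"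

definition pr :: "'v set \<Rightarrow> 'v \<Rightarrow> 'v" where
  "pr B x = (\<Sum>u\<in>B. sc (ip x u) u)"

lemma pr_span: "pr B x \<in> span B"
  unfolding pr_def by (intro span_sum span_scale span_base)

lemma pr_V: "orthn B \<Longrightarrow> pr B x \<in> V"
  unfolding pr_def orthn_def by (intro V_sum V_sc) auto

lemma pr_orth1:
  assumes B: "orthn B" and x: "x \<in> V" and u: "u \<in> B"
  shows "ip (x - pr B x) u = 0"
proof -
  have "ip (pr B x) u = (\<Sum>v\<in>B. ip (sc (ip x v) v) u)"
    unfolding pr_def using B u by (intro ip_sum) (auto simp: orthn_def intro: V_sc)
  also have "\<dots> = (\<Sum>v\<in>B. if v = u then ip x v else 0)"
    using B u by (intro sum.cong) (auto simp: orthn_def ip_sc subset_iff)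
  also have "\<dots> = ip x u" using B u by (simp add: orthn_def)
  finally show ?thesis using B x u pr_V[OF B] by (subst ip_diff) (auto simp: orthn_def)
qed

lemma orth_span:
  assumes "B \<subseteq> V" "x \<in> V" "\<And>u. u \<in> B \<Longrightarrow> ip x u = 0" "v \<in> span B"
  shows "ip x v = 0"
proof -
  have "subspace {v \<in> V. ip x v = 0}"
    unfolding subspace_def using assms(2) by (auto simp: ip_add2 ip_sc2 V_add V_sc)
  moreover have "B \<subseteq> {v \<in> V. ip x v = 0}" using assms by auto
  ultimately have "span B \<subseteq> {v \<in> V. ip x v = 0}" by (intro span_minimal)
  then show ?thesis using assms(4) by blast
qed

text \<open>Gram-Schmidt, adding the vectors of \<open>X\<close> one at a time. The given system is
  kept, so that an orthonormal list for one space of a flag can be prolonged to one for the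
  next.\<close>

lemma orthn_extend:
  assumes "orthn B" "finite X" "X \<subseteq> V"
  shows "\<exists>B'. orthn B' \<and> B \<subseteq> B' \<and> span B' = span (B \<union> X)"
  using assms(2,3)
proof (induction X rule: finite_induct)
  case empty
  then show ?case using assms(1) by auto
next
  case (insert x X)
  then obtain B' where B': "orthn B'" "B \<subseteq> B'" "span B' = span (B \<union> X)" by auto
  have xV: "x \<in> V" using insert by simp
  have B'V: "B' \<subseteq> V" "finite B'" using B' by (auto simp: orthn_def)
  define r where "r = x - pr B' x"
  have rV: "r \<in> V" using xV pr_V[OF B'(1)] V_diff r_def by simp
  have sp: "span (B \<union> insert x X) = span (insert x B')"
    by (simp only: Un_insert_right span_insert B'(3))
  show ?case
  proof (cases "r = 0")
    case True
    then have "x \<in> span B'" using pr_span[of B' x] by (simp add: r_def)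
    then have "span (insert x B') = span B'" by (rule span_redundant)
    then show ?thesis using B' sp by auto
  next
    case False
    then have nr: "n0 r > 0" using n0_eq0[OF rV] n0_ge0[of r] by linarith
    define u where "u = sc (of_real (1 / n0 r)) r"
    have uV: "u \<in> V" using rV V_sc u_def by simp
    have "n0 u = 1" using nr by (simp add: u_def n0_sc[OF rV] norm_divide)
    then have uu: "ip u u = 1" using n0_sq[OF uV] by simp
    have ru: "ip r v = 0" if "v \<in> B'" for v
      using pr_orth1[OF B'(1) xV that] by (simp add: r_def)
    then have uo: "ip u v = 0" if "v \<in> B'" for v
      using that B'V rV by (auto simp: u_def ip_sc)
    then have uo2: "ip v u = 0" if "v \<in> B'" for v
      using that B'V uV ip_0_sym by blast
    have unB: "u \<notin> B'" using uo uu by force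
    have "orthn (insert u B')"
      using B'(1) uu uo uo2 uV unB by (auto simp: orthn_def)
    moreover have "span (insert u B') = span (insert x B')"
    proof (rule span_unique[symmetric])
      show "subspace (span (insert u B'))" by simp
      have xr: "x = pr B' x + sc (of_real (n0 r)) u"
        using nr by (simp add: u_def r_def)
      have "pr B' x \<in> span (insert u B')" using pr_span span_mono[of B' "insert u B'"] by blast
      moreover have "sc (of_real (n0 r)) u \<in> span (insert u B')" by (intro span_scale span_base) simp
      ultimately have "x \<in> span (insert u B')" using xr span_add by metis
      then show "insert x B' \<subseteq> span (insert u B')" using span_superset[of "insert u B'"] by auto
      fix T assume T: "insert x B' \<subseteq> T" "subspace T"
      have "pr B' x \<in> T" using pr_span[of B' x] span_minimal[of B' T] T by auto
      then have "r \<in> T" using T by (auto simp: r_def intro: subspace_diff)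
      then have "u \<in> T" using T by (auto simp: u_def intro: subspace_scale)
      then show "span (insert u B') \<subseteq> T" using T by (intro span_minimal) auto
    qed
    ultimately show ?thesis using B' sp by (intro exI[of _ "insert u B'"]) auto
  qed
qed

definition fd :: "'v set \<Rightarrow> bool" where
  "fd S \<longleftrightarrow> (\<exists>B. orthn B \<and> span B = S)"

text \<open>Computed from an arbitrarily chosen orthonormal basis; by \<open>proj_eqI\<close> the
  value does not depend on that choice when \<open>fd S\<close> holds.\<close>

definition proj :: "'v set \<Rightarrow> 'v \<Rightarrow> 'v" where
  "proj S = pr (SOME B. orthn B \<and> span B = S)"

lemma proj_basis: "fd S \<Longrightarrow> \<exists>B. orthn B \<and> span B = S \<and> proj S = pr B"
proof -
  assume "fd S"
  then have "orthn (SOME B. orthn B \<and> span B = S) \<and> span (SOME B. orthn B \<and> span B = S) = S"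
    unfolding fd_def by (rule someI_ex)
  then show ?thesis unfolding proj_def by blast
qed

lemma fd_sub: "fd S \<Longrightarrow> subspace S" "fd S \<Longrightarrow> S \<subseteq> V"
  unfolding fd_def orthn_def using span_V by auto

lemma fd_V: "fd S \<Longrightarrow> s \<in> S \<Longrightarrow> s \<in> V" using fd_sub(2) by blast

lemma proj_in: "fd S \<Longrightarrow> proj S x \<in> S"
  using proj_basis[of S] pr_span[of _ x] by auto

lemma proj_V: "fd S \<Longrightarrow> proj S x \<in> V"
  using proj_in fd_V by blast

lemma proj_orth: "fd S \<Longrightarrow> x \<in> V \<Longrightarrow> s \<in> S \<Longrightarrow> ip (x - proj S x) s = 0"
proof -
  assume S: "fd S" and x: "x \<in> V" and s: "s \<in> S"
  then obtain B where B: "orthn B" "span B = S" "proj S = pr B" using proj_basis by blast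
  show ?thesis
    by (rule orth_span[of B])
       (use B s x pr_V pr_orth1 in \<open>auto simp: orthn_def intro: V_diff\<close>)
qed

lemma proj_eqI:
  assumes S: "fd S" and x: "x \<in> V" and y: "y \<in> S" and o: "\<And>s. s \<in> S \<Longrightarrow> ip (x - y) s = 0"
  shows "proj S x = y"
proof -
  let ?d = "proj S x - y"
  have yV: "y \<in> V" using S y fd_V by blast
  have d: "?d \<in> S" using proj_in[OF S] y fd_sub(1)[OF S] subspace_diff by blast
  have dV: "?d \<in> V" using d fd_V[OF S] by blast
  have "ip ((x - y) - (x - proj S x)) ?d = ip (x - y) ?d - ip (x - proj S x) ?d"
    using x yV dV proj_V[OF S] by (intro ip_diff V_diff)
  then have "ip ?d ?d = 0" using o[OF d] proj_orth[OF S x d] by simp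
  then show ?thesis using ip_def[OF dV] by simp
qed

lemma proj_id: "fd S \<Longrightarrow> s \<in> S \<Longrightarrow> proj S s = s"
  by (rule proj_eqI) (auto dest: fd_V)

lemma proj_add: "fd S \<Longrightarrow> x \<in> V \<Longrightarrow> y \<in> V \<Longrightarrow> proj S (x + y) = proj S x + proj S y"
proof (rule proj_eqI)
  assume S: "fd S" and x: "x \<in> V" and y: "y \<in> V"
  show "proj S x + proj S y \<in> S" using proj_in[OF S] fd_sub(1)[OF S] subspace_add by blast
  fix s assume s: "s \<in> S"
  have "ip ((x - proj S x) + (y - proj S y)) s = 0"
    using ip_add[of "x - proj S x" "y - proj S y" s] x y s proj_V[OF S] fd_V[OF S s]
      proj_orth[OF S x s] proj_orth[OF S y s] V_diff by simp
  then show "ip (x + y - (proj S x + proj S y)) s = 0" by (simp only: add_diff_add)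
qed (auto intro: V_add)

lemma proj_sc: "fd S \<Longrightarrow> x \<in> V \<Longrightarrow> proj S (sc c x) = sc c (proj S x)"
proof (rule proj_eqI)
  assume S: "fd S" and x: "x \<in> V"
  show "sc c (proj S x) \<in> S" using proj_in[OF S] fd_sub(1)[OF S] subspace_scale by blast
  fix s assume s: "s \<in> S"
  have "ip (sc c (x - proj S x)) s = 0"
    using ip_sc[of "x - proj S x" s c] x s proj_V[OF S] fd_V[OF S s] proj_orth[OF S x s] V_diff by simp
  then show "ip (sc c x - sc c (proj S x)) s = 0" by (simp only: scale_right_diff_distrib)
qed (auto intro: V_sc)

lemma proj_pyth: "fd S \<Longrightarrow> x \<in> V \<Longrightarrow> (n0 x)\<^sup>2 = (n0 (x - proj S x))\<^sup>2 + (n0 (proj S x))\<^sup>2"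
  using pythagoras[of "x - proj S x" "proj S x"] proj_V[of S x] proj_orth[of S x "proj S x"] proj_in[of S x]
    V_diff[of x "proj S x"] by simp

lemma n0_proj_le: "fd S \<Longrightarrow> x \<in> V \<Longrightarrow> n0 (proj S x) \<le> n0 x"
  by (rule power2_le_imp_le) (use proj_pyth in auto)

lemma proj_best:
  assumes S: "fd S" and x: "x \<in> V" and s: "s \<in> S"
  shows "n0 (x - proj S x) \<le> n0 (x - s)"
proof -
  have d: "proj S x - s \<in> S" using proj_in[OF S] s fd_sub(1)[OF S] subspace_diff by blast
  have "n0 (x - proj S x) \<le> n0 ((x - proj S x) + (proj S x - s))"
    by (rule pythagoras_le) (use x d proj_V[OF S] fd_V[OF S] proj_orth[OF S x d] V_diff in auto)
  then show ?thesis by simp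
qed

lemma proj_mono: "fd S \<Longrightarrow> fd S' \<Longrightarrow> S \<subseteq> S' \<Longrightarrow> x \<in> V \<Longrightarrow> n0 (x - proj S' x) \<le> n0 (x - proj S x)"
  using proj_best[of S' x "proj S x"] proj_in[of S x] by blast

lemma fd_span: "finite X \<Longrightarrow> X \<subseteq> V \<Longrightarrow> fd (span X)"
  using orthn_extend[of "{}" X] by (auto simp: fd_def orthn_def)

lemma fd_zero: "fd {0}"
  using fd_span[of "{}"] by simp

lemma fd_subspace:
  assumes S: "fd S" and S': "subspace S'" "S' \<subseteq> S"
  shows "fd S'"
proof -
  obtain B where B: "orthn B" "span B = S" using S fd_def by blast
  obtain X where X: "X \<subseteq> S'" "independent X" "S' \<subseteq> span X"
    using maximal_independent_subset[of S'] by blast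
  have "finite X" using independent_span_bound[of B X] B X S' by (auto simp: orthn_def)
  moreover have "span X = S'" using X S' span_minimal by blast
  moreover have "X \<subseteq> V" using X S' fd_sub(2)[OF S] by blast
  ultimately show ?thesis using fd_span by blast
qed

lemma fd_image:
  assumes S: "fd S" and f: "\<And>x. x \<in> S \<Longrightarrow> f x \<in> V"
    and fa: "\<And>x y. x \<in> S \<Longrightarrow> y \<in> S \<Longrightarrow> f (x + y) = f x + f y"
    and fs: "\<And>c x. x \<in> S \<Longrightarrow> f (sc c x) = sc c (f x)"
  shows "fd (f ` S)"
proof -
  obtain B where B: "orthn B" "span B = S" using S fd_def by blast
  have BS: "B \<subseteq> S" using B span_superset by blast
  have sS: "subspace S" using fd_sub(1)[OF S] .
  have f0: "f 0 = 0" using fs[of 0 0] subspace_0[OF sS] by simp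
  have sub: "subspace (f ` S)"
    unfolding subspace_def
  proof (intro conjI ballI allI)
    show "0 \<in> f ` S" using f0 subspace_0[OF sS] by force
    show "x + y \<in> f ` S" if "x \<in> f ` S" "y \<in> f ` S" for x y
      using that fa subspace_add[OF sS] by (metis (no_types, lifting) imageE imageI)
    show "sc c x \<in> f ` S" if "x \<in> f ` S" for c x
      using that fs subspace_scale[OF sS] by (metis (no_types, lifting) imageE imageI)
  qed
  have "f x \<in> span (f ` B)" if "x \<in> S" for x
  proof -
    have "x \<in> span B" using that B by simp
    then have "x \<in> S \<and> f x \<in> span (f ` B)"
    proof (induction rule: span_induct_alt)
      case base
      then show ?case using f0 span_zero subspace_0[OF sS] by simp
    next
      case (step c x y)
      have "x \<in> S" using step BS by blast
      moreover have "f x \<in> span (f ` B)" using step by (intro span_base) auto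
      ultimately show ?case using step fa fs subspace_add[OF sS] subspace_scale[OF sS]
        by (simp add: span_add span_scale)
    qed
    then show ?thesis by simp
  qed
  moreover have "span (f ` B) \<subseteq> f ` S" using BS sub by (intro span_minimal) auto
  ultimately have "f ` S = span (f ` B)" by blast
  moreover have "finite (f ` B)" "f ` B \<subseteq> V" using B BS f by (auto simp: orthn_def)
  ultimately show ?thesis using fd_span by metis
qed

section \<open>Sums of subspaces and the Bessel inequality\<close>

definition osum :: "'v set \<Rightarrow> 'v set \<Rightarrow> 'v set" where
  "osum A W = {a + w | a w. a \<in> A \<and> w \<in> W}"

lemma fd_osum:
  assumes "fd A" "fd W"
  shows "fd (osum A W)"
proof -
  obtain B where B: "orthn B" "span B = A" using assms fd_def by blast
  obtain C where C: "orthn C" "span C = W" using assms fd_def by blast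
  have "osum A W = span (B \<union> C)"
    unfolding osum_def span_Un B C by auto
  then show ?thesis using fd_span[of "B \<union> C"] B C by (auto simp: orthn_def)
qed

lemma osum_sup: "fd A \<Longrightarrow> fd W \<Longrightarrow> A \<subseteq> osum A W" "fd A \<Longrightarrow> fd W \<Longrightarrow> W \<subseteq> osum A W"
proof -
  assume "fd A" "fd W"
  then have "0 \<in> A" "0 \<in> W" using fd_sub(1) subspace_0 by auto
  then show "A \<subseteq> osum A W" "W \<subseteq> osum A W" unfolding osum_def
    by (force intro: exI[of _ 0])+
qed

lemma n0_orth_sum:
  assumes "finite C" "\<And>c. c \<in> C \<Longrightarrow> g c \<in> V"
    "\<And>c d. c \<in> C \<Longrightarrow> d \<in> C \<Longrightarrow> c \<noteq> d \<Longrightarrow> ip (g c) (g d) = 0"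
  shows "(n0 (\<Sum>c\<in>C. g c))\<^sup>2 = (\<Sum>c\<in>C. (n0 (g c))\<^sup>2)"
  using assms
proof (induction C rule: finite_induct)
  case (insert c C)
  have "ip (g c) (\<Sum>c\<in>C. g c) = (\<Sum>d\<in>C. ip (g c) (g d))"
    using insert by (intro ip_sum2) auto
  also have "\<dots> = 0" using insert by (intro sum.neutral) auto
  finally have "(n0 (g c + (\<Sum>c\<in>C. g c)))\<^sup>2 = (n0 (g c))\<^sup>2 + (n0 (\<Sum>c\<in>C. g c))\<^sup>2"
    using insert by (intro pythagoras V_sum) auto
  then show ?case using insert by auto
qed simp

lemma bessel:
  assumes "orthn B" "x \<in> V"
  shows "(\<Sum>u\<in>B. (norm (ip x u))\<^sup>2) \<le> (n0 x)\<^sup>2"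
proof -
  have B: "finite B" "\<And>u. u \<in> B \<Longrightarrow> u \<in> V" "\<And>u v. u \<in> B \<Longrightarrow> v \<in> B \<Longrightarrow> ip u v = (if u = v then 1 else 0)"
    using assms by (auto simp: orthn_def)
  have n1: "n0 u = 1" if "u \<in> B" for u using B that by (simp add: n0_def)
  have "(n0 (pr B x))\<^sup>2 = (\<Sum>u\<in>B. (n0 (sc (ip x u) u))\<^sup>2)"
    unfolding pr_def using B by (intro n0_orth_sum) (auto simp: ip_sc ip_sc2 V_sc)
  also have "\<dots> = (\<Sum>u\<in>B. (norm (ip x u))\<^sup>2)"
    using B n1 by (intro sum.cong) (auto simp: n0_sc)
  finally have eq: "(n0 (pr B x))\<^sup>2 = (\<Sum>u\<in>B. (norm (ip x u))\<^sup>2)" .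
  have "ip (x - pr B x) (pr B x) = 0"
    by (rule orth_span[of B]) (use assms B pr_V pr_orth1 pr_span in \<open>auto intro: V_diff\<close>)
  then have "n0 (pr B x) \<le> n0 (x - pr B x + pr B x)"
    using assms pr_V by (intro pythagoras_le2) (auto intro: V_diff)
  then have "(n0 (pr B x))\<^sup>2 \<le> (n0 x)\<^sup>2"
    using assms(2) by (intro power_mono) simp_all
  then show ?thesis using eq by simp
qed

end

subsection \<open>Truncation of singular values\<close>

lemma vector_space_scale_seq: "vector_space (scale_seq :: 'a::real_normed_field \<Rightarrow> _)"
  by unfold_locales (auto simp: scale_seq_def algebra_simps fun_eq_iff)

section \<open>The space of coefficient vectors\<close>

context conj_scalar
begin

definition cip :: "nat \<Rightarrow> (nat \<Rightarrow> 'a) \<Rightarrow> (nat \<Rightarrow> 'a) \<Rightarrow> 'a" where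
  "cip y c d = (\<Sum>n\<le>y. c n * cj (d n))"

definition csup :: "nat \<Rightarrow> (nat \<Rightarrow> 'a) set" where
  "csup y = {c. \<forall>n>y. c n = 0}"

lemma cip_self: "cip y c c = of_real (\<Sum>n\<le>y. (norm (c n))\<^sup>2)"
  unfolding cip_def mult_cj by simp

text \<open>Orthonormal systems, projections and the Bessel inequality thereby become available a
  second time, for coefficient vectors, next to the space into which these are mapped.\<close>

lemma cspace_ips: "ips cj scale_seq (csup y) (cip y)"
proof -
  interpret vs: vector_space "scale_seq :: 'a \<Rightarrow> _" by (rule vector_space_scale_seq)
  show ?thesis
  proof (unfold_locales)
    show "vs.subspace (csup y)"
      unfolding vs.subspace_def csup_def by (auto simp: scale_seq_def)
    show "cip y (a + b) d = cip y a d + cip y b d" for a b d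
      by (simp add: cip_def distrib_right sum.distrib)
    show "cip y (scale_seq c a) d = c * cip y a d" for a c d
      by (simp add: cip_def scale_seq_def sum_distrib_left mult_ac)
    show "cip y d c = cj (cip y c d)" for c d
      by (simp add: cip_def cj_sum cj_mult cj_cj mult_ac)
    show "\<exists>r\<ge>0. cip y c c = of_real r" for c
      unfolding cip_self by (intro exI[of _ "\<Sum>n\<le>y. (norm (c n))\<^sup>2"]) (auto simp: sum_nonneg)
    show "c = 0" if "c \<in> csup y" "cip y c c = 0" for c
    proof
      fix n
      have "(\<Sum>n\<le>y. (norm (c n))\<^sup>2) = 0" using that(2) unfolding cip_self by (simp only: of_real_eq_0_iff)
      then have "\<forall>n\<le>y. c n = 0" by (subst (asm) sum_nonneg_eq_0_iff) auto
      then show "c n = 0 n" using that(1) unfolding csup_def by (cases "n \<le> y") auto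
    qed
  qed
qed

end

context ips
begin

text \<open>\<open>W\<close> is spanned by the images of right singular vectors of the map from
  coefficients \<open>c\<close> to \<open>\<Sum>n\<le>y. sc (c n) (w n)\<close> with singular value
  at least \<open>1 / \<theta>\<close>: on \<open>W\<close> the map is inverted with norm
  \<open>\<theta>\<close>, and on the complement of these vectors it has norm at most
  \<open>1 / \<theta>\<close>. A maximal system of such vectors replaces the spectral
  theorem.\<close>

lemma svd:
  fixes y :: nat and w :: "nat \<Rightarrow> 'v"
  assumes w: "\<And>n. n \<le> y \<Longrightarrow> w n \<in> V" and \<theta>: "0 < \<theta>"
  obtains W where "fd W"
    "\<And>v. v \<in> W \<Longrightarrow> \<exists>c. v = (\<Sum>n\<le>y. sc (c n) (w n)) \<and> sqrt (\<Sum>n\<le>y. (norm (c n))\<^sup>2) \<le> \<theta> * n0 v"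
    "\<And>c. n0 ((\<Sum>n\<le>y. sc (c n) (w n)) - proj W (\<Sum>n\<le>y. sc (c n) (w n))) \<le> sqrt (\<Sum>n\<le>y. (norm (c n))\<^sup>2) / \<theta>"
proof -
  interpret cs: ips cj scale_seq "csup y" "cip y" by (rule cspace_ips)
  define R where "R = (\<lambda>c. \<Sum>n\<le>y. sc (c n) (w n))"
  have RV: "R c \<in> V" for c unfolding R_def using w by (intro V_sum V_sc) auto
  have Radd: "R (c + d) = R c + R d" for c d
    by (simp add: R_def scale_left_distrib sum.distrib)
  have Rsc: "R (scale_seq a c) = sc a (R c)" for a c
    by (simp add: R_def scale_seq_def scale_sum_right)
  have R0: "R 0 = 0" by (simp add: R_def)
  have Rdiff: "R (c - d) = R c - R d" for c d
    using Radd[of "c - d" d] by (simp add: eq_diff_eq)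
  have Rsum: "R (\<Sum>u\<in>C. g u) = (\<Sum>u\<in>C. R (g u))" for C and g :: "(nat \<Rightarrow> 'a) \<Rightarrow> _"
  proof (induction C rule: infinite_finite_induct)
    case (infinite A)
    show ?case unfolding sum.infinite[OF infinite] by (rule R0)
  next
    case empty
    show ?case unfolding sum.empty by (rule R0)
  next
    case (insert x F)
    show ?case unfolding sum.insert[OF insert.hyps(1,2)] Radd insert.IH ..
  qed
  have cn0: "cs.n0 c = sqrt (\<Sum>n\<le>y. (norm (c n))\<^sup>2)" for c
    unfolding cs.n0_def cip_self norm_of_real by (simp add: sum_nonneg)
  \<comment> \<open>A right singular vector is recognised by the fact that \<open>R\<close>
    preserves orthogonality to it; no adjoint and no eigenvalue equation are involved.\<close>
  define good where "good = (\<lambda>C. cs.orthn C \<and> (\<forall>c\<in>C. 1 / \<theta> \<le> n0 (R c)) \<and>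
    (\<forall>c\<in>C. \<forall>d\<in>csup y. cip y d c = 0 \<longrightarrow> ip (R d) (R c) = 0))"
  \<comment> \<open>The squared norms of the system are summed coordinate by coordinate, and Bessel
    bounds the contribution of each coordinate by 1.\<close>
  have card_le: "card C \<le> Suc y" if "good C" for C
  proof -
    have C: "cs.orthn C" "finite C" using that by (auto simp: good_def cs.orthn_def)
    define e where "e = (\<lambda>n i :: nat. if i = n then 1 else 0 :: 'a)"
    have eS: "e n \<in> csup y" if "n \<le> y" for n using that by (auto simp: e_def csup_def)
    have en: "cs.n0 (e n) = 1" if "n \<le> y" for n
    proof -
      have "(\<Sum>i\<le>y. (norm (e n i))\<^sup>2) = (\<Sum>i\<le>y. if i = n then 1 else 0)"
        by (intro sum.cong) (auto simp: e_def)
      also have "\<dots> = 1" using that by simp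
      finally show ?thesis by (simp add: cn0)
    qed
    have ec: "cip y (e n) c = cj (c n)" if "n \<le> y" for n c
    proof -
      have "cip y (e n) c = (\<Sum>i\<le>y. if i = n then cj (c i) else 0)"
        unfolding cip_def by (intro sum.cong) (auto simp: e_def)
      then show ?thesis using that by simp
    qed
    have "real (card C) = (\<Sum>c\<in>C. (cs.n0 c)\<^sup>2)"
      using C by (simp add: cs.orthn_def cs.n0_def)
    also have "\<dots> = (\<Sum>c\<in>C. \<Sum>n\<le>y. (norm (c n))\<^sup>2)"
      by (intro sum.cong) (auto simp: cn0 sum_nonneg)
    also have "\<dots> = (\<Sum>n\<le>y. \<Sum>c\<in>C. (norm (c n))\<^sup>2)" by (rule sum.swap)
    also have "\<dots> = (\<Sum>n\<le>y. \<Sum>c\<in>C. (norm (cip y (e n) c))\<^sup>2)"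
      by (intro sum.cong) (auto simp: ec)
    also have "\<dots> \<le> (\<Sum>n\<le>y. (cs.n0 (e n))\<^sup>2)"
      by (intro sum_mono cs.bessel C eS) auto
    also have "\<dots> = real (Suc y)" by (simp add: en)
    finally show ?thesis by linarith
  qed
  have good_empty: "good {}" by (simp add: good_def cs.orthn_def)
  obtain C where C: "good C" "\<And>D. good D \<Longrightarrow> card D \<le> card C"
    using ex_has_greatest_nat[of good "{}" card "Suc (Suc y)"] good_empty card_le
    by (auto simp: less_Suc_eq_le)
  have Co: "cs.orthn C" "finite C" "C \<subseteq> csup y" using C(1) by (auto simp: good_def cs.orthn_def)
  \<comment> \<open>If \<open>R\<close> were larger somewhere on the complement of \<open>C\<close>,
    a maximiser of \<open>n0 (R c)\<close> on the unit sphere \<open>K\<close> of that complement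
    would be a further right singular vector, against the maximality of \<open>C\<close>.\<close>
  have key: "n0 (R c) \<le> cs.n0 c / \<theta>" if c: "c \<in> csup y" "\<And>d. d \<in> C \<Longrightarrow> cip y c d = 0" for c
  proof (rule ccontr)
    assume neg: "\<not> n0 (R c) \<le> cs.n0 c / \<theta>"
    define K where "K = {c \<in> csup y. (\<forall>d\<in>C. cip y c d = 0) \<and> cs.n0 c = 1}"
    have c0: "cs.n0 c > 0"
    proof (rule ccontr)
      assume "\<not> cs.n0 c > 0"
      then have "cs.n0 c = 0" using cs.n0_ge0[of c] by linarith
      then have "c = 0" using cs.n0_eq0 c by blast
      then show False using neg by (simp add: R0)
    qed
    have scK: "scale_seq (of_real (1 / cs.n0 e)) e \<in> K"
      if "e \<in> csup y" "\<And>d. d \<in> C \<Longrightarrow> cip y e d = 0" "cs.n0 e > 0" for e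
      using that Co by (auto simp: K_def cs.V_sc cs.ip_sc cs.n0_sc norm_divide subset_iff)
    have "continuous_on UNIV (\<lambda>c. cip y c d)" for d
      unfolding cip_def by (intro continuous_intros continuous_on_product_coordinates)
    then have cl1: "closed {c. cip y c d = 0}" for d
      by (intro closed_Collect_eq continuous_intros) auto
    have "continuous_on UNIV cs.n0"
      unfolding cn0[abs_def] by (intro continuous_intros continuous_on_product_coordinates)
    then have cl2: "closed {c. cs.n0 c = 1}"
      by (intro closed_Collect_eq continuous_intros) auto
    have cl3: "closed {c \<in> UNIV. \<forall>n>y. c n = (0::'a)}"
    proof -
      have "closed {c :: nat \<Rightarrow> 'a. c n = 0}" for n
        by (intro closed_Collect_eq continuous_intros continuous_on_product_coordinates)
      then have "closed (\<Inter>n\<in>{y<..}. {c :: nat \<Rightarrow> 'a. c n = 0})" by blast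
      moreover have "(\<Inter>n\<in>{y<..}. {c :: nat \<Rightarrow> 'a. c n = 0}) = {c \<in> UNIV. \<forall>n>y. c n = 0}" by auto
      ultimately show ?thesis by simp
    qed
    have Keq: "K = {c \<in> UNIV. \<forall>n>y. c n = 0} \<inter> (\<Inter>d\<in>C. {c. cip y c d = 0}) \<inter> {c. cs.n0 c = 1}"
      by (auto simp: K_def csup_def)
    have clK: "closed K"
      unfolding Keq by (intro closed_Int closed_INT ballI cl1 cl2 cl3)
    \<comment> \<open>Coordinates of vectors in \<open>K\<close> have norm at most 1, so
      \<open>K\<close> is a closed subset of a product of closed balls, compact by
      Tychonoff.\<close>
    have cpt: "compact (PiE UNIV (\<lambda>n::nat. cball (0::'a) 1))"
    proof -
      have "compactin (product_topology (\<lambda>n::nat. euclidean) UNIV) (PiE UNIV (\<lambda>n. cball (0::'a) 1))"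
        by (simp add: compactin_PiE compactin_euclidean_iff)
      then show ?thesis by (simp add: euclidean_product_topology)
    qed
    have "K \<subseteq> PiE UNIV (\<lambda>n. cball 0 1)"
    proof
      fix c assume c: "c \<in> K"
      have "norm (c n) \<le> 1" for n
      proof (cases "n \<le> y")
        case True
        have "(norm (c n))\<^sup>2 \<le> (\<Sum>n\<le>y. (norm (c n))\<^sup>2)" using True by (intro member_le_sum) auto
        also have "\<dots> = 1" using c by (simp add: K_def cn0)
        finally show ?thesis using power2_le_imp_le[of "norm (c n)" 1] by simp
      qed (use c in \<open>auto simp: K_def csup_def\<close>)
      then show "c \<in> PiE UNIV (\<lambda>n. cball 0 1)" by auto
    qed
    then have "K = PiE UNIV (\<lambda>n. cball 0 1) \<inter> K" by blast
    then have "compact K" using compact_Int_closed[OF cpt clK] by simp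
    moreover have "K \<noteq> {}" using scK[OF c c0] by blast
    moreover have "continuous_on K (\<lambda>c. n0 (R c))"
    proof -
      have eq: "ip (R c) (R c) = (\<Sum>n\<le>y. \<Sum>m\<le>y. c n * (cj (c m) * ip (w n) (w m)))" for c
      proof -
        have "ip (R c) (R c) = (\<Sum>n\<le>y. ip (sc (c n) (w n)) (R c))"
          unfolding R_def using w by (subst ip_sum) (auto intro!: V_sc V_sum)
        also have "\<dots> = (\<Sum>n\<le>y. c n * (\<Sum>m\<le>y. ip (w n) (sc (c m) (w m))))"
          using w RV by (intro sum.cong refl) (auto simp: ip_sc R_def intro!: ip_sum2 V_sc)
        finally show ?thesis using w by (simp add: ip_sc2 sum_distrib_left)
      qed
      show ?thesis
        unfolding n0_def eq
        by (intro continuous_intros continuous_on_compose2[OF continuous_on_cj]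
            continuous_on_subset[OF continuous_on_product_coordinates]) auto
    qed
    ultimately obtain m where m: "m \<in> K" "\<And>c. c \<in> K \<Longrightarrow> n0 (R c) \<le> n0 (R m)"
      using continuous_attains_sup[of K "\<lambda>c. n0 (R c)"] by blast
    define \<sigma> where "\<sigma> = n0 (R m)"
    have mS: "m \<in> csup y" "\<And>d. d \<in> C \<Longrightarrow> cip y m d = 0" "cs.n0 m = 1" using m(1) by (auto simp: K_def)
    have le: "n0 (R e) \<le> \<sigma> * cs.n0 e" if "e \<in> csup y" "\<And>d. d \<in> C \<Longrightarrow> cip y e d = 0" for e
    proof (cases "cs.n0 e > 0")
      case True
      then show ?thesis
        using m(2)[OF scK[OF that True]] by (simp add: Rsc n0_sc RV norm_divide \<sigma>_def field_simps)
    next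
      case False
      then have "cs.n0 e = 0" using cs.n0_ge0[of e] by linarith
      then have "e = 0" using cs.n0_eq0 that by blast
      then show ?thesis by (simp add: R0)
    qed
    have s1: "\<sigma> > 1 / \<theta>"
      using le[OF c] neg c0 \<theta> by (smt (verit) divide_inverse mult.commute mult_right_less_imp_less inverse_eq_divide)
    \<comment> \<open>First variation at the maximiser: moving \<open>m\<close> in the direction of
      \<open>h\<close> times \<open>d\<close> raises the square of \<open>n0 (R m)\<close> to first
      order in \<open>s\<close>, while the norm of the vector changes only to second order. The size
      of \<open>s\<close> keeps the second-order term at no more than half of the gain.\<close>
    have var: "ip (R m) (R d) = 0"
      if d: "d \<in> csup y" "\<And>e. e \<in> C \<Longrightarrow> cip y d e = 0" "cip y d m = 0" for d
    proof (rule ccontr)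
      define h where "h = ip (R m) (R d)"
      assume "ip (R m) (R d) \<noteq> 0"
      then have h: "norm h > 0" by (simp add: h_def)
      define D where "D = cs.n0 d"
      define s where "s = 1 / (\<sigma>\<^sup>2 * D\<^sup>2 + 1)"
      have s: "s > 0" unfolding s_def by (intro divide_pos_pos) (auto intro: add_nonneg_pos)
      define e where "e = scale_seq (of_real s * h) d"
      have eS: "e \<in> csup y" using d cs.V_sc by (simp add: e_def)
      have "ip (R m) (R e) = cj (of_real s * h) * h"
        by (simp add: e_def Rsc ip_sc2 RV h_def)
      also have "\<dots> = of_real s * (h * cj h)" by (simp add: cj_mult cj_of_real)
      also have "\<dots> = of_real (s * (norm h)\<^sup>2)" unfolding mult_cj by simp
      finally have "(n0 (R m + R e))\<^sup>2 = \<sigma>\<^sup>2 + (n0 (R e))\<^sup>2 + 2 * (s * (norm h)\<^sup>2)"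
        unfolding \<sigma>_def by (intro n0_add_real RV)
      then have low: "\<sigma>\<^sup>2 + 2 * (s * (norm h)\<^sup>2) \<le> (n0 (R (m + e)))\<^sup>2" by (simp add: Radd)
      have "cip y m e = 0" using d mS cs.ip_0_sym[of d m] by (simp add: e_def cs.ip_sc2)
      then have "(cs.n0 (m + e))\<^sup>2 = 1 + (cs.n0 e)\<^sup>2"
        using cs.pythagoras[OF mS(1) eS] mS by simp
      also have "cs.n0 e = s * norm h * D"
        using d s by (simp add: e_def cs.n0_sc norm_mult D_def)
      finally have ne: "(cs.n0 (m + e))\<^sup>2 = 1 + (s * norm h * D)\<^sup>2" .
      have "cip y (m + e) u = 0" if "u \<in> C" for u
        using that mS d eS Co by (auto simp: cs.ip_add e_def cs.ip_sc subset_iff)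
      then have "n0 (R (m + e)) \<le> \<sigma> * cs.n0 (m + e)" using le mS eS cs.V_add by blast
      then have "(n0 (R (m + e)))\<^sup>2 \<le> (\<sigma> * cs.n0 (m + e))\<^sup>2" by (intro power_mono) auto
      also have "\<dots> = \<sigma>\<^sup>2 + \<sigma>\<^sup>2 * (s * norm h * D)\<^sup>2"
        by (simp add: power_mult_distrib ne distrib_left)
      finally have "2 * (s * (norm h)\<^sup>2) \<le> \<sigma>\<^sup>2 * (s * norm h * D)\<^sup>2" using low by linarith
      also have "\<dots> = (s * (norm h)\<^sup>2) * (s * (\<sigma>\<^sup>2 * D\<^sup>2))" by (simp add: power2_eq_square)
      finally have "2 \<le> s * (\<sigma>\<^sup>2 * D\<^sup>2)" using s h by simp
      moreover have "s * (\<sigma>\<^sup>2 * D\<^sup>2) \<le> 1" unfolding s_def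
        by (simp add: divide_le_eq_1 add_nonneg_pos)
      ultimately show False by linarith
    qed
    \<comment> \<open>\<open>var\<close> covers only directions orthogonal to \<open>C\<close>;
      along \<open>C\<close> the claim follows because the members of \<open>C\<close> are good and
      \<open>m\<close> is orthogonal to them.\<close>
    have var2: "ip (R d) (R m) = 0" if d: "d \<in> csup y" "cip y d m = 0" for d
    proof -
      define d1 where "d1 = cs.pr C d"
      have d1: "d1 \<in> csup y" using cs.pr_V[OF Co(1)] by (simp add: d1_def)
      have "ip (R u) (R m) = 0" if "u \<in> C" for u
        using C(1) mS that ip_0_sym[OF RV RV] by (auto simp: good_def)
      then have "ip (R d1) (R m) = 0"
        unfolding d1_def cs.pr_def Rsum Rsc by (subst ip_sum) (auto intro!: V_sc RV simp: ip_sc RV)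
      moreover have "ip (R m) (R (d - d1)) = 0"
      proof (rule var)
        show "d - d1 \<in> csup y" using d d1 cs.V_diff by blast
        show "cip y (d - d1) e = 0" if "e \<in> C" for e
          using cs.pr_orth1[OF Co(1) d(1) that] by (simp add: d1_def)
        have "cip y m d1 = 0" by (rule cs.orth_span[of C]) (use Co mS cs.pr_span in \<open>auto simp: d1_def\<close>)
        then show "cip y (d - d1) m = 0" using d d1 mS cs.ip_0_sym[of m d1] by (simp add: cs.ip_diff)
      qed
      then have "ip (R (d - d1)) (R m) = 0" using ip_0_sym[OF RV RV] by blast
      ultimately have "ip (R (d - d1) + R d1) (R m) = 0" by (simp add: ip_add RV)
      then show ?thesis by (simp flip: Radd)
    qed
    have "cip y m m = 1" using cs.n0_sq[OF mS(1)] mS by simp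
    moreover have "cip y d m = 0" if "d \<in> C" for d using that mS Co cs.ip_0_sym[of m d] by auto
    ultimately have "good (insert m C)"
      using C(1) mS s1 var2 unfolding good_def cs.orthn_def \<sigma>_def by auto
    moreover have "m \<notin> C" using \<open>cip y m m = 1\<close> mS by force
    ultimately show False using C(2)[of "insert m C"] Co by simp
  qed
  define W where "W = span (R ` C)"
  have WR: "\<exists>d\<in>cs.span C. v = R d" if "v \<in> W" for v
  proof -
    have "subspace (R ` cs.span C)"
      unfolding subspace_def
    proof (intro conjI ballI allI)
      show "0 \<in> R ` cs.span C" using R0 cs.span_zero by force
      show "x + z \<in> R ` cs.span C" if "x \<in> R ` cs.span C" "z \<in> R ` cs.span C" for x z
        using that Radd cs.span_add by (metis (no_types, lifting) imageE imageI)
      show "sc a x \<in> R ` cs.span C" if "x \<in> R ` cs.span C" for a x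
        using that Rsc cs.span_scale by (metis (no_types, lifting) imageE imageI)
    qed
    moreover have "R ` C \<subseteq> R ` cs.span C" using cs.span_superset by blast
    ultimately have "W \<subseteq> R ` cs.span C" unfolding W_def by (intro span_minimal)
    then show ?thesis using that by blast
  qed
  have prR: "R (cs.pr C d) \<in> W" for d
    unfolding cs.pr_def Rsum Rsc W_def by (intro span_sum span_scale span_base) auto
  have spC: "cs.span C \<subseteq> csup y" using cs.span_V Co by blast
  have fdW: "fd W" unfolding W_def using Co RV by (intro fd_span) auto
  show ?thesis
  proof (rule that)
    show "fd W" by (rule fdW)
    fix v assume "v \<in> W"
    then obtain d where d: "d \<in> cs.span C" "v = R d" using WR by blast
    have dS: "d \<in> csup y" using d spC by blast
    have pd: "d = cs.pr C d"
    proof -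
      have df: "d - cs.pr C d \<in> cs.span C" using d cs.pr_span cs.span_diff by blast
      have "cip y (d - cs.pr C d) (d - cs.pr C d) = 0"
        by (rule cs.orth_span[of C]) (use Co dS df spC cs.pr_orth1[OF Co(1) dS] in auto)
      then show ?thesis using cs.ip_def df spC by force
    qed
    have "(cs.n0 d)\<^sup>2 = (cs.n0 (cs.pr C d))\<^sup>2" using pd by simp
    also have "\<dots> = (\<Sum>u\<in>C. (cs.n0 (scale_seq (cip y d u) u))\<^sup>2)"
      unfolding cs.pr_def using Co
      by (intro cs.n0_orth_sum) (auto simp: cs.orthn_def cs.ip_sc cs.ip_sc2 cs.V_sc subset_iff)
    also have "\<dots> = (\<Sum>u\<in>C. (norm (cip y d u))\<^sup>2)"
    proof (intro sum.cong refl)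
      fix u assume u: "u \<in> C"
      then have "cs.n0 u = 1" using Co by (simp add: cs.orthn_def cs.n0_def)
      then show "(cs.n0 (scale_seq (cip y d u) u))\<^sup>2 = (norm (cip y d u))\<^sup>2"
        using u Co by (simp add: cs.n0_sc subset_iff)
    qed
    also have "\<dots> \<le> (\<Sum>u\<in>C. \<theta>\<^sup>2 * (n0 (sc (cip y d u) (R u)))\<^sup>2)"
    proof (rule sum_mono)
      fix u assume "u \<in> C"
      then have "1 \<le> \<theta> * n0 (R u)" using C(1) \<theta> by (auto simp: good_def field_simps)
      then have "norm (cip y d u) * 1 \<le> norm (cip y d u) * (\<theta> * n0 (R u))" by (intro mult_left_mono) auto
      then have "(norm (cip y d u))\<^sup>2 \<le> (norm (cip y d u) * (\<theta> * n0 (R u)))\<^sup>2" by (intro power_mono) auto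
      then show "(norm (cip y d u))\<^sup>2 \<le> \<theta>\<^sup>2 * (n0 (sc (cip y d u) (R u)))\<^sup>2"
        by (simp add: n0_sc RV power_mult_distrib mult_ac)
    qed
    also have "\<dots> = \<theta>\<^sup>2 * (\<Sum>u\<in>C. (n0 (sc (cip y d u) (R u)))\<^sup>2)" by (simp add: sum_distrib_left)
    also have "(\<Sum>u\<in>C. (n0 (sc (cip y d u) (R u)))\<^sup>2) = (n0 (\<Sum>u\<in>C. sc (cip y d u) (R u)))\<^sup>2"
    proof (rule n0_orth_sum[symmetric])
      fix u u' assume u: "u \<in> C" "u' \<in> C" "u \<noteq> u'"
      then have "cip y u u' = 0" using Co by (auto simp: cs.orthn_def)
      then have "ip (R u) (R u') = 0" using C(1) u Co by (auto simp: good_def)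
      then show "ip (sc (cip y d u) (R u)) (sc (cip y d u') (R u')) = 0" by (simp add: ip_sc ip_sc2 RV V_sc)
    qed (use Co in \<open>auto intro: V_sc RV\<close>)
    also have "(\<Sum>u\<in>C. sc (cip y d u) (R u)) = R (cs.pr C d)" by (simp add: cs.pr_def Rsum Rsc)
    finally have "(cs.n0 d)\<^sup>2 \<le> (\<theta> * n0 v)\<^sup>2" using pd d by (simp add: power_mult_distrib)
    then have "cs.n0 d \<le> \<theta> * n0 v" by (rule power2_le_imp_le) (use \<theta> in simp)
    then show "\<exists>c. v = (\<Sum>n\<le>y. sc (c n) (w n)) \<and> sqrt (\<Sum>n\<le>y. (norm (c n))\<^sup>2) \<le> \<theta> * n0 v"
      using d by (intro exI[of _ d]) (simp add: R_def cn0)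
  next
    fix c :: "nat \<Rightarrow> 'a"
    define c1 where "c1 = (\<lambda>n. if n \<le> y then c n else 0)"
    have c1: "c1 \<in> csup y" by (simp add: c1_def csup_def)
    have Rc: "(\<Sum>n\<le>y. sc (c n) (w n)) = R c1" unfolding R_def by (intro sum.cong) (auto simp: c1_def)
    have nc: "(\<Sum>n\<le>y. (norm (c n))\<^sup>2) = (\<Sum>n\<le>y. (norm (c1 n))\<^sup>2)" by (intro sum.cong) (auto simp: c1_def)
    define d where "d = cs.pr C c1"
    have dS: "d \<in> csup y" using cs.pr_V[OF Co(1)] by (simp add: d_def)
    have orth: "cip y (c1 - d) u = 0" if "u \<in> C" for u
      using cs.pr_orth1[OF Co(1) c1 that] by (simp add: d_def)
    have cd: "c1 - d \<in> csup y" using c1 dS cs.V_diff by blast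
    \<comment> \<open>Projecting after \<open>R\<close> agrees with projecting before it, since
      goodness keeps the image of the complement of \<open>C\<close> orthogonal to
      \<open>W\<close>.\<close>
    have "proj W (R c1) = R d"
    proof (rule proj_eqI[OF fdW RV])
      show "R d \<in> W" unfolding d_def by (rule prR)
      fix s assume "s \<in> W"
      then have s: "s \<in> span (R ` C)" by (simp only: W_def)
      have "R ` C \<subseteq> V" using RV by blast
      moreover have "ip (R (c1 - d)) u = 0" if "u \<in> R ` C" for u
        using that C(1) orth cd unfolding good_def by blast
      ultimately have "ip (R (c1 - d)) s = 0" by (rule orth_span[OF _ RV _ s])
      then show "ip (R c1 - R d) s = 0" by (simp only: Rdiff)
    qed
    then have "n0 (R c1 - proj W (R c1)) = n0 (R (c1 - d))" by (simp add: Rdiff)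
    also have "\<dots> \<le> cs.n0 (c1 - d) / \<theta>" by (rule key[OF cd orth])
    also have "cip y (c1 - d) d = 0"
      by (rule cs.orth_span[of C]) (use Co cd orth cs.pr_span in \<open>auto simp: d_def\<close>)
    then have "cs.n0 (c1 - d) \<le> cs.n0 (c1 - d + d)" by (intro cs.pythagoras_le cd dS)
    then have "cs.n0 (c1 - d) / \<theta> \<le> cs.n0 c1 / \<theta>" using \<theta> by (simp add: divide_right_mono)
    finally show "n0 ((\<Sum>n\<le>y. sc (c n) (w n)) - proj W (\<Sum>n\<le>y. sc (c n) (w n))) \<le> sqrt (\<Sum>n\<le>y. (norm (c n))\<^sup>2) / \<theta>"
      unfolding Rc nc by (simp add: cn0)
  qed
qed

end

subsection \<open>Bernstein and Jackson inequalities\<close>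

text \<open>\<open>n0\<close> is a dominating norm in the sense of (DN), with all constants equal to
  1. This costs only a sparser choice of the norms and keeps constants out of the estimates.\<close>

locale graded = ips +
  fixes N :: "nat \<Rightarrow> 'b \<Rightarrow> real"
  assumes N_ge0: "x \<in> V \<Longrightarrow> 0 \<le> N k x"
    and N_tri: "x \<in> V \<Longrightarrow> y \<in> V \<Longrightarrow> N k (x + y) \<le> N k x + N k y"
    and N_sc: "x \<in> V \<Longrightarrow> N k (sc c x) = norm c * N k x"
    and N_Suc: "x \<in> V \<Longrightarrow> N k x \<le> N (Suc k) x"
    and n0_N: "x \<in> V \<Longrightarrow> n0 x \<le> N k x"
    and N_DN: "x \<in> V \<Longrightarrow> (N k x)\<^sup>2 \<le> n0 x * N (Suc k) x"
begin

lemma N_mono: "k \<le> m \<Longrightarrow> x \<in> V \<Longrightarrow> N k x \<le> N m x"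
proof (induction rule: dec_induct)
  case (step m)
  then show ?case using N_Suc[of x m] by linarith
qed simp

lemma N_minus: "x \<in> V \<Longrightarrow> N k (- x) = N k x"
  using N_sc[of x k "-1"] by simp

lemma N_diff: "x \<in> V \<Longrightarrow> y \<in> V \<Longrightarrow> N k (x - y) \<le> N k x + N k y"
  using N_tri[of x "- y" k] N_minus[of y k] V_sc[of y "-1"] by simp

lemma N_0 [simp]: "N k 0 = 0"
  using N_sc[of 0 k 0] by simp

lemma N_sum: "(\<And>i. i \<in> I \<Longrightarrow> f i \<in> V) \<Longrightarrow> N k (sum f I) \<le> (\<Sum>i\<in>I. N k (f i))"
proof (induction I rule: infinite_finite_induct)
  case (insert i I)
  have "N k (f i + sum f I) \<le> N k (f i) + N k (sum f I)"
    using insert by (intro N_tri V_sum) auto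
  then show ?case using insert by fastforce
qed auto

definition bern :: "nat \<Rightarrow> 'b set \<Rightarrow> real \<Rightarrow> bool" where
  "bern k S c \<longleftrightarrow> (\<forall>s\<in>S. N k s \<le> c * n0 s)"

lemma bernD: "bern k S c \<Longrightarrow> s \<in> S \<Longrightarrow> N k s \<le> c * n0 s"
  by (simp add: bern_def)

lemma bern_mono: "bern k S c \<Longrightarrow> c \<le> d \<Longrightarrow> bern k S d"
  unfolding bern_def by (meson mult_right_mono n0_ge0 order_trans)

lemma fd_bern:
  assumes "fd S"
  shows "\<exists>c\<ge>0. bern k S c"
proof -
  obtain B where B: "orthn B" "span B = S" "proj S = pr B" using proj_basis assms by blast
  have BV: "u \<in> V" if "u \<in> B" for u using B that by (auto simp: orthn_def)
  define c where "c = (\<Sum>u\<in>B. N k u)"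
  have "N k s \<le> c * n0 s" if s: "s \<in> S" for s
  proof -
    have sV: "s \<in> V" using s assms fd_V by blast
    have "s = (\<Sum>u\<in>B. sc (ip s u) u)" using proj_id[OF assms s] B(3) by (simp add: pr_def)
    then have "N k s \<le> (\<Sum>u\<in>B. N k (sc (ip s u) u))"
      using N_sum[of B "\<lambda>u. sc (ip s u) u" k] BV V_sc by metis
    also have "\<dots> \<le> (\<Sum>u\<in>B. n0 s * N k u)"
    proof (rule sum_mono)
      fix u assume u: "u \<in> B"
      have "n0 u = 1" using u B(1) by (simp add: n0_def orthn_def)
      then have "norm (ip s u) \<le> n0 s" using cauchy_schwarz[OF sV BV[OF u]] by simp
      then show "N k (sc (ip s u) u) \<le> n0 s * N k u"
        using BV[OF u] N_ge0 by (simp add: N_sc mult_right_mono)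
    qed
    finally show ?thesis by (simp add: c_def sum_distrib_left mult.commute)
  qed
  moreover have "c \<ge> 0" unfolding c_def using BV N_ge0 by (intro sum_nonneg) auto
  ultimately show ?thesis by (auto simp: bern_def)
qed

text \<open>Stated as a product, without naming a Bernstein constant of \<open>Y\<close> or a
  Jackson constant of \<open>X\<close>: in this form the property is inherited when \<open>X\<close>
  grows and \<open>Y\<close> shrinks, and it is the quantity that convergence along the flag
  requires.\<close>

definition serve :: "nat \<Rightarrow> nat \<Rightarrow> real \<Rightarrow> 'b set \<Rightarrow> 'b set \<Rightarrow> bool" where
  "serve k Q \<epsilon> X Y \<longleftrightarrow> (\<forall>s\<in>Y. \<forall>x\<in>V. N k s * n0 (x - proj X x) \<le> \<epsilon> * n0 s * N Q x)"

lemma serve_mono: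
  assumes "serve k Q \<epsilon> X Y" "fd X" "fd X'" "X \<subseteq> X'" "Y' \<subseteq> Y" "Y \<subseteq> V"
  shows "serve k Q \<epsilon> X' Y'"
  unfolding serve_def
proof (intro ballI)
  fix s x assume s: "s \<in> Y'" and x: "x \<in> V"
  have "N k s * n0 (x - proj X' x) \<le> N k s * n0 (x - proj X x)"
    using proj_mono[OF assms(2-4) x] N_ge0 s assms by (intro mult_left_mono) auto
  also have "\<dots> \<le> \<epsilon> * n0 s * N Q x" using assms s x by (auto simp: serve_def)
  finally show "N k s * n0 (x - proj X' x) \<le> \<epsilon> * n0 s * N Q x" .
qed

lemma serveI:
  assumes V: "Y \<subseteq> V" "fd X" and B: "bern k Y \<beta>" and J: "\<And>x. x \<in> V \<Longrightarrow> \<gamma> * n0 (x - proj X x) \<le> \<delta> * N Q x"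
    and p: "0 < \<gamma>" "0 \<le> \<beta>" "\<beta> * \<delta> \<le> \<epsilon> * \<gamma>"
  shows "serve k Q \<epsilon> X Y"
  unfolding serve_def
proof (intro ballI)
  fix s x assume s: "s \<in> Y" and x: "x \<in> V"
  have "\<gamma> * (N k s * n0 (x - proj X x)) = N k s * (\<gamma> * n0 (x - proj X x))" by simp
  also have "\<dots> \<le> (\<beta> * n0 s) * (\<delta> * N Q x)"
  proof (rule mult_mono)
    show "N k s \<le> \<beta> * n0 s" using B s by (rule bernD)
    show "0 \<le> \<gamma> * n0 (x - proj X x)" using p by simp
    show "0 \<le> \<beta> * n0 s" using p by simp
  qed (rule J[OF x])
  also have "\<dots> = (\<beta> * \<delta>) * (n0 s * N Q x)" by simp
  also have "\<dots> \<le> (\<epsilon> * \<gamma>) * (n0 s * N Q x)"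
    using p(3) N_ge0[OF x] by (intro mult_right_mono mult_nonneg_nonneg) auto
  also have "\<dots> = \<gamma> * (\<epsilon> * n0 s * N Q x)" by simp
  finally show "N k s * n0 (x - proj X x) \<le> \<epsilon> * n0 s * N Q x" using p by simp
qed

text \<open>A link from \<open>X\<close> to \<open>Y\<close> serves the norms \<open>1, \<dots>, l\<close>: the Bernstein constant of \<open>Y\<close> is beaten by
  the Jackson constant of \<open>X\<close>. This survives refinement of the pair.\<close>

definition link :: "nat \<Rightarrow> real \<Rightarrow> 'b set \<Rightarrow> 'b set \<Rightarrow> bool" where
  "link l \<epsilon> X Y \<longleftrightarrow> fd X \<and> fd Y \<and> X \<subseteq> Y \<and> (\<forall>k. 1 \<le> k \<and> k \<le> l \<longrightarrow> serve k (4 * k + 15) \<epsilon> X Y)"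

lemma link_path_sub: "(link l \<epsilon>)\<^sup>*\<^sup>* X Y \<Longrightarrow> X \<subseteq> Y"
  by (induction rule: rtranclp_induct) (auto simp: link_def)

text \<open>Each pair of neighbours in a chain from \<open>X\<close> to \<open>Y\<close> lies
  between \<open>X\<close> and \<open>Y\<close>, so what these two do for the norm
  \<open>Suc l\<close> is inherited by every step of a chain that was built for the smaller
  norms.\<close>

lemma link_path_Suc:
  assumes "(link l \<epsilon>)\<^sup>*\<^sup>* X Y" "serve (Suc l) (4 * Suc l + 15) \<epsilon> X Y" "fd X" "Y \<subseteq> V"
  shows "(link (Suc l) \<epsilon>)\<^sup>*\<^sup>* X Y"
proof -
  have "(link (Suc l) \<epsilon>)\<^sup>*\<^sup>* X Z" if "(link l \<epsilon>)\<^sup>*\<^sup>* X Z" "Z \<subseteq> Y" for Z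
    using that
  proof (induction rule: rtranclp_induct)
    case (step Z Z')
    have sub: "X \<subseteq> Z" "Z \<subseteq> Z'" "fd Z" using link_path_sub[OF step(1)] step(2) by (auto simp: link_def)
    have "serve (Suc l) (4 * Suc l + 15) \<epsilon> Z Z'"
      using serve_mono[OF assms(2,3) sub(3,1) step.prems assms(4)] .
    then have "link (Suc l) \<epsilon> Z Z'" using step(2) unfolding link_def by (metis le_SucE)
    moreover have "(link (Suc l) \<epsilon>)\<^sup>*\<^sup>* X Z" using step sub by auto
    ultimately show ?case by auto
  qed auto
  then show ?thesis using assms(1) by blast
qed

end

text \<open>The matrix \<open>b\<close> is interpolated at real levels so that levels can be chosen by equations in \<open>b\<close>.
  Below the threshold \<open>\<omega> k\<close>, the cuts are of no use for the norm \<open>k\<close>.\<close>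

locale cuts = graded +
  fixes b :: "nat \<Rightarrow> real \<Rightarrow> real" and S :: "real \<Rightarrow> 'b set" and \<omega> :: "nat \<Rightarrow> real"
  assumes b_ge2: "0 \<le> t \<Longrightarrow> 2 \<le> b k t"
    and b_mono: "0 \<le> t \<Longrightarrow> t \<le> u \<Longrightarrow> b k t \<le> b k u"
    and b_sq: "0 \<le> t \<Longrightarrow> (b k t)\<^sup>2 \<le> b (Suc k) t"
    and b_ivt: "b k 0 \<le> \<beta> \<Longrightarrow> \<exists>t\<ge>0. b k t = \<beta>"
    and \<omega>_ge0: "0 \<le> \<omega> k"
    and \<omega>_mono: "k \<le> m \<Longrightarrow> \<omega> k \<le> \<omega> m"
    and S_fd: "0 \<le> t \<Longrightarrow> fd (S t)"
    and S_B: "\<omega> k \<le> t \<Longrightarrow> bern k (S t) (b (Suc k) t)"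
    and S_J: "\<omega> k \<le> t \<Longrightarrow> x \<in> V \<Longrightarrow> b k t * n0 (x - proj (S t) x) \<le> N (Suc k) x"
begin

lemma b_pos: "0 \<le> t \<Longrightarrow> 0 < b k t" using b_ge2[of t k] by linarith

lemma b_le_sq: "0 \<le> t \<Longrightarrow> b k t \<le> (b k t)\<^sup>2"
  using b_ge2[of t k] by (simp add: power2_eq_square)

lemma b_le: "k \<le> m \<Longrightarrow> 0 \<le> t \<Longrightarrow> b k t \<le> b m t"
proof (induction rule: dec_induct)
  case (step m)
  then show ?case using b_le_sq[of t m] b_sq[of t m] by linarith
qed simp

text \<open>Raising the index by one at least squares the value. Powers and fixed factors are
  absorbed in this way throughout.\<close>

lemma b_4: "0 \<le> t \<Longrightarrow> (b k t) ^ 4 \<le> b (k + 2) t"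
proof -
  assume t: "0 \<le> t"
  have "(b k t) ^ 4 = ((b k t)\<^sup>2)\<^sup>2" by simp
  also have "\<dots> \<le> (b (Suc k) t)\<^sup>2" using b_sq[OF t] by (intro power_mono) auto
  also have "\<dots> \<le> b (k + 2) t" using b_sq[OF t, of "Suc k"] by simp
  finally show ?thesis .
qed

lemma b_8: "0 \<le> t \<Longrightarrow> (b k t) ^ 8 \<le> b (k + 3) t"
proof -
  assume t: "0 \<le> t"
  have "(b k t) ^ 8 = ((b k t) ^ 4)\<^sup>2" by simp
  also have "\<dots> \<le> (b (k + 2) t)\<^sup>2" using b_4[OF t, of k] b_pos[OF t, of k] by (intro power_mono) auto
  also have "\<dots> \<le> b (k + 3) t" using b_sq[OF t, of "k + 2"] by (simp add: eval_nat_numeral)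
  finally show ?thesis .
qed

text \<open>Only the part of the cut that is orthogonal to \<open>A\<close> is kept, so that Bernstein constants add up.\<close>

definition tilt :: "real \<Rightarrow> 'b set \<Rightarrow> 'b set" where
  "tilt e A = osum A {s \<in> S e. \<forall>a\<in>A. ip s a = 0}"

lemma fd_perp:
  assumes "0 \<le> e" "fd A"
  shows "fd {s \<in> S e. \<forall>a\<in>A. ip s a = 0}"
proof (rule fd_subspace[OF S_fd[OF assms(1)]])
  note sV = fd_V[OF S_fd[OF assms(1)]] and aV = fd_V[OF assms(2)]
  note sub = fd_sub(1)[OF S_fd[OF assms(1)]]
  show "subspace {s \<in> S e. \<forall>a\<in>A. ip s a = 0}"
    unfolding subspace_def using sV aV subspace_0[OF sub] subspace_add[OF sub] subspace_scale[OF sub]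
    by (auto simp: ip_add ip_sc)
qed auto

lemma fd_tilt: "0 \<le> e \<Longrightarrow> fd A \<Longrightarrow> fd (tilt e A)"
  unfolding tilt_def by (intro fd_osum fd_perp)

lemma tilt_sup: "0 \<le> e \<Longrightarrow> fd A \<Longrightarrow> A \<subseteq> tilt e A"
  unfolding tilt_def by (intro osum_sup(1) fd_perp)

lemma tilt_B:
  assumes e: "\<omega> k \<le> e" and A: "fd A" and B: "bern k A \<nu>" and \<nu>: "0 \<le> \<nu>"
  shows "bern k (tilt e A) (\<nu> + b (Suc k) e)"
  unfolding bern_def
proof
  have e0: "0 \<le> e" using e \<omega>_ge0[of k] by linarith
  fix s assume "s \<in> tilt e A"
  then obtain a w where s: "s = a + w" "a \<in> A" "w \<in> S e" "\<And>a. a \<in> A \<Longrightarrow> ip w a = 0"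
    unfolding tilt_def osum_def by auto
  have aV: "a \<in> V" and wV: "w \<in> V" using s fd_V[OF A] fd_V[OF S_fd[OF e0]] by auto
  have "ip a w = 0" using s(4)[OF s(2)] ip_0_sym[OF aV wV] by simp
  then have n: "n0 a \<le> n0 s" "n0 w \<le> n0 s"
    unfolding s(1) using pythagoras_le[OF aV wV] pythagoras_le2[OF aV wV] by auto
  have "N k s \<le> N k a + N k w" unfolding s(1) by (rule N_tri[OF aV wV])
  also have "\<dots> \<le> \<nu> * n0 a + b (Suc k) e * n0 w"
    using bernD[OF B s(2)] bernD[OF S_B[OF e] s(3)] by linarith
  also have "\<dots> \<le> \<nu> * n0 s + b (Suc k) e * n0 s"
    using n \<nu> b_pos[OF e0, of "Suc k"] by (intro add_mono mult_left_mono) auto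
  finally show "N k s \<le> (\<nu> + b (Suc k) e) * n0 s" by (simp add: distrib_right)
qed

text \<open>\<open>x\<close> is projected to \<open>s\<close> in the cut, and \<open>s\<close> is
  split into its component \<open>s1\<close> in the projected copy of \<open>A\<close> and a rest
  \<open>w\<close>. As projections are self-adjoint, \<open>w\<close> is orthogonal to
  \<open>A\<close> itself, so only \<open>s1\<close> has to be replaced by a vector \<open>a\<close>
  of \<open>A\<close> that projects to it; by \<open>\<eta>\<close> this is a small move. The 3 is 1
  for the cut and 2 for the replacement.\<close>

lemma tilt_J:
  assumes e: "\<omega> k \<le> e" and kL: "k \<le> L" and A: "fd A" and x: "x \<in> V"
    and \<eta>: "\<And>a. a \<in> A \<Longrightarrow> b L e * n0 (a - proj (S e) a) \<le> n0 a"
  shows "b k e * n0 (x - proj (tilt e A) x) \<le> 3 * N (Suc k) x"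
proof -
  have e0: "0 \<le> e" using e \<omega>_ge0[of k] by linarith
  note Se = S_fd[OF e0]
  define s where "s = proj (S e) x"
  define X where "X = proj (S e) ` A"
  have fX: "fd X"
    unfolding X_def using A fd_V[OF A] proj_V[OF Se] by (intro fd_image) (auto simp: proj_add[OF Se] proj_sc[OF Se])
  have XS: "X \<subseteq> S e" using proj_in[OF Se] by (auto simp: X_def)
  have sS: "s \<in> S e" using proj_in[OF Se] by (simp add: s_def)
  have sV: "s \<in> V" using sS fd_V[OF Se] by blast
  obtain a where a: "a \<in> A" "proj X s = proj (S e) a" using proj_in[OF fX, of s] by (auto simp: X_def)
  have aV: "a \<in> V" using a fd_V[OF A] by blast
  define s1 where "s1 = proj X s"
  have s1: "s1 \<in> S e" "s1 \<in> V" using proj_in[OF fX, of s] XS fd_V[OF Se] by (auto simp: s1_def)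
  define w where "w = s - s1"
  have wS: "w \<in> S e" using sS s1 fd_sub(1)[OF Se] subspace_diff by (simp add: w_def)
  have wV: "w \<in> V" using wS fd_V[OF Se] by blast
  have wo: "ip w a' = 0" if "a' \<in> A" for a'
  proof -
    have a'V: "a' \<in> V" using that fd_V[OF A] by blast
    have "ip (a' - proj (S e) a') w = 0" by (rule proj_orth[OF Se a'V wS])
    then have "ip w (a' - proj (S e) a') = 0" using ip_0_sym[OF _ wV] V_diff a'V proj_V[OF Se] by blast
    then have "ip w a' = ip w (proj (S e) a')" using ip_diff2[OF wV a'V proj_V[OF Se]] by simp
    also have "\<dots> = 0" unfolding w_def s1_def by (rule proj_orth[OF fX sV]) (use that in \<open>simp add: X_def\<close>)
    finally show ?thesis .
  qed
  have mem: "a + w \<in> tilt e A" unfolding tilt_def osum_def using a wS wo by auto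
  have "n0 (x - proj (tilt e A) x) \<le> n0 (x - (a + w))" by (rule proj_best[OF fd_tilt[OF e0 A] x mem])
  also have "x - (a + w) = (x - s) - (a - s1)" by (simp add: w_def)
  also have "n0 \<dots> \<le> n0 (x - s) + n0 (a - s1)" using x sV aV s1 by (intro n0_triangle_diff V_diff)
  finally have "b k e * n0 (x - proj (tilt e A) x) \<le> b k e * n0 (x - s) + b k e * n0 (a - s1)"
    using b_pos[OF e0, of k] by (simp flip: distrib_left)
  moreover have "b k e * n0 (x - s) \<le> N (Suc k) x" unfolding s_def by (rule S_J[OF e x])
  moreover have "b k e * n0 (a - s1) \<le> 2 * N (Suc k) x"
  proof -
    have h: "b L e * n0 (a - s1) \<le> n0 a" using \<eta>[OF a(1)] a(2) by (simp add: s1_def)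
    have "2 * n0 (a - s1) \<le> b L e * n0 (a - s1)" using b_ge2[OF e0] by (intro mult_right_mono) auto
    moreover have "n0 a \<le> n0 (a - s1) + n0 s1" using n0_triangle[of "a - s1" s1] aV s1 V_diff by simp
    moreover have "n0 s1 \<le> n0 s" unfolding s1_def by (rule n0_proj_le[OF fX sV])
    moreover have "n0 s \<le> n0 x" unfolding s_def by (rule n0_proj_le[OF Se x])
    moreover have "n0 x \<le> N (Suc k) x" by (rule n0_N[OF x])
    moreover have "b k e * n0 (a - s1) \<le> b L e * n0 (a - s1)" using b_le[OF kL e0] by (intro mult_right_mono) auto
    ultimately show ?thesis using h by linarith
  qed
  ultimately show ?thesis by linarith
qed

subsection \<open>Refining a pair of cuts\<close>

text \<open>The flag contains \<open>U\<close> and \<open>\<Phi> ` D\<close>, which are close to the honest cuts \<open>A\<close> (at level \<open>c\<close>) and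
  \<open>D\<close> (at level \<open>d\<close>). The map \<open>\<Phi>\<close> is a composition of projections, which makes the inserted
  spaces nested; \<open>\<mu>\<close> counts how often the left space has been tilted.\<close>

definition left :: "nat \<Rightarrow> nat \<Rightarrow> real \<Rightarrow> real \<Rightarrow> 'b set \<Rightarrow> 'b set \<Rightarrow> bool" where
  "left l K \<mu> c A U \<longleftrightarrow> fd A \<and> fd U \<and> (\<forall>k\<le>K. \<omega> k \<le> c \<and> bern k A (\<mu> * b (Suc k) c)) \<and>
    (\<forall>l'\<le>Suc l. \<forall>x\<in>V. b (4 * l' + 10) c * n0 (x - proj U x) \<le> 4 * N (4 * l' + 11) x)"

definition right :: "nat \<Rightarrow> nat \<Rightarrow> real \<Rightarrow> real \<Rightarrow> 'b set \<Rightarrow> ('b \<Rightarrow> 'b) \<Rightarrow> bool" where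
  "right l K \<mu> d D \<Phi> \<longleftrightarrow> 0 \<le> d \<and> fd D \<and> (\<forall>k\<le>K. bern k D ((\<mu> + 1) * b (Suc k) d)) \<and>
    (\<forall>k\<le>4 * l + 10. \<forall>x\<in>V. b k d * n0 (x - proj D x) \<le> 3 * N (Suc k) x) \<and>
    (\<forall>s\<in>D. \<Phi> s \<in> V) \<and> (\<forall>s\<in>D. \<forall>s'\<in>D. \<Phi> (s + s') = \<Phi> s + \<Phi> s') \<and> (\<forall>c. \<forall>s\<in>D. \<Phi> (sc c s) = sc c (\<Phi> s)) \<and>
    (\<forall>s\<in>D. b (4 * l + 10) d * n0 (\<Phi> s - s) \<le> n0 s) \<and>
    (\<forall>k\<le>l. \<forall>s\<in>D. sqrt (b (4 * l + 10) d) * N k (\<Phi> s - s) \<le> 4 * n0 s)"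

lemma left_pred: "left (Suc l) K \<mu> c A U \<Longrightarrow> left l K \<mu> c A U"
  unfolding left_def by auto

lemma right_pred: 
  assumes "right (Suc l) K \<mu> d D \<Phi>"
  shows "right l K \<mu> d D \<Phi>"
proof -
  have d: "0 \<le> d" and D: "fd D" and \<Phi>V: "\<And>s. s \<in> D \<Longrightarrow> \<Phi> s \<in> V" using assms by (auto simp: right_def)
  have le: "b (4 * l + 10) d \<le> b (4 * Suc l + 10) d" using d by (intro b_le) auto
  have 1: "b (4 * l + 10) d * n0 (\<Phi> s - s) \<le> n0 s" if "s \<in> D" for s
  proof -
    have "b (4 * l + 10) d * n0 (\<Phi> s - s) \<le> b (4 * Suc l + 10) d * n0 (\<Phi> s - s)"
      using le by (intro mult_right_mono) auto
    also have "\<dots> \<le> n0 s" using assms that unfolding right_def by blast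
    finally show ?thesis .
  qed
  have 2: "sqrt (b (4 * l + 10) d) * N k (\<Phi> s - s) \<le> 4 * n0 s" if "s \<in> D" "k \<le> l" for s k
  proof -
    have "0 \<le> N k (\<Phi> s - s)" using that \<Phi>V fd_V[OF D] N_ge0 V_diff by blast
    then have "sqrt (b (4 * l + 10) d) * N k (\<Phi> s - s) \<le> sqrt (b (4 * Suc l + 10) d) * N k (\<Phi> s - s)"
      using le by (intro mult_right_mono) auto
    also have "\<dots> \<le> 4 * n0 s" using assms that unfolding right_def by (meson le_SucI)
    finally show ?thesis .
  qed
  show ?thesis using assms 1 2 unfolding right_def by simp
qed

lemma right_mu:
  assumes "right l K \<mu> d D \<Phi>" "\<mu> \<le> \<mu>'"
  shows "right l K \<mu>' d D \<Phi>"
proof -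
  have "bern k D ((\<mu>' + 1) * b (Suc k) d)" if "k \<le> K" for k
  proof (rule bern_mono)
    show "bern k D ((\<mu> + 1) * b (Suc k) d)" using assms that by (simp add: right_def)
    have "0 \<le> d" using assms by (simp add: right_def)
    then show "(\<mu> + 1) * b (Suc k) d \<le> (\<mu>' + 1) * b (Suc k) d"
      using b_pos[of d "Suc k"] assms by (intro mult_right_mono) auto
  qed
  then show ?thesis using assms(1) by (simp add: right_def)
qed

lemma right_fd: "right l K \<mu> d D \<Phi> \<Longrightarrow> fd (\<Phi> ` D)"
  unfolding right_def by (intro fd_image) auto

text \<open>\<open>\<Phi>\<close> is so close to the identity on \<open>D\<close> that
  \<open>n0 s\<close> is at most twice \<open>n0 (\<Phi> s)\<close>, and it changes the norm
  \<open>l\<close> by at most \<open>4 * n0 s\<close>; so the Bernstein inequality passes from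
  \<open>D\<close> to the image.\<close>

lemma right_bern:
  assumes r: "right l K \<mu> d D \<Phi>" and l: "1 \<le> l" "l \<le> K" and \<mu>: "\<mu> + 1 \<le> b 1 d" 
  shows "bern l (\<Phi> ` D) (4 * b (l + 2) d)"
  unfolding bern_def
proof
  have d: "0 \<le> d" and D: "fd D" and \<Phi>V: "\<And>s. s \<in> D \<Longrightarrow> \<Phi> s \<in> V" using r by (auto simp: right_def)
  fix u assume "u \<in> \<Phi> ` D"
  then obtain s where s: "s \<in> D" "u = \<Phi> s" by blast
  have sV: "s \<in> V" and uV: "u \<in> V" using s \<Phi>V fd_V[OF D] by auto
  have "2 * n0 (u - s) \<le> b (4 * l + 10) d * n0 (u - s)" using b_ge2[OF d] by (intro mult_right_mono) auto
  also have "\<dots> \<le> n0 s" using r s unfolding right_def by blast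
  finally have "2 * n0 (u - s) \<le> n0 s" .
  moreover have "n0 s \<le> n0 u + n0 (u - s)"
    using n0_triangle_diff[of u "u - s"] uV sV V_diff by simp
  ultimately have su: "n0 s \<le> 2 * n0 u" by linarith
  have "1 \<le> sqrt (b (4 * l + 10) d)" using b_ge2[OF d, of "4 * l + 10"] by simp
  then have "1 * N l (u - s) \<le> sqrt (b (4 * l + 10) d) * N l (u - s)"
    using N_ge0[OF V_diff[OF uV sV], of l] by (rule mult_right_mono)
  then have "N l (u - s) \<le> sqrt (b (4 * l + 10) d) * N l (u - s)" by simp
  also have "\<dots> \<le> 4 * n0 s" using r s unfolding right_def by blast
  finally have 1: "N l (u - s) \<le> 4 * n0 s" .
  have "N l s \<le> (\<mu> + 1) * b (Suc l) d * n0 s" using r s l bernD unfolding right_def by blast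
  also have "\<dots> \<le> b (l + 2) d * n0 s"
  proof (rule mult_right_mono)
    have "\<mu> + 1 \<le> b (Suc l) d" using \<mu> b_le[of 1 "Suc l" d] d by auto
    then have "(\<mu> + 1) * b (Suc l) d \<le> b (Suc l) d * b (Suc l) d" using b_pos[OF d] by (intro mult_right_mono) (auto simp: less_imp_le)
    also have "\<dots> \<le> b (l + 2) d" using b_sq[OF d, of "Suc l"] by (simp add: power2_eq_square)
    finally show "(\<mu> + 1) * b (Suc l) d \<le> b (l + 2) d" .
  qed simp
  finally have 2: "N l s \<le> b (l + 2) d * n0 s" .
  have "(4::real) \<le> b (l + 2) d"
  proof -
    have "(2::real)\<^sup>2 \<le> (b (Suc l) d)\<^sup>2" using b_ge2[OF d] by (intro power_mono) auto
    then show ?thesis using b_sq[OF d, of "Suc l"] by simp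
  qed
  then have "4 * n0 s \<le> b (l + 2) d * n0 s" by (intro mult_right_mono) auto
  then have "N l s + N l (u - s) \<le> 2 * b (l + 2) d * n0 s" using 1 2 by linarith
  moreover have "N l u \<le> N l s + N l (u - s)" using N_tri[of s "u - s" l] sV uV V_diff by simp
  moreover have "2 * b (l + 2) d * n0 s \<le> 2 * b (l + 2) d * (2 * n0 u)"
    using su b_pos[OF d, of "l + 2"] by (intro mult_left_mono) auto
  ultimately show "N l u \<le> 4 * b (l + 2) d * n0 u" by linarith
qed

text \<open>The inserted cut \<open>tilt e A\<close> has two roles: right end for the part between
  \<open>c\<close> and \<open>e\<close>, and honest left cut for the part between \<open>e\<close>
  and \<open>d\<close>. The square that ties \<open>e\<close> to \<open>d\<close> pays for the
  errors: what is known of \<open>\<Phi>\<close> at level \<open>d\<close> is far stronger than what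
  has to be shown at level \<open>e\<close> for its composition with \<open>proj D\<close>.\<close>

lemma right_tilt:
  assumes l: "1 \<le> l" and r: "right l K \<mu> d D \<Phi>" and A: "fd A"
    and BA: "\<And>k. k \<le> K \<Longrightarrow> \<omega> k \<le> c \<and> bern k A (\<mu> * b (Suc k) c)"
    and ce: "0 \<le> c" "c \<le> e" and z: "(b (4 * l + 10) e)\<^sup>2 = b (l + 5) d"
    and LW: "(b (4 * l + 14) c)\<^sup>2 \<le> b (4 * l + 11) e"
    and K: "4 * l + 12 \<le> K" and \<mu>: "0 \<le> \<mu>" "\<mu> + 1 \<le> b 1 c" "\<mu> + 1 \<le> b 1 d"
  shows "right l K \<mu> e (tilt e A) (\<lambda>s. \<Phi> (proj D s))"
    and "\<And>l' x. l' \<le> l \<Longrightarrow> x \<in> V \<Longrightarrow>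
      b (4 * l' + 10) e * n0 (x - proj ((\<lambda>s. \<Phi> (proj D s)) ` tilt e A) x) \<le> 4 * N (4 * l' + 11) x"
    and "\<And>k. k \<le> K \<Longrightarrow> \<omega> k \<le> e \<and> bern k (tilt e A) ((\<mu> + 1) * b (Suc k) e)"
proof -
  let ?T = "tilt e A"
  let ?F = "\<lambda>s. \<Phi> (proj D s)"
  have e0: "0 \<le> e" using ce by linarith
  have d0: "0 \<le> d" and D: "fd D" and PV: "\<And>s. s \<in> D \<Longrightarrow> \<Phi> s \<in> V"
    and PA: "\<And>s s'. s \<in> D \<Longrightarrow> s' \<in> D \<Longrightarrow> \<Phi> (s + s') = \<Phi> s + \<Phi> s'"
    and PS: "\<And>c s. s \<in> D \<Longrightarrow> \<Phi> (sc c s) = sc c (\<Phi> s)"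
    and DB: "\<And>k. k \<le> K \<Longrightarrow> bern k D ((\<mu> + 1) * b (Suc k) d)"
    and DJ: "\<And>k x. k \<le> 4 * l + 10 \<Longrightarrow> x \<in> V \<Longrightarrow> b k d * n0 (x - proj D x) \<le> 3 * N (Suc k) x"
    and P0: "\<And>s. s \<in> D \<Longrightarrow> b (4 * l + 10) d * n0 (\<Phi> s - s) \<le> n0 s"
    and PN: "\<And>k s. k \<le> l \<Longrightarrow> s \<in> D \<Longrightarrow> sqrt (b (4 * l + 10) d) * N k (\<Phi> s - s) \<le> 4 * n0 s"
    using r unfolding right_def by auto
  have \<omega>e: "\<omega> k \<le> e" if "k \<le> K" for k using BA[OF that] ce by linarith
  have fT: "fd ?T" by (rule fd_tilt[OF e0 A])
  have TV: "s \<in> V" if "s \<in> ?T" for s using fd_V[OF fT that] .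
  show TB: "\<omega> k \<le> e \<and> bern k ?T ((\<mu> + 1) * b (Suc k) e)" if k: "k \<le> K" for k
  proof
    have "bern k ?T (\<mu> * b (Suc k) c + b (Suc k) e)"
      using BA[OF k] \<mu> b_pos[OF ce(1), of "Suc k"] by (intro tilt_B \<omega>e k A) auto
    moreover have "\<mu> * b (Suc k) c + b (Suc k) e \<le> (\<mu> + 1) * b (Suc k) e"
      using b_mono[OF ce, of "Suc k"] \<mu> by (simp add: distrib_right mult_left_mono)
    ultimately show "bern k ?T ((\<mu> + 1) * b (Suc k) e)" by (rule bern_mono)
  qed (rule \<omega>e[OF k])
  \<comment> \<open>Since \<open>\<mu> + 1\<close> is at most \<open>b 1 t\<close>, this factor
    disappears when the index is raised by one.\<close>
  have T\<mu>: "(\<mu> + 1) * b (Suc k) t \<le> b (Suc (Suc k)) t" if "t = e \<or> t = d" for k t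
  proof -
    have t0: "0 \<le> t" using that e0 d0 by auto
    have "\<mu> + 1 \<le> b 1 t" using that \<mu> b_mono[OF ce, of 1] by auto
    also have "\<dots> \<le> b (Suc k) t" using b_le[of 1 "Suc k" t] t0 by auto
    finally have "(\<mu> + 1) * b (Suc k) t \<le> b (Suc k) t * b (Suc k) t" using b_pos[OF t0, of "Suc k"] by (intro mult_right_mono) auto
    then show ?thesis using b_sq[OF t0, of "Suc k"] by (simp add: power2_eq_square)
  qed
  have N_bound: "N k s \<le> b (k + 2) e * n0 s" if "s \<in> ?T" "k \<le> K" for k s
    using bernD[OF conjunct2[OF TB[OF that(2)]] that(1)] mult_right_mono[OF T\<mu>[of e k], of "n0 s"] by simp
  have N_boundD: "N k s \<le> b (k + 2) d * n0 s" if "s \<in> D" "k \<le> K" for k s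
    using bernD[OF DB[OF that(2)] that(1)] mult_right_mono[OF T\<mu>[of d k], of "n0 s"] by simp
  \<comment> \<open>\<open>A\<close> belongs to the lower level \<open>c\<close>: its Bernstein
    constant for the norm \<open>4 * l + 12\<close> is at most \<open>X\<close>, and the Jackson
    constant \<open>Z\<close> of \<open>S e\<close> is at least \<open>X * Y\<close> by
    \<open>LW\<close>. So \<open>A\<close> nearly lies in \<open>S e\<close>.\<close>
  have \<eta>: "b (4 * l + 10) e * n0 (a - proj (S e) a) \<le> n0 a" if a: "a \<in> A" for a
  proof -
    have aV: "a \<in> V" using a fd_V[OF A] by blast
    define X where "X = b (4 * l + 14) c"
    define Y where "Y = b (4 * l + 10) e"
    define Z where "Z = b (4 * l + 11) e"
    have X: "X > 0" and Y: "Y > 0" and Z: "Z > 0" using b_pos ce e0 by (auto simp: X_def Y_def Z_def)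
    have "Y\<^sup>2 \<le> Z" using b_sq[OF e0, of "4 * l + 10"] by (simp add: Y_def Z_def add.commute)
    then have "X\<^sup>2 * Y\<^sup>2 \<le> Z * Z" using LW Z unfolding X_def[symmetric] Z_def[symmetric] by (intro mult_mono) auto
    then have "(X * Y)\<^sup>2 \<le> Z\<^sup>2" unfolding power_mult_distrib power2_eq_square[of Z] .
    then have XY: "X * Y \<le> Z" by (rule power2_le_imp_le) (use Z in linarith)
    have "Z * n0 (a - proj (S e) a) \<le> N (4 * l + 12) a"
      using S_J[of "4 * l + 11" e a] \<omega>e[of "4 * l + 11"] K aV by (simp add: Z_def add.commute)
    also have "\<dots> \<le> \<mu> * b (4 * l + 13) c * n0 a" using bernD[OF conjunct2[OF BA[OF K]] a] by (simp add: add.commute)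
    also have "\<dots> \<le> X * n0 a"
    proof (rule mult_right_mono)
      have "\<mu> \<le> b (4 * l + 13) c" using \<mu> b_le[of 1 "4 * l + 13" c] ce by auto
      then have "\<mu> * b (4 * l + 13) c \<le> b (4 * l + 13) c * b (4 * l + 13) c"
        using b_pos[OF ce(1), of "4 * l + 13"] by (intro mult_right_mono) auto
      then show "\<mu> * b (4 * l + 13) c \<le> X" using b_sq[OF ce(1), of "4 * l + 13"] by (simp add: X_def power2_eq_square add.commute)
    qed simp
    finally have "Z * n0 (a - proj (S e) a) \<le> X * n0 a" .
    moreover have "X * Y * n0 (a - proj (S e) a) \<le> Z * n0 (a - proj (S e) a)" using XY by (intro mult_right_mono) auto
    ultimately have "X * (Y * n0 (a - proj (S e) a)) \<le> X * n0 a" by simp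
    then show ?thesis using X by (simp add: Y_def)
  qed
  \<comment> \<open>\<open>g\<close> bounds the norms up to \<open>l + 6\<close> on the new cut,
    \<open>y\<close> is the closeness required at level \<open>e\<close>, and
    \<open>y\<^sup>2\<close> is a Jackson constant of \<open>D\<close>. Factors \<open>g\<close> are
    cheap because of \<open>g ^ 4 \<le> y\<close>.\<close>
  define g where "g = b (l + 8) e"
  define y where "y = b (4 * l + 10) e"
  have g2: "g \<ge> 2" using b_ge2[OF e0] by (simp add: g_def)
  have y2: "y \<ge> 2" using b_ge2[OF e0] by (simp add: y_def)
  have g4: "g ^ 4 \<le> y"
    using b_4[OF e0, of "l + 8"] b_le[of "l + 10" "4 * l + 10" e] e0 by (simp add: g_def y_def add.commute)
  have yd: "y\<^sup>2 = b (l + 5) d" using z by (simp add: y_def)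
  have yD: "y\<^sup>2 \<le> b (4 * l + 10) d" using b_le[of "l + 5" "4 * l + 10" d] d0 yd by simp
  define r where "r = sqrt y"
  have r2: "r\<^sup>2 = y" "r > 0" using y2 by (auto simp: r_def)
  have gr: "g\<^sup>2 \<le> r" 
    using g4 g2 r2 by (intro power2_le_imp_le[of "g\<^sup>2" r]) auto
  have g_r: "2 * g \<le> r" using gr mult_right_mono[OF g2, of g] g2 unfolding power2_eq_square by linarith
  have est: "y\<^sup>2 * n0 (s - proj D s) \<le> 3 * g * n0 s" if s: "s \<in> ?T" for s
  proof -
    have "y\<^sup>2 * n0 (s - proj D s) \<le> 3 * N (l + 6) s" using DJ[of "l + 5" s] TV[OF s] l yd by (simp add: add.commute)
    also have "\<dots> \<le> 3 * (g * n0 s)" using N_bound[OF s, of "l + 6"] K by (simp add: g_def add.commute)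
    finally show ?thesis by simp
  qed
  \<comment> \<open>The errors of \<open>\<Phi>\<close> and of the projection onto \<open>D\<close>,
    at most \<open>1 / y\<^sup>2\<close> and \<open>3 * g / y\<^sup>2\<close>, add up to at most
    \<open>1 / y\<close>.\<close>
  have F0: "y * n0 (?F s - s) \<le> n0 s" if s: "s \<in> ?T" for s
  proof -
    have sV: "s \<in> V" using TV[OF s] .
    let ?p = "proj D s"
    have p: "?p \<in> D" "?p \<in> V" using proj_in[OF D] proj_V[OF D] by auto
    have "y\<^sup>2 * n0 (\<Phi> ?p - ?p) \<le> b (4 * l + 10) d * n0 (\<Phi> ?p - ?p)" using yD by (intro mult_right_mono) auto
    also have "\<dots> \<le> n0 ?p" by (rule P0[OF p(1)])
    also have "\<dots> \<le> n0 s" by (rule n0_proj_le[OF D sV])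
    finally have 1: "y\<^sup>2 * n0 (\<Phi> ?p - ?p) \<le> n0 s" .
    have "n0 (?F s - s) \<le> n0 (\<Phi> ?p - ?p) + n0 (?p - s)" by (rule n0_triangle3[OF PV[OF p(1)] p(2) sV])
    also have "n0 (?p - s) = n0 (s - ?p)" by (rule n0_diff_commute[OF p(2) sV])
    finally have "y\<^sup>2 * n0 (?F s - s) \<le> y\<^sup>2 * (n0 (\<Phi> ?p - ?p) + n0 (s - ?p))" by (intro mult_left_mono) auto
    also have "\<dots> \<le> n0 s + 3 * g * n0 s" using 1 est[OF s] by (simp add: distrib_left)
    also have "\<dots> \<le> y * n0 s"
    proof -
      have "1 + 3 * g \<le> 2 ^ 3 * g" using g2 by simp
      also have "\<dots> \<le> g ^ 3 * g" using g2 by (intro mult_right_mono power_mono) auto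
      also have "\<dots> \<le> y" using g4 by (simp add: eval_nat_numeral)
      finally have "(1 + 3 * g) * n0 s \<le> y * n0 s" by (intro mult_right_mono) auto
      then show ?thesis by (simp add: distrib_right)
    qed
    finally have "y * (y * n0 (?F s - s)) \<le> y * n0 s" by (simp add: power2_eq_square)
    then show ?thesis using y2 by simp
  qed
  \<comment> \<open>The same two errors in the norm \<open>k\<close>. For the projection error
    \<open>?q\<close> smallness is known in \<open>n0\<close> only; (DN) passes to the norm
    \<open>k\<close> at the price of a square root, which is why \<open>r\<close> and not
    \<open>y\<close> appears.\<close>
  have FN: "r * N k (?F s - s) \<le> 4 * n0 s" if k: "k \<le> l" and s: "s \<in> ?T" for k s
  proof -
    have sV: "s \<in> V" using TV[OF s] .
    let ?p = "proj D s"
    have p: "?p \<in> D" "?p \<in> V" using proj_in[OF D] proj_V[OF D] by auto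
    let ?q = "s - ?p"
    have qV: "?q \<in> V" using sV p V_diff by blast
    have fV: "\<Phi> ?p - ?p \<in> V" using p PV V_diff by blast
    have "r\<^sup>2 * N k (\<Phi> ?p - ?p) \<le> sqrt (b (4 * l + 10) d) * N k (\<Phi> ?p - ?p)"
      using yD r2 N_ge0[OF fV] by (intro mult_right_mono) (auto intro: real_le_rsqrt)
    also have "\<dots> \<le> 4 * n0 ?p" by (rule PN[OF k p(1)])
    also have "\<dots> \<le> 4 * n0 s" using n0_proj_le[OF D sV] by simp
    finally have 1: "r * (r * N k (\<Phi> ?p - ?p)) \<le> 4 * n0 s" by (simp add: power2_eq_square)
    have r4: "r \<ge> 4" using g_r g2 by linarith
    have "0 \<le> r * N k (\<Phi> ?p - ?p)" using r2 N_ge0[OF fV] by simp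
    then have "2 * (r * N k (\<Phi> ?p - ?p)) \<le> r * (r * N k (\<Phi> ?p - ?p))" using r4 by (intro mult_right_mono) auto
    then have A1: "r * N k (\<Phi> ?p - ?p) \<le> 2 * n0 s" using 1 by linarith
    have "N (Suc k) s \<le> b (k + 3) e * n0 s" using N_bound[OF s, of "Suc k"] k K by (simp add: eval_nat_numeral)
    also have "\<dots> \<le> g * n0 s" using b_le[of "k + 3" "l + 8" e] e0 k by (intro mult_right_mono) (auto simp: g_def)
    finally have n1: "N (Suc k) s \<le> g * n0 s" .
    have "N (Suc k) ?p \<le> b (k + 3) d * n0 ?p" using N_boundD[OF p(1), of "Suc k"] k K by (simp add: eval_nat_numeral)
    also have "\<dots> \<le> r * n0 s"
    proof (rule mult_mono)
      have "(b (l + 3) d) ^ 4 \<le> y\<^sup>2" using b_4[OF d0, of "l + 3"] yd by (simp add: add.commute)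
      then have "((b (l + 3) d)\<^sup>2)\<^sup>2 \<le> (r\<^sup>2)\<^sup>2" using r2 by simp
      then have "(b (l + 3) d)\<^sup>2 \<le> r\<^sup>2" by (rule power2_le_imp_le) simp
      then have "b (l + 3) d \<le> r" by (rule power2_le_imp_le) (use r2 in simp)
      then show "b (k + 3) d \<le> r" using b_le[of "k + 3" "l + 3" d] k d0 by simp
      show "n0 ?p \<le> n0 s" by (rule n0_proj_le[OF D sV])
    qed (use r2 in auto)
    finally have n2: "N (Suc k) ?p \<le> r * n0 s" .
    have "N (Suc k) ?q \<le> N (Suc k) s + N (Suc k) ?p" by (rule N_diff[OF sV p(2)])
    also have "\<dots> \<le> g * n0 s + r * n0 s" using n1 n2 by linarith
    also have "\<dots> \<le> 2 * r * n0 s"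
    proof -
      have "g * n0 s \<le> r * n0 s" using g_r g2 by (intro mult_right_mono) auto
      then show ?thesis by linarith
    qed
    finally have q1: "N (Suc k) ?q \<le> 2 * r * n0 s" .
    have "y\<^sup>2 * (N k ?q)\<^sup>2 \<le> y\<^sup>2 * (n0 ?q * N (Suc k) ?q)" using N_DN[OF qV] by (intro mult_left_mono) auto
    also have "\<dots> = (y\<^sup>2 * n0 ?q) * N (Suc k) ?q" by simp
    also have "\<dots> \<le> (3 * g * n0 s) * (2 * r * n0 s)"
      by (rule mult_mono[OF est[OF s] q1 _ N_ge0[OF qV]]) (use g2 in auto)
    also have "\<dots> = (2 * g) * (3 * r * (n0 s)\<^sup>2)" by (simp add: power2_eq_square)
    also have "\<dots> \<le> r * (3 * r * (n0 s)\<^sup>2)" using g_r r2 by (intro mult_right_mono) auto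
    also have "\<dots> = y * (3 * (n0 s)\<^sup>2)" unfolding r2(1)[symmetric] by (simp add: power2_eq_square)
    finally have "y * (y * (N k ?q)\<^sup>2) \<le> y * (3 * (n0 s)\<^sup>2)" by (simp add: power2_eq_square)
    then have "y * (N k ?q)\<^sup>2 \<le> 3 * (n0 s)\<^sup>2" using y2 by simp
    then have "(r * N k ?q)\<^sup>2 \<le> (2 * n0 s)\<^sup>2" using zero_le_power2[of "n0 s"] unfolding power_mult_distrib r2(1) power2_eq_square[of 2] by linarith
    then have A2: "r * N k ?q \<le> 2 * n0 s" by (rule power2_le_imp_le) simp
    have "?F s - s = (\<Phi> ?p - ?p) - ?q" by simp
    then have "N k (?F s - s) \<le> N k (\<Phi> ?p - ?p) + N k ?q" using N_diff[OF fV qV, of k] by simp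
    then have "r * N k (?F s - s) \<le> r * N k (\<Phi> ?p - ?p) + r * N k ?q" using r2 by (simp flip: distrib_left)
    then show ?thesis using A1 A2 by linarith
  qed
  have TJ: "b k e * n0 (x - proj ?T x) \<le> 3 * N (Suc k) x" if "k \<le> 4 * l + 10" "x \<in> V" for k x
    using tilt_J[of k e "4 * l + 10" A x] \<omega>e[of k] that K A \<eta> by simp
  have FV: "?F s \<in> V" for s using PV proj_in[OF D] by blast
  show R: "right l K \<mu> e ?T ?F"
    unfolding right_def
    using e0 fT TB TJ FV F0 FN
    by (auto simp: proj_add[OF D] proj_sc[OF D] TV PA PS proj_in[OF D] y_def[symmetric] r_def[symmetric])
  fix l' x assume l': "l' \<le> l" and x: "x \<in> V"
  let ?s = "proj ?T x"
  have s: "?s \<in> ?T" "?s \<in> V" using proj_in[OF fT] proj_V[OF fT] by auto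
  have "n0 (x - proj (?F ` ?T) x) \<le> n0 (x - ?F ?s)" by (rule proj_best[OF right_fd[OF R] x]) (use s in blast)
  also have "\<dots> \<le> n0 (x - ?s) + n0 (?s - ?F ?s)" by (rule n0_triangle3[OF x s(2) FV])
  also have "n0 (?s - ?F ?s) = n0 (?F ?s - ?s)" by (rule n0_diff_commute[OF s(2) FV])
  finally have "b (4 * l' + 10) e * n0 (x - proj (?F ` ?T) x) \<le>
      b (4 * l' + 10) e * n0 (x - ?s) + b (4 * l' + 10) e * n0 (?F ?s - ?s)"
    using b_pos[OF e0, of "4 * l' + 10"] by (simp flip: distrib_left)
  moreover have "b (4 * l' + 10) e * n0 (x - ?s) \<le> 3 * N (4 * l' + 11) x" using TJ[of "4 * l' + 10" x] l' x by (simp add: add.commute)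
  moreover have "b (4 * l' + 10) e * n0 (?F ?s - ?s) \<le> y * n0 (?F ?s - ?s)"
    using b_le[of "4 * l' + 10" "4 * l + 10" e] e0 l' by (intro mult_right_mono) (auto simp: y_def)
  moreover have "n0 ?s \<le> N (4 * l' + 11) x" using n0_proj_le[OF fT x] n0_N[OF x, of "4 * l' + 11"] by linarith
  ultimately show "b (4 * l' + 10) e * n0 (x - proj (?F ` ?T) x) \<le> 4 * N (4 * l' + 11) x"
    using F0[OF s(1)] by linarith
qed

text \<open>For the top norm, either the pair already serves it, and the smaller norms are left to
  the induction hypothesis, or a cut is inserted so that the right part serves it and the left part
  is treated again. Only the passage to smaller \<open>l\<close> adds a tilt, whence the budget
  \<open>\<mu> + 1 + real l \<le> \<beta>\<close>. The equation for \<open>U\<close> says that the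
  left end is what \<open>\<Phi>\<close> makes of \<open>A\<close>; it puts the left end inside the
  right one.\<close>

lemma refine:
  assumes "left l K \<mu> c A U" "U = (\<lambda>a. \<Phi> (proj D a)) ` A" "right l K \<mu> d D \<Phi>"
    "4 * l + 12 \<le> K" "0 \<le> \<mu>" "\<mu> + 1 + real l \<le> \<beta>" "\<beta> \<le> b 1 c" "\<beta> \<le> b 1 d" "0 \<le> c"
  shows "(link l (24 / \<beta>))\<^sup>*\<^sup>* U (\<Phi> ` D)"
  using assms
proof (induction l arbitrary: \<mu> c A U d D \<Phi>)
  case 0
  have "fd D" using 0(3) by (simp add: right_def)
  then have "U \<subseteq> \<Phi> ` D" using 0(2) proj_in by blast
  then have "link 0 (24 / \<beta>) U (\<Phi> ` D)"
    using 0(1) right_fd[OF 0(3)] by (simp add: link_def left_def)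
  then show ?case by blast
next
  case (Suc l)
  define L where "L = Suc l"
  note IH = Suc.IH
  have A: "fd A" "fd U" and BA: "\<And>k. k \<le> K \<Longrightarrow> \<omega> k \<le> c \<and> bern k A (\<mu> * b (Suc k) c)"
    and UJ: "\<And>l' x. l' \<le> Suc L \<Longrightarrow> x \<in> V \<Longrightarrow> b (4 * l' + 10) c * n0 (x - proj U x) \<le> 4 * N (4 * l' + 11) x"
    using Suc.prems(1) unfolding left_def L_def by auto
  have leftL: "left l K \<mu> c A U" using left_pred Suc.prems(1) by blast
  have K: "4 * L + 12 \<le> K" and \<mu>: "0 \<le> \<mu>" "\<mu> + 1 + real L \<le> \<beta>" and \<beta>c: "\<beta> \<le> b 1 c" and c: "0 \<le> c"
    using Suc.prems by (auto simp: L_def)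
  have \<beta>0: "\<beta> > 0" using \<mu> by linarith
  have common: "0 \<le> d" "fd D" "bern L (\<Phi> ` D) (4 * b (L + 2) d)" "\<Phi> ` D \<subseteq> V" "\<beta> \<le> b (L + 2) d"
    if R: "right L K \<mu> d D \<Phi>" and \<beta>d: "\<beta> \<le> b 1 d" for d D \<Phi>
  proof -
    show d: "0 \<le> d" and D: "fd D" using R by (auto simp: right_def)
    show "bern L (\<Phi> ` D) (4 * b (L + 2) d)"
      using R K \<mu> \<beta>d by (intro right_bern) (auto simp: L_def)
    show "\<Phi> ` D \<subseteq> V" using right_fd[OF R] fd_V by blast
    show "\<beta> \<le> b (L + 2) d" using \<beta>d b_le[of 1 "L + 2" d] d by auto
  qed
  \<comment> \<open>By \<open>b_8\<close> the Bernstein constant at \<open>d\<close> has its square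
    bounded by \<open>?w\<close>, so one of the two factors is left over to absorb
    \<open>\<beta>\<close>.\<close>
  have closeD: "(link L (24 / \<beta>))\<^sup>*\<^sup>* U (\<Phi> ` D)"
    if R: "right L K \<mu> d D \<Phi>" and U: "U = (\<lambda>a. \<Phi> (proj D a)) ` A" and \<beta>d: "\<beta> \<le> b 1 d"
      and close: "b (L + 5) d \<le> (b (4 * L + 14) c) ^ 4" for d D \<Phi>
  proof -
      note d = common(1)[OF R \<beta>d] and D = common(2)[OF R \<beta>d] and Dbern = common(3)[OF R \<beta>d]
        and DV = common(4)[OF R \<beta>d] and \<beta>L = common(5)[OF R \<beta>d]
      let ?w = "b (4 * L + 14) c"
      have w: "?w > 0" using b_pos[OF c] .
      have "((b (L + 2) d)\<^sup>2) ^ 4 \<le> ?w ^ 4" using b_8[OF d, of "L + 2"] close by (simp add: add.commute)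
      then have "(b (L + 2) d)\<^sup>2 \<le> ?w" by (rule power_le_imp_le_base[of _ 3, simplified]) (use w in simp)
      moreover have "\<beta> * b (L + 2) d \<le> (b (L + 2) d)\<^sup>2"
        unfolding power2_eq_square using \<beta>L b_pos[OF d, of "L + 2"] by (intro mult_right_mono) auto
      ultimately have le: "\<beta> * b (L + 2) d \<le> ?w" by linarith
      have sv: "serve L (4 * L + 15) (24 / \<beta>) U (\<Phi> ` D)"
      proof (rule serveI[OF DV A(2) Dbern])
        \<comment> \<open>The Jackson estimate of \<open>U\<close> with index \<open>Suc L\<close>,
          one beyond the norms being served; this is the origin of \<open>4 * k + 15\<close> in
          \<open>link\<close>.\<close>
        show "?w * n0 (x - proj U x) \<le> 4 * N (4 * L + 15) x" if "x \<in> V" for x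
          using UJ[of "Suc L" x] that by (simp add: add.commute)
        show "4 * b (L + 2) d * 4 \<le> 24 / \<beta> * ?w" using le \<beta>0 w by (simp add: field_simps)
      qed (use w b_pos[OF d, of "L + 2"] in auto)
      have "(link l (24 / \<beta>))\<^sup>*\<^sup>* U (\<Phi> ` D)"
        using IH[OF leftL U right_pred[of l K \<mu> d D \<Phi>]] R K \<mu> \<beta>c \<beta>d c by (simp add: L_def)
      then show ?thesis
        using link_path_Suc sv A(2) DV unfolding L_def by blast
  qed
  have farD: "\<exists>e T F. right L K \<mu> e T F \<and> U = (\<lambda>a. F (proj T a)) ` A \<and> \<beta> \<le> b 1 e \<and>
          (b (4 * L + 10) e)\<^sup>2 = b (L + 5) d \<and> (link L (24 / \<beta>))\<^sup>*\<^sup>* (F ` T) (\<Phi> ` D)"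
    if R: "right L K \<mu> d D \<Phi>" and U: "U = (\<lambda>a. \<Phi> (proj D a)) ` A" and \<beta>d: "\<beta> \<le> b 1 d"
      and far: "\<not> b (L + 5) d \<le> (b (4 * L + 14) c) ^ 4" for d D \<Phi>
  proof -
      note d = common(1)[OF R \<beta>d] and D = common(2)[OF R \<beta>d] and Dbern = common(3)[OF R \<beta>d]
        and DV = common(4)[OF R \<beta>d] and \<beta>L = common(5)[OF R \<beta>d]
      let ?w = "b (4 * L + 14) c"
      have w2: "?w \<ge> 2" using b_ge2[OF c] .
      have w4: "?w\<^sup>2 \<le> ?w ^ 4" using w2 by (intro power_increasing) auto
      have le1: "b (4 * L + 10) 0 \<le> ?w" using b_mono[of 0 c "4 * L + 10"] b_le[of "4 * L + 10" "4 * L + 14" c] c by simp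
      have "?w \<le> sqrt (b (L + 5) d)" using far w4 by (intro real_le_rsqrt) linarith
      \<comment> \<open>The Jackson constant of the new cut becomes the square root of
        \<open>b (L + 5) d\<close>: large enough, by \<open>b_8\<close>, to serve the norm
        \<open>L\<close> towards \<open>d\<close>, and small enough for the iteration to
        end.\<close>
      then obtain e where e: "0 \<le> e" "b (4 * L + 10) e = sqrt (b (L + 5) d)"
        using b_ivt[of "4 * L + 10" "sqrt (b (L + 5) d)"] le1 by auto
      have z: "(b (4 * L + 10) e)\<^sup>2 = b (L + 5) d" using e b_pos[OF d, of "L + 5"] by simp
      have LW4: "?w ^ 4 \<le> b (4 * L + 11) e" using b_sq[OF e(1), of "4 * L + 10"] z far by (simp add: add.commute)
      have ce: "c \<le> e"
      proof (rule ccontr)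
        assume "\<not> c \<le> e"
        then have "b (4 * L + 11) e \<le> b (4 * L + 11) c" using b_mono e(1) by simp
        also have "\<dots> \<le> ?w" using b_le c by simp
        finally have "?w ^ 4 \<le> ?w" using LW4 by linarith
        moreover have "?w ^ 1 < ?w ^ 4" using w2 by (intro power_strict_increasing) auto
        ultimately show False by simp
      qed
      let ?T = "tilt e A"
      let ?F = "\<lambda>s. \<Phi> (proj D s)"
      have 1: "1 \<le> L" by (simp add: L_def)
      have LW: "?w\<^sup>2 \<le> b (4 * L + 11) e" using LW4 w4 by linarith
      note rt = right_tilt[OF 1 R A(1) BA c ce z LW K \<mu>(1)]
      have m1: "\<mu> + 1 \<le> b 1 c" "\<mu> + 1 \<le> b 1 d" using \<mu> \<beta>c \<beta>d by auto
      note rt = rt[OF _ m1]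
      have Rt: "right L K \<mu> e ?T ?F" by (rule rt(1))
      have fT: "fd ?T" by (rule fd_tilt[OF e(1) A(1)])
      have TV: "\<And>s. s \<in> ?T \<Longrightarrow> s \<in> V" using fd_V[OF fT] .
      have \<beta>e: "\<beta> \<le> b 1 e" using \<beta>c b_mono[OF c ce, of 1] by linarith
      have "?F (proj ?T a) = \<Phi> (proj D a)" if "a \<in> A" for a
        using proj_id[OF fT, of a] tilt_sup[OF e(1) A(1)] that by auto
      then have Ue: "U = (\<lambda>a. ?F (proj ?T a)) ` A" using U by force
      let ?W = "?F ` ?T"
      \<comment> \<open>The tilted cut becomes the honest left cut of the right part, with one more
        tilt to account for.\<close>
      have lft: "left l K (\<mu> + 1) e ?T ?W"
        unfolding left_def using fT right_fd[OF Rt] rt(2,3) by (auto simp: L_def)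
      have rgt: "right l K (\<mu> + 1) d D \<Phi>"
        using right_mu[OF right_pred[of l K \<mu> d D \<Phi>]] R by (simp add: L_def)
      have "(link l (24 / \<beta>))\<^sup>*\<^sup>* ?W (\<Phi> ` D)"
        using IH[OF lft refl rgt] K \<mu> \<beta>e \<beta>d e(1) by (simp add: L_def)
      moreover have "serve L (4 * L + 15) (24 / \<beta>) ?W (\<Phi> ` D)"
      proof (rule serveI[OF DV right_fd[OF Rt] Dbern])
        show "b (4 * L + 10) e * n0 (x - proj ?W x) \<le> 4 * N (4 * L + 15) x" if "x \<in> V" for x
          using rt(2)[of L x] that N_mono[of "4 * L + 11" "4 * L + 15" x] by simp
        have "((b (L + 2) d) ^ 4)\<^sup>2 \<le> (b (4 * L + 10) e)\<^sup>2" using b_8[OF d, of "L + 2"] z by (simp add: add.commute)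
        then have "(b (L + 2) d) ^ 4 \<le> b (4 * L + 10) e"
          by (rule power2_le_imp_le) (use b_pos[OF e(1)] in \<open>simp add: less_imp_le\<close>)
        moreover have "(b (L + 2) d)\<^sup>2 \<le> (b (L + 2) d) ^ 4"
          using b_ge2[OF d, of "L + 2"] by (intro power_increasing) auto
        moreover have "\<beta> * b (L + 2) d \<le> (b (L + 2) d)\<^sup>2"
          unfolding power2_eq_square using \<beta>L b_pos[OF d, of "L + 2"] by (intro mult_right_mono) auto
        ultimately have "\<beta> * b (L + 2) d \<le> b (4 * L + 10) e" by linarith
        then show "4 * b (L + 2) d * 4 \<le> 24 / \<beta> * b (4 * L + 10) e"
          using \<beta>0 b_pos[OF e(1), of "4 * L + 10"] by (simp add: field_simps)
      qed (use b_pos[OF e(1)] b_pos[OF d, of "L + 2"] in auto)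
      ultimately have path: "(link L (24 / \<beta>))\<^sup>*\<^sup>* ?W (\<Phi> ` D)"
        using link_path_Suc right_fd[OF Rt] DV unfolding L_def by blast
      show ?thesis
        by (rule exI[of _ e], rule exI[of _ ?T], rule exI[of _ ?F]) (use Rt Ue \<beta>e z path in blast)
  qed
  \<comment> \<open>Each insertion replaces \<open>b (4 * L + 10) d\<close> by at most its square
    root, so a double exponential counts the insertions. At the value 2 the levels are close in any
    case.\<close>
  have key: "(link L (24 / \<beta>))\<^sup>*\<^sup>* U (\<Phi> ` D)"
    if "b (4 * L + 10) d \<le> 2 ^ (2 ^ n)" "right L K \<mu> d D \<Phi>" "U = (\<lambda>a. \<Phi> (proj D a)) ` A" "\<beta> \<le> b 1 d" for n d D \<Phi>
    using that
  proof (induction n arbitrary: d D \<Phi>)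
    case 0
    have d: "0 \<le> d" using common(1)[OF 0(2,4)] .
    have "(2::real) ^ 4 \<le> (b (4 * L + 14) c) ^ 4" using b_ge2[OF c] by (intro power_mono) auto
    moreover have "b (L + 5) d \<le> 2" using 0(1) b_le[of "L + 5" "4 * L + 10" d] d by simp
    ultimately show ?case using closeD[OF 0(2-4)] by simp
  next
    case (Suc n)
    show ?case
    proof (cases "b (L + 5) d \<le> (b (4 * L + 14) c) ^ 4")
      case True
      then show ?thesis using closeD[OF Suc.prems(2-4)] by simp
    next
      case False
      have d: "0 \<le> d" using common(1)[OF Suc.prems(2,4)] .
      obtain e T F where e: "right L K \<mu> e T F" "U = (\<lambda>a. F (proj T a)) ` A" "\<beta> \<le> b 1 e"
        "(b (4 * L + 10) e)\<^sup>2 = b (L + 5) d" "(link L (24 / \<beta>))\<^sup>*\<^sup>* (F ` T) (\<Phi> ` D)"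
        using farD[OF Suc.prems(2-4) False] by blast
      have "(b (4 * L + 10) e)\<^sup>2 \<le> ((2::real) ^ (2 ^ n))\<^sup>2"
        using e(4) Suc.prems(1) b_le[of "L + 5" "4 * L + 10" d] d by (simp flip: power_mult add: mult.commute)
      then have "b (4 * L + 10) e \<le> 2 ^ (2 ^ n)" by (rule power2_le_imp_le) simp
      then have "(link L (24 / \<beta>))\<^sup>*\<^sup>* U (F ` T)" by (rule Suc.IH[OF _ e(1-3)])
      then show ?thesis using e(5) by (rule rtranclp_trans)
    qed
  qed
  obtain n where n: "b (4 * L + 10) d < 2 ^ n" using real_arch_pow[of 2 "b (4 * L + 10) d"] by auto
  have "(2::real) ^ n \<le> 2 ^ (2 ^ n)" by (rule power_increasing) (auto simp: less_imp_le)
  then have "b (4 * L + 10) d \<le> 2 ^ (2 ^ n)" using n by linarith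
  then have "(link L (24 / \<beta>))\<^sup>*\<^sup>* U (\<Phi> ` D)"
    by (rule key[OF _ Suc.prems(3)[folded L_def] Suc.prems(2) Suc.prems(8)])
  then show ?case unfolding L_def .
qed

subsection \<open>The flag\<close>

text \<open>The factors 2 and 3 are what \<open>tilt_B\<close> and \<open>tilt_J\<close> leave
  behind. The last clause makes the approximation error of the stages and the constants of the links
  between them tend to 0 as \<open>L\<close> grows.\<close>

definition stage :: "nat \<Rightarrow> 'b set \<Rightarrow> real \<Rightarrow> bool" where
  "stage L A t \<longleftrightarrow> 0 \<le> t \<and> fd A \<and> (\<forall>k\<le>4 * L + 16. \<omega> k \<le> t \<and> bern k A (2 * b (Suc k) t)) \<and>
    (\<forall>k\<le>4 * L + 14. \<forall>x\<in>V. b k t * n0 (x - proj A x) \<le> 3 * N (Suc k) x) \<and> 3 + real L \<le> b 0 t"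

text \<open>A fixed finite-dimensional space has some Bernstein constant \<open>C\<close>. At a
  level where \<open>b 0\<close> is at least \<open>C\<close>, the cut almost contains the space, so
  tilting costs only constants.\<close>

lemma stage_exists:
  assumes A: "fd A" and t: "0 \<le> t"
  shows "\<exists>A' t'. stage L A' t' \<and> A \<subseteq> A' \<and> t \<le> t'"
proof -
  define K where "K = 4 * L + 18"
  obtain C where C: "C \<ge> 0" "bern K A C" using fd_bern[OF A] by blast
  have CB: "bern k A C" if "k \<le> K" for k
    unfolding bern_def
  proof
    fix a assume a: "a \<in> A"
    have "N k a \<le> N K a" using N_mono[OF that] a fd_V[OF A] by blast
    then show "N k a \<le> C * n0 a" using bernD[OF C(2) a] by linarith
  qed
  obtain t1 where t1: "0 \<le> t1" "b 0 t1 = max (b 0 0) (max C (3 + real L))"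
    using b_ivt[of 0 "max (b 0 0) (max C (3 + real L))"] by auto
  define t' where "t' = max t1 (max t (\<omega> K))"
  have t': "0 \<le> t'" "t \<le> t'" "t1 \<le> t'" "\<omega> K \<le> t'" using t1 by (auto simp: t'_def)
  have b0: "C \<le> b 0 t'" "3 + real L \<le> b 0 t'" using b_mono[OF t1(1) t'(3), of 0] t1(2) by auto
  have \<omega>: "\<omega> k \<le> t'" if "k \<le> K" for k using \<omega>_mono[OF that] t'(4) by linarith
  have Cb: "C \<le> b k t'" for k using b0(1) b_le[of 0 k t'] t' by auto
  have \<eta>: "b (4 * L + 16) t' * n0 (a - proj (S t') a) \<le> n0 a" if a: "a \<in> A" for a
  proof -
    let ?\<beta> = "b (4 * L + 16) t'" and ?n = "n0 (a - proj (S t') a)"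
    have aV: "a \<in> V" using a fd_V[OF A] by blast
    have "?\<beta>\<^sup>2 * ?n \<le> b (Suc (4 * L + 16)) t' * ?n" by (rule mult_right_mono[OF b_sq[OF t'(1)] n0_ge0])
    also have "\<dots> \<le> N (Suc (Suc (4 * L + 16))) a" by (rule S_J[OF \<omega> aV]) (simp add: K_def)
    also have "\<dots> \<le> C * n0 a" using bernD[OF CB a] by (simp add: K_def)
    also have "\<dots> \<le> ?\<beta> * n0 a" using Cb by (intro mult_right_mono) auto
    finally have "?\<beta> * (?\<beta> * ?n) \<le> ?\<beta> * n0 a" by (simp add: power2_eq_square)
    then show ?thesis using b_pos[OF t'(1), of "4 * L + 16"] by simp
  qed
  have "bern k (tilt t' A) (2 * b (Suc k) t')" if "k \<le> K" for k
    by (rule bern_mono[OF tilt_B[OF \<omega> A CB C(1)]]) (use that Cb[of "Suc k"] in auto)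
  moreover have "b k t' * n0 (x - proj (tilt t' A) x) \<le> 3 * N (Suc k) x" if "k \<le> 4 * L + 14" "x \<in> V" for k x
    by (rule tilt_J[of k t' "4 * L + 16", OF \<omega>]) (use that A \<eta> in \<open>auto simp: K_def\<close>)
  ultimately have "stage L (tilt t' A) t'"
    unfolding stage_def using t' fd_tilt[OF t'(1) A] b0 \<omega> by (auto simp: K_def)
  then show ?thesis using tilt_sup[OF t'(1) A] t' by blast
qed

text \<open>Both stages are honest cuts, so \<open>refine\<close> starts with the identity for
  \<open>\<Phi>\<close> and with 2 for \<open>\<mu>\<close>, which gives the budget
  \<open>3 + real L\<close>. The loop at \<open>A\<close> makes the path nonempty, as
  \<open>concat_paths\<close> requires.\<close>

lemma stage_path:
  assumes s: "stage L A t" and s': "stage (Suc L) A' t'" and A: "A \<subseteq> A'" and t: "t \<le> t'"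
  shows "(link L (24 / (3 + real L)))\<^sup>+\<^sup>+ A A'"
proof -
  let ?\<beta> = "3 + real L"
  have t0: "0 \<le> t" "0 \<le> t'" and fA: "fd A" "fd A'" using s s' by (auto simp: stage_def)
  have \<beta>: "?\<beta> \<le> b 1 t" "?\<beta> \<le> b 1 t'"
  proof -
    have "b 0 t \<le> b 1 t" "b 0 t' \<le> b 1 t'" using b_le t0 by auto
    then show "?\<beta> \<le> b 1 t" "?\<beta> \<le> b 1 t'" using s s' by (auto simp: stage_def)
  qed
  have AV: "A \<subseteq> V" using fd_sub(2)[OF fA(1)] .
  have "link L (24 / ?\<beta>) A A"
    unfolding link_def
  proof (intro conjI allI impI)
    fix k assume k: "1 \<le> k \<and> k \<le> L"
    have 1: "?\<beta> * b (Suc k) t \<le> b (4 * k + 14) t"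
    proof -
      have "?\<beta> \<le> b (Suc k) t" using \<beta>(1) b_le[of 1 "Suc k" t] t0 by auto
      then have "?\<beta> * b (Suc k) t \<le> b (Suc k) t * b (Suc k) t"
        using b_pos[OF t0(1), of "Suc k"] by (intro mult_right_mono) auto
      also have "\<dots> \<le> b (Suc (Suc k)) t" using b_sq[OF t0(1), of "Suc k"] by (simp add: power2_eq_square)
      also have "\<dots> \<le> b (4 * k + 14) t" using t0 by (intro b_le) auto
      finally show ?thesis .
    qed
    show "serve k (4 * k + 15) (24 / ?\<beta>) A A"
    proof (rule serveI[OF AV fA(1)])
      show "bern k A (2 * b (Suc k) t)" using s k by (auto simp: stage_def)
      show "b (4 * k + 14) t * n0 (x - proj A x) \<le> 3 * N (4 * k + 15) x" if "x \<in> V" for x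
      proof -
        have "b (4 * k + 14) t * n0 (x - proj A x) \<le> 3 * N (Suc (4 * k + 14)) x"
          using s k that unfolding stage_def by (meson add_le_mono le_refl mult_le_mono)
        then show ?thesis by (simp add: add.commute)
      qed
      have "2 * b (Suc k) t * 3 * ?\<beta> \<le> 24 * b (4 * k + 14) t" using 1 b_pos[OF t0(1), of "Suc k"] b_pos[OF t0(1), of "4 * k + 14"]
        by (simp add: mult.commute)
      then show "2 * b (Suc k) t * 3 \<le> 24 / ?\<beta> * b (4 * k + 14) t" by (simp add: pos_le_divide_eq)
    qed (use b_pos[OF t0(1)] in \<open>auto simp: less_imp_le\<close>)
  qed (use fA in auto)
  moreover have "(link L (24 / ?\<beta>))\<^sup>*\<^sup>* A ((\<lambda>s. s) ` A')"
  proof (rule refine[of L "4 * L + 12" 2 t A A "\<lambda>s. s" A' t'])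
    show "left L (4 * L + 12) 2 t A A"
      unfolding left_def
    proof (intro conjI allI impI ballI)
      fix l' x assume l': "l' \<le> Suc L" and x: "x \<in> V"
      have "4 * l' + 10 \<le> 4 * L + 14" using l' by simp
      then have "b (4 * l' + 10) t * n0 (x - proj A x) \<le> 3 * N (Suc (4 * l' + 10)) x"
        using s x unfolding stage_def by blast
      then show "b (4 * l' + 10) t * n0 (x - proj A x) \<le> 4 * N (4 * l' + 11) x"
        using N_ge0[OF x, of "4 * l' + 11"] by (simp add: add.commute)
    qed (use s in \<open>auto simp: stage_def\<close>)
    have "proj A' ` A = (\<lambda>s. s) ` A" by (rule image_cong) (use proj_id[OF fA(2)] A in auto)
    then show "A = (\<lambda>a. proj A' a) ` A" by simp
    show "right L (4 * L + 12) 2 t' A' (\<lambda>s. s)"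
      unfolding right_def
    proof (intro conjI allI impI ballI)
      fix k assume k: "k \<le> 4 * L + 12"
      have "bern k A' (2 * b (Suc k) t')" using s' k unfolding stage_def by auto
      then show "bern k A' ((2 + 1) * b (Suc k) t')"
        by (rule bern_mono) (use b_pos[OF t0(2), of "Suc k"] in simp)
    next
      fix k x assume "k \<le> 4 * L + 10" "x \<in> V"
      then show "b k t' * n0 (x - proj A' x) \<le> 3 * N (Suc k) x" using s' unfolding stage_def by auto
    qed (use t0 fA fd_V[OF fA(2)] in auto)
  qed (use \<beta> t0 in auto)
  ultimately show ?thesis by simp
qed

text \<open>A position in the concatenation is a pair of path number and offset; \<open>nx\<close>
  moves to the next offset or to the start of the next path. Paths of positive length ensure that
  every path is entered and left.\<close>

lemma concat_paths:
  assumes p: "\<And>L. (R L)\<^sup>+\<^sup>+ (a L) (a (Suc L))"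
  shows "\<exists>u l. mono l \<and> (\<forall>M. \<exists>j. l j = M) \<and> (\<forall>j. R (l j) (u j) (u (Suc j))) \<and> (\<forall>M. \<exists>j. l j = M \<and> u j = a M)"
proof -
  have "\<exists>n g. 0 < n \<and> g 0 = a L \<and> g n = a (Suc L) \<and> (\<forall>i<n. R L (g i) (g (Suc i)))" for L
    using p[of L] unfolding tranclp_power relpowp_fun_conv by blast
  then obtain n g where ng: "\<And>L. 0 < n L" "\<And>L. g L 0 = a L" "\<And>L. g L (n L) = a (Suc L)"
    "\<And>L i. i < n L \<Longrightarrow> R L (g L i) (g L (Suc i))" by metis
  define nx where "nx = (\<lambda>(L, i). if Suc i < n L then (L, Suc i) else (Suc L, 0))"
  define st where "st = (\<lambda>j. (nx ^^ j) (0, 0))"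
  define u where "u = (\<lambda>j. g (fst (st j)) (snd (st j)))"
  define l where "l = (\<lambda>j. fst (st j))"
  have st_Suc: "st (Suc j) = nx (st j)" for j by (simp add: st_def)
  have inv: "snd (st j) < n (fst (st j))" for j
  proof (induction j)
    case (Suc j)
    then show ?case unfolding st_Suc by (cases "st j") (auto simp: nx_def ng(1))
  qed (simp add: st_def ng(1))
  have "l j \<le> l (Suc j)" for j unfolding l_def st_Suc by (cases "st j") (auto simp: nx_def)
  then have "mono l" by (rule mono_iff_le_Suc[THEN iffD2, rule_format])
  moreover have "R (l j) (u j) (u (Suc j))" for j
  proof -
    obtain L i where Li: "st j = (L, i)" by fastforce
    have "i < n L" using inv[of j] Li by simp
    then have r: "R L (g L i) (g L (Suc i))" by (rule ng(4))
    show ?thesis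
    proof (cases "Suc i < n L")
      case True
      then show ?thesis using r by (simp add: l_def u_def st_Suc Li nx_def)
    next
      case False
      then have "Suc i = n L" using \<open>i < n L\<close> by simp
      then show ?thesis using r False by (simp add: l_def u_def st_Suc Li nx_def ng)
    qed
  qed
  moreover have reach: "\<exists>j. st j = (M, 0)" for M
  proof (induction M)
    case 0
    show ?case by (rule exI[of _ 0]) (simp add: st_def)
  next
    case (Suc M)
    then obtain j where j: "st j = (M, 0)" by blast
    have "i < n M \<Longrightarrow> st (j + i) = (M, i)" for i
    proof (induction i)
      case (Suc i)
      then show ?case using st_Suc[of "j + i"] by (simp add: nx_def)
    qed (simp add: j)
    from this[of "n M - 1"] have "st (j + (n M - 1)) = (M, n M - 1)" using ng(1)[of M] by simp
    then have "st (Suc (j + (n M - 1))) = (Suc M, 0)" unfolding st_Suc using ng(1)[of M] by (simp add: nx_def)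
    then show ?case by blast
  qed
  moreover have "\<exists>j. l j = M \<and> u j = a M" for M
    using reach[of M] by (auto simp: l_def u_def ng) (metis fst_conv ng(2) snd_conv)
  ultimately show ?thesis by blast
qed

theorem flag_exists:
  shows "\<exists>U. (\<forall>i. fd (U i) \<and> U i \<subseteq> U (Suc i)) \<and>
    (\<forall>k. \<exists>Q. \<forall>e>0. \<exists>i0. \<forall>i\<ge>i0. serve k Q e (U i) (U (Suc i))) \<and>
    (\<forall>e>0. \<exists>i0. \<forall>i\<ge>i0. \<forall>x\<in>V. n0 (x - proj (U i) x) \<le> e * N 1 x)"
proof -
  have "\<exists>f. \<forall>L. stage L (fst (f L)) (snd (f L)) \<and> (fst (f L) \<subseteq> fst (f (Suc L)) \<and> snd (f L) \<le> snd (f (Suc L)))"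
  proof (rule dependent_nat_choice)
    show "\<exists>p. stage 0 (fst p) (snd p)" using stage_exists[OF fd_zero order_refl, of 0] by auto
    fix p L assume "stage L (fst p) (snd p)"
    then have "fd (fst p)" "0 \<le> snd p" by (auto simp: stage_def)
    from stage_exists[OF this, of "Suc L"] show "\<exists>q. stage (Suc L) (fst q) (snd q) \<and> fst p \<subseteq> fst q \<and> snd p \<le> snd q"
      by auto
  qed
  then obtain f where f: "\<And>L. stage L (fst (f L)) (snd (f L))"
    "\<And>L. fst (f L) \<subseteq> fst (f (Suc L))" "\<And>L. snd (f L) \<le> snd (f (Suc L))" by blast
  define a where "a = (\<lambda>L. fst (f L))"
  have path: "(link L (24 / (3 + real L)))\<^sup>+\<^sup>+ (a L) (a (Suc L))" for L
    unfolding a_def by (rule stage_path[OF f(1) f(1) f(2) f(3)])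
  obtain u l where ul: "mono l" "\<And>M. \<exists>j. l j = M" "\<And>j. link (l j) (24 / (3 + real (l j))) (u j) (u (Suc j))"
    "\<And>M. \<exists>j. l j = M \<and> u j = a M"
    using concat_paths[of "\<lambda>L. link L (24 / (3 + real L))" a, OF path] by blast
  have u: "fd (u i)" "u i \<subseteq> u (Suc i)" for i using ul(3)[of i] by (auto simp: link_def)
  have um: "u i \<subseteq> u j" if "i \<le> j" for i j using lift_Suc_mono_le[of u, OF u(2) that] .
  \<comment> \<open>Links serve the norms from 1 on, so the norm \<open>k\<close> is estimated by
    the norm \<open>Suc k\<close>.\<close>
  have "\<exists>i0. \<forall>i\<ge>i0. serve k (4 * Suc k + 15) e (u i) (u (Suc i))" if e: "0 < e" for k e
  proof -
    obtain M :: nat where M: "24 / e < real M" using reals_Archimedean2 by blast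
    obtain i0 where i0: "l i0 = max (Suc k) M" using ul(2) by blast
    have "serve k (4 * Suc k + 15) e (u i) (u (Suc i))" if i: "i \<ge> i0" for i
      unfolding serve_def
    proof (intro ballI)
      fix s x assume s: "s \<in> u (Suc i)" and x: "x \<in> V"
      have sV: "s \<in> V" using s u(1) fd_V by blast
      have li: "max (Suc k) M \<le> l i" using ul(1) i i0 by (metis monoD)
      have "serve (Suc k) (4 * Suc k + 15) (24 / (3 + real (l i))) (u i) (u (Suc i))"
        using ul(3)[of i] li unfolding link_def by auto
      then have "N (Suc k) s * n0 (x - proj (u i) x) \<le> 24 / (3 + real (l i)) * n0 s * N (4 * Suc k + 15) x"
        using s x unfolding serve_def by blast
      also have "\<dots> \<le> e * n0 s * N (4 * Suc k + 15) x"
      proof (intro mult_right_mono)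
        have "24 / e \<le> 3 + real (l i)" using M li by linarith
        then show "24 / (3 + real (l i)) \<le> e" using e by (simp add: field_simps)
      qed (use N_ge0[OF x] in auto)
      finally show "N k s * n0 (x - proj (u i) x) \<le> e * n0 s * N (4 * Suc k + 15) x"
        using mult_right_mono[OF N_Suc[OF sV, of k], of "n0 (x - proj (u i) x)"] by simp
    qed
    then show ?thesis by blast
  qed
  moreover have "\<exists>i0. \<forall>i\<ge>i0. \<forall>x\<in>V. n0 (x - proj (u i) x) \<le> e * N 1 x" if e: "0 < e" for e
  proof -
    obtain M :: nat where M: "3 / e < real M" using reals_Archimedean2 by blast
    obtain j where j: "u j = a M" using ul(4) by blast
    have "n0 (x - proj (u i) x) \<le> e * N 1 x" if "i \<ge> j" "x \<in> V" for i x
    proof -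
      let ?t = "snd (f M)"
      have s: "stage M (u j) ?t" using f(1) j by (simp add: a_def)
      have n: "n0 (x - proj (u i) x) \<le> n0 (x - proj (u j) x)" by (rule proj_mono[OF u(1) u(1) um[OF that(1)] that(2)])
      have "b 0 ?t * n0 (x - proj (u j) x) \<le> 3 * N 1 x" using s that(2) unfolding stage_def by (metis One_nat_def zero_le)
      moreover have "real M \<le> b 0 ?t" using s by (simp add: stage_def)
      ultimately have "real M * n0 (x - proj (u j) x) \<le> 3 * N 1 x"
        using mult_right_mono[of "real M" "b 0 ?t" "n0 (x - proj (u j) x)"] by simp
      then have "3 / e * n0 (x - proj (u j) x) \<le> 3 * N 1 x"
        using mult_right_mono[of "3 / e" "real M" "n0 (x - proj (u j) x)"] M by simp
      then have "n0 (x - proj (u j) x) \<le> e * N 1 x" using e by (simp add: field_simps)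
      then show ?thesis using n by linarith
    qed
    then show ?thesis by blast
  qed
  ultimately show ?thesis using u by blast
qed

end

context graded
begin

subsection \<open>Bases adapted to a flag\<close>

text \<open>With \<open>s = proj W x\<close>, (DN) bounds the square of \<open>N k (x - s)\<close>
  by the distance of \<open>x\<close> to \<open>U i\<close> times
  \<open>N (Suc k) x + N (Suc k) s\<close>. The first product is small by density, the second by
  \<open>serve\<close>, as \<open>s\<close> lies in \<open>U (Suc i)\<close>. Arbitrary
  \<open>W\<close> between two neighbours of the flag cover partial sums inside a step.\<close>

lemma flag_conv:
  assumes U: "\<And>i. fd (U i)" "\<And>i. U i \<subseteq> U (Suc i)"
    and serve: "\<And>k. \<exists>Q. \<forall>e>0. \<exists>i0. \<forall>i\<ge>i0. serve k Q e (U i) (U (Suc i))"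
    and dense: "\<And>e. 0 < e \<Longrightarrow> \<exists>i0. \<forall>i\<ge>i0. \<forall>x\<in>V. n0 (x - proj (U i) x) \<le> e * N 1 x"
    and x: "x \<in> V" and e: "0 < e"
  shows "\<exists>i0. \<forall>i\<ge>i0. \<forall>W. fd W \<and> U i \<subseteq> W \<and> W \<subseteq> U (Suc i) \<longrightarrow> N k (x - proj W x) < e"
proof -
  define d where "d = e\<^sup>2 / 4"
  have d: "0 < d" using e by (simp add: d_def)
  have small: "\<exists>p>0. p * C \<le> d" if "0 \<le> C" for C
    using that d by (intro exI[of _ "d / (1 + C)"]) (auto simp: divide_simps)
  obtain p where p: "0 < p" "p * (N 1 x * N (Suc k) x) \<le> d" using small N_ge0[OF x] by (meson mult_nonneg_nonneg)
  obtain i1 where i1: "\<And>i. i \<ge> i1 \<Longrightarrow> n0 (x - proj (U i) x) \<le> p * N 1 x" using dense[OF p(1)] x by blast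
  obtain Q where Q: "\<And>q. 0 < q \<Longrightarrow> \<exists>i0. \<forall>i\<ge>i0. serve (Suc k) Q q (U i) (U (Suc i))" using serve by blast
  obtain q where q: "0 < q" "q * (n0 x * N Q x) \<le> d" using small N_ge0[OF x] by (meson mult_nonneg_nonneg n0_ge0)
  obtain i2 where i2: "\<And>i. i \<ge> i2 \<Longrightarrow> serve (Suc k) Q q (U i) (U (Suc i))" using Q[OF q(1)] by blast
  have "N k (x - proj W x) < e" if i: "i \<ge> max i1 i2" and W: "fd W" "U i \<subseteq> W" "W \<subseteq> U (Suc i)" for i W
  proof -
    let ?s = "proj W x" and ?\<delta> = "n0 (x - proj (U i) x)"
    have s: "?s \<in> U (Suc i)" "?s \<in> V" using proj_in[OF W(1)] proj_V[OF W(1)] W by auto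
    have zV: "x - ?s \<in> V" using x s V_diff by blast
    have "(N k (x - ?s))\<^sup>2 \<le> n0 (x - ?s) * N (Suc k) (x - ?s)" by (rule N_DN[OF zV])
    also have "\<dots> \<le> ?\<delta> * (N (Suc k) x + N (Suc k) ?s)"
      by (rule mult_mono[OF proj_mono[OF U(1) W(1,2) x] N_diff[OF x s(2)]]) (use N_ge0[OF zV] in auto)
    also have "\<dots> = ?\<delta> * N (Suc k) x + N (Suc k) ?s * ?\<delta>" by (simp add: distrib_left)
    also have "?\<delta> * N (Suc k) x \<le> (p * N 1 x) * N (Suc k) x"
      using i1[of i] i N_ge0[OF x] by (intro mult_right_mono) auto
    also have "N (Suc k) ?s * ?\<delta> \<le> q * n0 ?s * N Q x" using i2[of i] i s x unfolding serve_def by auto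
    also have "\<dots> \<le> q * n0 x * N Q x"
      using n0_proj_le[OF W(1) x] q N_ge0[OF x] by (intro mult_right_mono mult_left_mono) auto
    finally have "(N k (x - ?s))\<^sup>2 \<le> 2 * d" using p q by (simp add: mult.assoc)
    also have "\<dots> < e\<^sup>2" using e by (simp add: d_def)
    finally show ?thesis by (rule power2_less_imp_less) (use e in simp)
  qed
  then show ?thesis by blast
qed

lemma proj_span:
  assumes B: "orthn B" and x: "x \<in> V"
  shows "proj (span B) x = pr B x"
proof (rule proj_eqI[OF _ x pr_span])
  show "fd (span B)" using B by (auto simp: fd_def)
  show "ip (x - pr B x) s = 0" if "s \<in> span B" for s
    by (rule orth_span[OF _ V_diff[OF x pr_V[OF B]] pr_orth1[OF B x] that]) (use B in \<open>simp_all add: orthn_def\<close>)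
qed

lemma proj_take:
  assumes "orthn (set ys)" "distinct ys" "n \<le> length ys" "x \<in> V"
  shows "fd (span (set (take n ys)))" "proj (span (set (take n ys))) x = (\<Sum>j<n. sc (ip x (ys ! j)) (ys ! j))"
proof -
  have o: "orthn (set (take n ys))" using assms(1) unfolding orthn_def by (auto dest!: in_set_takeD)
  then show "fd (span (set (take n ys)))" by (auto simp: fd_def)
  have "proj (span (set (take n ys))) x = pr (set (take n ys)) x" by (rule proj_span[OF o assms(4)])
  also have "\<dots> = (\<Sum>j<n. sc (ip x (ys ! j)) (ys ! j))"
    unfolding nth_image[OF assms(3), symmetric] atLeast0LessThan pr_def by (rule sum.reindex[unfolded comp_def]) (use assms in \<open>auto simp: inj_on_def nth_eq_iff_index_eq\<close>)
  finally show "proj (span (set (take n ys))) x = (\<Sum>j<n. sc (ip x (ys ! j)) (ys ! j))" .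
qed

text \<open>Orthonormal lists for the spaces of the flag are prolonged one after the other. A late
  partial sum of the expansion is then the projection onto a space between two neighbours, to which
  \<open>flag_conv\<close> applies. If the flag becomes stationary, \<open>M\<close> is
  finite.\<close>

theorem flag_basis:
  assumes U: "\<And>i. fd (U i)" "\<And>i. U i \<subseteq> U (Suc i)"
    and serve: "\<And>k. \<exists>Q. \<forall>e>0. \<exists>i0. \<forall>i\<ge>i0. serve k Q e (U i) (U (Suc i))"
    and dense: "\<And>e. 0 < e \<Longrightarrow> \<exists>i0. \<forall>i\<ge>i0. \<forall>x\<in>V. n0 (x - proj (U i) x) \<le> e * N 1 x"
  shows "\<exists>(M :: enat) f. (\<forall>j. enat j < M \<longrightarrow> f j \<in> V) \<and>
    (\<forall>i j. enat i < M \<longrightarrow> enat j < M \<longrightarrow> ip (f i) (f j) = (if i = j then 1 else 0)) \<and>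
    (\<forall>x\<in>V. \<forall>k. (\<lambda>n. N k (x - (\<Sum>j<n. sc (if enat j < M then ip x (f j) else 0) (f j)))) \<longlonglongrightarrow> 0)"
proof -
  let ?ok = "\<lambda>i ys. distinct ys \<and> orthn (set ys) \<and> span (set ys) = U i"
  have "\<exists>xs. \<forall>i. ?ok i (xs i) \<and> (\<exists>ys. xs (Suc i) = xs i @ ys)"
  proof (rule dependent_nat_choice)
    obtain B where B: "orthn B" "span B = U 0" using U(1) fd_def by blast
    then obtain ys where "set ys = B" "distinct ys" using finite_distinct_list[of B] by (auto simp: orthn_def)
    then show "\<exists>ys. ?ok 0 ys" using B by auto
  next
    fix xs i assume xs: "?ok i xs"
    obtain C where C: "orthn C" "span C = U (Suc i)" using U(1) fd_def by blast
    obtain B where B: "orthn B" "set xs \<subseteq> B" "span B = span (set xs \<union> C)"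
      using orthn_extend[of "set xs" C] xs C by (auto simp: orthn_def)
    have "span B = U (Suc i)"
    proof
      have "set xs \<subseteq> span C" using xs U(2)[of i] span_superset[of "set xs"] C by auto
      then show "span B \<subseteq> U (Suc i)" unfolding B(3) C(2)[symmetric] using span_superset[of C] by (intro span_minimal) auto
      show "U (Suc i) \<subseteq> span B" unfolding B(3) C(2)[symmetric] by (intro span_mono) auto
    qed
    moreover obtain ys where ys: "set ys = B - set xs" "distinct ys"
      using finite_distinct_list[of "B - set xs"] B by (auto simp: orthn_def)
    moreover have "set (xs @ ys) = B" using ys B by auto
    ultimately have "?ok (Suc i) (xs @ ys)" using xs B by auto
    then show "\<exists>zs. ?ok (Suc i) zs \<and> (\<exists>ys. zs = xs @ ys)" by blast
  qed
  then obtain xs where ok: "\<And>i. distinct (xs i)" "\<And>i. orthn (set (xs i))" "\<And>i. span (set (xs i)) = U i"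
    and app: "\<And>i. \<exists>ys. xs (Suc i) = xs i @ ys" by blast
  have pre: "\<exists>ys. xs i' = xs i @ ys" if "i \<le> i'" for i i'
    using that
  proof (induction rule: dec_induct)
    case (step m)
    then show ?case using app[of m] by (metis append.assoc)
  qed auto
  have len: "length (xs i) \<le> length (xs i')" if "i \<le> i'" for i i'
    using pre[OF that] by auto
  have nth: "xs i ! j = xs i' ! j" if "j < length (xs i)" "j < length (xs i')" for i i' j
    using that by (cases rule: linorder_le_cases[of i i']) (use pre in \<open>force simp: nth_append\<close>)+
  \<comment> \<open>Unspecified at indices beyond all lists; the coefficients are set to 0
    there.\<close>
  define f where "f = (\<lambda>j. xs (SOME i. j < length (xs i)) ! j)"
  have f: "f j = xs i ! j" if "j < length (xs i)" for i j
    unfolding f_def by (rule nth[OF someI[of _ i] that]) (rule that)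
  define M where "M = (SUP i. enat (length (xs i)))"
  have M: "enat j < M \<longleftrightarrow> (\<exists>i. j < length (xs i))" for j unfolding M_def less_SUP_iff by simp
  have inV: "f j \<in> V" if j: "enat j < M" for j
  proof -
    obtain i where i: "j < length (xs i)" using j unfolding M by blast
    then have "xs i ! j \<in> V" using ok(2)[of i] by (auto simp: orthn_def)
    then show ?thesis using f[OF i] by simp
  qed
  have on: "ip (f i) (f j) = (if i = j then 1 else 0)" if "enat i < M" "enat j < M" for i j
  proof -
    have "enat (max i j) < M" using that by (simp add: max_def)
    then obtain m where m: "max i j < length (xs m)" using M by blast
    then have "xs m ! i \<in> set (xs m)" "xs m ! j \<in> set (xs m)" "xs m ! i = xs m ! j \<longleftrightarrow> i = j"
      using ok(1)[of m] by (auto simp: nth_eq_iff_index_eq)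
    then have "ip (xs m ! i) (xs m ! j) = (if i = j then 1 else 0)" using ok(2)[of m] unfolding orthn_def by auto
    then show ?thesis using f[of i m] f[of j m] m by simp
  qed
  define P where "P = (\<lambda>n x. \<Sum>j<n. sc (if enat j < M then ip x (f j) else 0) (f j))"
  have P: "proj (span (set (take n (xs i)))) x = P n x" if "n \<le> length (xs i)" "x \<in> V" for n i x
    unfolding P_def proj_take(2)[OF ok(2,1) that] 
  proof (rule sum.cong[OF refl])
    fix j assume "j \<in> {..<n}"
    then have j: "j < length (xs i)" using that by simp
    then have "enat j < M" unfolding M by blast
    then show "sc (ip x (xs i ! j)) (xs i ! j) = sc (if enat j < M then ip x (f j) else 0) (f j)" by (simp add: f[OF j])
  qed
  have layer: "\<exists>i'\<ge>i. \<exists>W. fd W \<and> U i' \<subseteq> W \<and> W \<subseteq> U (Suc i') \<and> proj W x = P n x"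
    if n: "length (xs i) \<le> n" and x: "x \<in> V" for n i x
  proof (cases "\<exists>m. n < length (xs m)")
    case True
    define m where "m = (LEAST m. n < length (xs m))"
    have m: "n < length (xs m)" unfolding m_def using True by (rule LeastI_ex)
    have least: "length (xs m') \<le> n" if "m' < m" for m' using not_less_Least[of m' "\<lambda>m. n < length (xs m)"] that m_def by auto
    have im: "i < m" using len[of m i] n m by linarith
    then obtain i' where i': "m = Suc i'" by (cases m) auto
    obtain ys where ys: "xs m = xs i' @ ys" using app[of i'] i' by auto
    have "length (xs i') \<le> n" using least[of i'] i' by simp
    then have sub: "set (xs i') \<subseteq> set (take n (xs m))" unfolding ys by auto
    have "U i' \<subseteq> span (set (take n (xs m)))" unfolding ok(3)[symmetric] by (rule span_mono[OF sub])
    moreover have "span (set (take n (xs m))) \<subseteq> U (Suc i')"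
      unfolding ok(3)[symmetric] i' by (rule span_mono[OF set_take_subset])
    ultimately show ?thesis
      using P[of n m x] proj_take(1)[OF ok(2,1), of n m x] m x im i' by (intro exI[of _ i']) auto
  next
    case False
    then have bd: "\<And>m. length (xs m) \<le> n" by (meson not_le_imp_less)
    \<comment> \<open>The lists are bounded in length; from a longest one on, the partial sum is the
      projection onto the space of the flag itself.\<close>
    obtain i2 where i2: "\<And>m. length (xs m) \<le> length (xs i2)"
      using ex_has_greatest_nat[of "\<lambda>_. True" 0 "\<lambda>m. length (xs m)" "Suc n"] bd by (auto simp: less_Suc_eq_le)
    define i' where "i' = max i i2"
    have i': "i \<le> i'" "\<And>m. length (xs m) \<le> length (xs i')"
      using i2 len[of i2 i'] by (auto simp: i'_def intro: order_trans)
    have "proj (U i') x = P (length (xs i')) x" using P[of "length (xs i')" i' x] x ok(3) by simp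
    also have "\<dots> = P n x"
      unfolding P_def
    proof (rule sum.mono_neutral_left)
      show "\<forall>j\<in>{..<n} - {..<length (xs i')}. sc (if enat j < M then ip x (f j) else 0) (f j) = 0"
        using i'(2) M by (auto simp: not_less) (meson leD less_le_trans)
    qed (use bd in auto)
    finally show ?thesis using i'(1) U by blast
  qed
  have "(\<lambda>n. N k (x - P n x)) \<longlonglongrightarrow> 0" if x: "x \<in> V" for x k
  proof (rule LIMSEQ_I)
    fix e :: real assume e: "0 < e"
    obtain i0 where i0: "\<And>i W. i \<ge> i0 \<Longrightarrow> fd W \<Longrightarrow> U i \<subseteq> W \<Longrightarrow> W \<subseteq> U (Suc i) \<Longrightarrow> N k (x - proj W x) < e"
      using flag_conv[OF U serve dense x e] by blast
    have "norm (N k (x - P n x) - 0) < e" if n: "n \<ge> length (xs i0)" for n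
    proof -
      obtain i' W where W: "i' \<ge> i0" "fd W" "U i' \<subseteq> W" "W \<subseteq> U (Suc i')" "proj W x = P n x"
        using layer[OF n x] by blast
      have "x - P n x \<in> V" using proj_V[OF W(2), of x] W(5) x V_diff by simp
      then show ?thesis using i0[OF W(1-4)] W(5) N_ge0 by simp
    qed
    then show "\<exists>no. \<forall>n\<ge>no. norm (N k (x - P n x) - 0) < e" by blast
  qed
  then show ?thesis using inV on unfolding P_def by blast
qed

end

subsection \<open>Relabelling the norms, and real levels\<close>

lemma exp_interp:
  fixes x y :: real
  assumes "0 < x" "x \<le> y" "0 \<le> s" "s \<le> 1"
  shows "x \<le> x powr (1 - s) * y powr s" "x powr (1 - s) * y powr s \<le> y"
proof -
  have "x powr (1 - s) * x powr s \<le> x powr (1 - s) * y powr s"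
    using assms by (intro mult_left_mono powr_mono2) auto
  moreover have "x powr (1 - s) * x powr s = x" using assms by (simp flip: powr_add)
  ultimately show "x \<le> x powr (1 - s) * y powr s" by simp
  have "x powr (1 - s) * y powr s \<le> y powr (1 - s) * y powr s"
    using assms by (intro mult_right_mono powr_mono2) auto
  moreover have "y powr (1 - s) * y powr s = y" using assms by (simp flip: powr_add)
  ultimately show "x powr (1 - s) * y powr s \<le> y" by simp
qed

text \<open>Interpolating the logarithms linearly preserves the inequality between \<open>f\<^sup>2\<close> and \<open>g\<close>.\<close>

definition interp :: "(nat \<Rightarrow> real) \<Rightarrow> real \<Rightarrow> real" where
  "interp f t = f (nat \<lfloor>t\<rfloor>) powr (1 - frac t) * f (Suc (nat \<lfloor>t\<rfloor>)) powr frac t"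

lemma interp_bounds:
  assumes "\<And>n. 0 < f n" "\<And>n. f n \<le> f (Suc n)"
  shows "f (nat \<lfloor>t\<rfloor>) \<le> interp f t" "interp f t \<le> f (Suc (nat \<lfloor>t\<rfloor>))"
  unfolding interp_def using exp_interp[of "f (nat \<lfloor>t\<rfloor>)" "f (Suc (nat \<lfloor>t\<rfloor>))" "frac t"] assms frac_lt_1[of t] by auto

lemma interp_mono:
  assumes f: "\<And>n. 0 < f n" "\<And>n. f n \<le> f (Suc n)" and t: "0 \<le> t" "t \<le> u"
  shows "interp f t \<le> interp f u"
proof (cases "\<lfloor>t\<rfloor> = \<lfloor>u\<rfloor>")
  case True
  let ?x = "f (nat \<lfloor>u\<rfloor>)" and ?y = "f (Suc (nat \<lfloor>u\<rfloor>))"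
  have le: "frac t \<le> frac u" using t True by (simp add: frac_def)
  have e: "?x powr (1 - s) * ?y powr s = ?x * (?y / ?x) powr s" for s
    using f(1)[of "nat \<lfloor>u\<rfloor>"] f(1)[of "Suc (nat \<lfloor>u\<rfloor>)"] by (simp add: powr_diff powr_divide)
  have "1 \<le> ?y / ?x" using f by simp
  then have "(?y / ?x) powr frac t \<le> (?y / ?x) powr frac u" using le by (intro powr_mono)
  then have "?x * (?y / ?x) powr frac t \<le> ?x * (?y / ?x) powr frac u" using f(1)[of "nat \<lfloor>u\<rfloor>"] by simp
  then show ?thesis unfolding interp_def True e .
next
  case False
  then have "Suc (nat \<lfloor>t\<rfloor>) \<le> nat \<lfloor>u\<rfloor>" using t floor_mono[OF t(2)] by linarith
  then have "f (Suc (nat \<lfloor>t\<rfloor>)) \<le> f (nat \<lfloor>u\<rfloor>)" using lift_Suc_mono_le[of f] f(2) by blast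
  then show ?thesis using interp_bounds[of f t, OF f] interp_bounds[of f u, OF f] by linarith
qed

lemma interp_sq:
  assumes "\<And>n. 0 < f n" "\<And>n. (f n)\<^sup>2 \<le> g n"
  shows "(interp f t)\<^sup>2 \<le> interp g t"
proof -
  have e: "((f n) powr s)\<^sup>2 = ((f n)\<^sup>2) powr s" for n s
    using assms(1)[of n] by (simp add: power2_eq_square powr_mult)
  have "(interp f t)\<^sup>2 = (f (nat \<lfloor>t\<rfloor>))\<^sup>2 powr (1 - frac t) * (f (Suc (nat \<lfloor>t\<rfloor>)))\<^sup>2 powr frac t"
    unfolding interp_def power_mult_distrib e ..
  also have "\<dots> \<le> interp g t"
    unfolding interp_def using frac_lt_1[of t] assms(2) by (intro mult_mono powr_mono2) auto
  finally show ?thesis .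
qed

lemma interp_ivt:
  assumes f: "\<And>n. 0 < f n" "\<And>n. f n \<le> f (Suc n)" and unb: "\<And>C. \<exists>n. C < f n" and \<beta>: "f 0 \<le> \<beta>"
  shows "\<exists>t\<ge>0. interp f t = \<beta>"
proof -
  define m where "m = (LEAST n. \<beta> < f n)"
  have m: "\<beta> < f m" unfolding m_def using unb by (rule LeastI_ex)
  then have "m \<noteq> 0" using \<beta> by (metis not_le)
  then obtain n where n: "m = Suc n" by (cases m) auto
  have n\<beta>: "f n \<le> \<beta>" using not_less_Least[of n "\<lambda>n. \<beta> < f n"] n m_def by auto
  let ?x = "f n" and ?y = "f (Suc n)"
  have xy: "0 < ?x" "?x < ?y" using f(1) n\<beta> m n by auto
  define s where "s = ln (\<beta> / ?x) / ln (?y / ?x)"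
  have l: "0 < ln (?y / ?x)" using xy by simp
  have s: "0 \<le> s" "s < 1"
    using l n\<beta> m n xy by (auto simp: s_def intro!: divide_strict_right_mono)
  have fl: "\<lfloor>real n + s\<rfloor> = int n" using s by linarith
  have "interp f (real n + s) = ?x powr (1 - s) * ?y powr s"
    unfolding interp_def frac_def fl by simp
  also have "\<dots> = ?x * (?y / ?x) powr s" using xy by (simp add: powr_diff powr_divide)
  also have "(?y / ?x) powr s = \<beta> / ?x"
    using xy n\<beta> l by (simp add: powr_def s_def)
  finally show ?thesis using xy s by (intro exI[of _ "real n + s"]) auto
qed

section \<open>From cuts at integer levels to cuts at real levels\<close>

context graded
begin

text \<open>The estimates lose indices according to \<open>\<tau>\<close>; the norms are thinned to
  \<open>\<sigma>\<close>, along which the loss is a single step. The Jackson hypothesis is stated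
  at \<open>Suc n\<close> because the cut with number \<open>n\<close> is used at all real levels
  between \<open>n\<close> and \<open>n + 1\<close>.\<close>

theorem basis_of_cuts:
  fixes b :: "nat \<Rightarrow> nat \<Rightarrow> real" and \<tau> :: "nat \<Rightarrow> nat"
  assumes b2: "\<And>k n. 2 \<le> b k n" and bm: "\<And>k n. b k n \<le> b k (Suc n)" and bs: "\<And>k n. (b k n)\<^sup>2 \<le> b (Suc k) n"
    and unb: "\<And>k C. \<exists>n. C < b k n" and \<tau>: "\<And>k. k < \<tau> k"
    and cut: "\<And>L. \<exists>T. \<forall>n\<ge>T. \<exists>S. fd S \<and> (\<forall>k\<le>L. bern k S (b (\<tau> k) n) \<and>
      (\<forall>x\<in>V. b k (Suc n) * n0 (x - proj S x) \<le> N (\<tau> k) x))"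
  shows "\<exists>(M :: enat) f. (\<forall>j. enat j < M \<longrightarrow> f j \<in> V) \<and>
    (\<forall>i j. enat i < M \<longrightarrow> enat j < M \<longrightarrow> ip (f i) (f j) = (if i = j then 1 else 0)) \<and>
    (\<forall>x\<in>V. \<forall>k. (\<lambda>n. N k (x - (\<Sum>j<n. sc (if enat j < M then ip x (f j) else 0) (f j)))) \<longlonglongrightarrow> 0)"
proof -
  define \<sigma> where "\<sigma> = rec_nat 0 (\<lambda>_ k. \<tau> k)"
  have \<sigma>_Suc: "\<sigma> (Suc k) = \<tau> (\<sigma> k)" for k by (simp add: \<sigma>_def)
  have "strict_mono \<sigma>" using \<tau> by (simp add: strict_mono_Suc_iff \<sigma>_Suc)
  then have \<sigma>: "\<And>k. k \<le> \<sigma> k" "\<And>i k. i \<le> k \<Longrightarrow> \<sigma> i \<le> \<sigma> k"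
    by (auto simp: strict_mono_imp_increasing strict_mono_less_eq)
  let ?good = "\<lambda>k n S. bern k S (b (\<tau> k) n) \<and> (\<forall>x\<in>V. b k (Suc n) * n0 (x - proj S x) \<le> N (\<tau> k) x)"
  obtain T where T: "\<And>L n. T L \<le> n \<Longrightarrow> \<exists>S. fd S \<and> (\<forall>k\<le>L. ?good k n S)" using cut by metis
  \<comment> \<open>The sum is monotone in \<open>k\<close>, bounds \<open>T (\<sigma> k)\<close>,
    and is at least \<open>k\<close>, so that at each level only finitely many norms have to be
    served.\<close>
  define w where "w = (\<lambda>k. \<Sum>i\<le>\<sigma> k. T i + 1)"
  have w_mono: "w i \<le> w k" if "i \<le> k" for i k
    unfolding w_def using \<sigma>(2)[OF that] by (intro sum_mono2) auto
  have wk: "k \<le> w k" for k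
  proof -
    have "(\<Sum>i\<le>\<sigma> k. 1) \<le> w k" unfolding w_def by (intro sum_mono) auto
    then show ?thesis using \<sigma>(1)[of k] by simp
  qed
  have wT: "T (\<sigma> k) \<le> w k" for k
  proof -
    have "T (\<sigma> k) + 1 \<le> w k" unfolding w_def by (rule member_le_sum) auto
    then show ?thesis by simp
  qed
  have "\<exists>S. fd S \<and> (\<forall>k. w k \<le> n \<longrightarrow> ?good (\<sigma> k) n S)" for n
  proof (cases "w 0 \<le> n")
    case True
    have "\<forall>i. w i \<le> n \<longrightarrow> i < Suc n" by (meson wk le_imp_less_Suc order_trans)
    then obtain k where k: "w k \<le> n" "\<And>i. w i \<le> n \<Longrightarrow> i \<le> k"
      using ex_has_greatest_nat[of "\<lambda>k. w k \<le> n" 0 "\<lambda>k. k" "Suc n"] True by blast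
    obtain S where "fd S" "\<forall>i\<le>\<sigma> k. ?good i n S" using T[of "\<sigma> k" n] wT[of k] k(1) by (meson order_trans)
    then show ?thesis using k(2) \<sigma>(2) by blast
  next
    case False
    then have "\<not> w k \<le> n" for k using w_mono[of 0 k] by linarith
    then show ?thesis using fd_zero by blast
  qed
  then obtain S where S: "\<And>n. fd (S n)" "\<And>n k. w k \<le> n \<Longrightarrow> ?good (\<sigma> k) n (S n)" by metis
  have bpos: "0 < b k n" for k n using b2[of k n] by linarith
  have bsuc: "(b k n)\<^sup>2 \<le> b m n" if "Suc k \<le> m" for k m n
    using that
  proof (induction rule: dec_induct)
    case (step m)
    have "b m n * 1 \<le> b m n * b m n" using b2[of m n] by (intro mult_left_mono) auto
    then show ?case using step bs[of m n] by (simp add: power2_eq_square)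
  qed (rule bs)
  interpret g: graded cj sc V ip "\<lambda>k. N (\<sigma> k)"
  proof unfold_locales
    fix x k assume x: "x \<in> V"
    have le: "Suc (\<sigma> k) \<le> \<sigma> (Suc k)" using \<tau>[of "\<sigma> k"] by (simp add: \<sigma>_Suc)
    show "N (\<sigma> k) x \<le> N (\<sigma> (Suc k)) x" by (rule N_mono[OF \<sigma>(2) x]) simp
    have "(N (\<sigma> k) x)\<^sup>2 \<le> n0 x * N (Suc (\<sigma> k)) x" by (rule N_DN[OF x])
    also have "\<dots> \<le> n0 x * N (\<sigma> (Suc k)) x" using N_mono[OF le x] by (intro mult_left_mono) auto
    finally show "(N (\<sigma> k) x)\<^sup>2 \<le> n0 x * N (\<sigma> (Suc k)) x" .
  qed (use N_ge0 N_tri N_sc n0_N in auto)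
  have gb: "g.bern k S c \<longleftrightarrow> bern (\<sigma> k) S c" for k S c by (simp add: g.bern_def bern_def)
  interpret c: cuts cj sc V ip "\<lambda>k. N (\<sigma> k)" "\<lambda>k. interp (b (\<sigma> k))" "\<lambda>t. S (nat \<lfloor>t\<rfloor>)" "\<lambda>k. real (w k)"
  proof unfold_locales
    fix k and t :: real assume t: "0 \<le> t"
    show "2 \<le> interp (b (\<sigma> k)) t" using interp_bounds(1)[of "b (\<sigma> k)" t, OF bpos bm] b2[of "\<sigma> k" "nat \<lfloor>t\<rfloor>"] by linarith
    show "(interp (b (\<sigma> k)) t)\<^sup>2 \<le> interp (b (\<sigma> (Suc k))) t"
      by (rule interp_sq[of "b (\<sigma> k)" "b (\<sigma> (Suc k))", OF bpos bsuc]) (simp add: \<sigma>_Suc \<tau> Suc_leI)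
    show "fd (S (nat \<lfloor>t\<rfloor>))" by (rule S)
  next
    fix k and t u :: real assume "0 \<le> t" "t \<le> u"
    then show "interp (b (\<sigma> k)) t \<le> interp (b (\<sigma> k)) u" by (rule interp_mono[of "b (\<sigma> k)", OF bpos bm])
  next
    fix k and \<beta> :: real assume \<beta>: "interp (b (\<sigma> k)) 0 \<le> \<beta>"
    then have "b (\<sigma> k) 0 \<le> \<beta>" using interp_bounds(1)[of "b (\<sigma> k)" 0, OF bpos bm] by simp
    then show "\<exists>t\<ge>0. interp (b (\<sigma> k)) t = \<beta>" by (rule interp_ivt[of "b (\<sigma> k)", OF bpos bm unb])
  next
    fix k and t :: real assume t: "real (w k) \<le> t"
    then have n: "w k \<le> nat \<lfloor>t\<rfloor>" by linarith
    note good = S(2)[OF n, folded \<sigma>_Suc]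
    show "g.bern k (S (nat \<lfloor>t\<rfloor>)) (interp (b (\<sigma> (Suc k))) t)"
      unfolding gb by (rule bern_mono[OF conjunct1[OF good] interp_bounds(1)[of "b (\<sigma> (Suc k))", OF bpos bm]])
    fix x assume x: "x \<in> V"
    have "interp (b (\<sigma> k)) t * n0 (x - proj (S (nat \<lfloor>t\<rfloor>)) x) \<le> b (\<sigma> k) (Suc (nat \<lfloor>t\<rfloor>)) * n0 (x - proj (S (nat \<lfloor>t\<rfloor>)) x)"
      by (rule mult_right_mono[OF interp_bounds(2)[of "b (\<sigma> k)", OF bpos bm] n0_ge0])
    also have "\<dots> \<le> N (\<sigma> (Suc k)) x" using good x by blast
    finally show "interp (b (\<sigma> k)) t * n0 (x - proj (S (nat \<lfloor>t\<rfloor>)) x) \<le> N (\<sigma> (Suc k)) x" .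
  qed (use w_mono in auto)
  obtain U where U: "(\<forall>i. fd (U i) \<and> U i \<subseteq> U (Suc i)) \<and>
    (\<forall>k. \<exists>Q. \<forall>e>0. \<exists>i0. \<forall>i\<ge>i0. g.serve k Q e (U i) (U (Suc i))) \<and>
    (\<forall>e>0. \<exists>i0. \<forall>i\<ge>i0. \<forall>x\<in>V. n0 (x - proj (U i) x) \<le> e * N (\<sigma> 1) x)"
    using c.flag_exists by (rule exE)
  note U' = U[THEN conjunct1] U[THEN conjunct2, THEN conjunct1] U[THEN conjunct2, THEN conjunct2]
  obtain M :: enat and f where f: "\<And>j. enat j < M \<Longrightarrow> f j \<in> V"
    "\<And>i j. enat i < M \<Longrightarrow> enat j < M \<Longrightarrow> ip (f i) (f j) = (if i = j then 1 else 0)"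
    "\<And>x k. x \<in> V \<Longrightarrow> (\<lambda>n. N (\<sigma> k) (x - (\<Sum>j<n. sc (if enat j < M then ip x (f j) else 0) (f j)))) \<longlonglongrightarrow> 0"
    using g.flag_basis[OF U'(1)[rule_format, THEN conjunct1] U'(1)[rule_format, THEN conjunct2] U'(2)[rule_format] U'(3)[rule_format]]
    by blast
  have "(\<lambda>n. N k (x - (\<Sum>j<n. sc (if enat j < M then ip x (f j) else 0) (f j)))) \<longlonglongrightarrow> 0" if x: "x \<in> V" for x k
  proof (rule tendsto_sandwich[OF _ _ tendsto_const f(3)[OF x, of k]])
    have V: "x - (\<Sum>j<n. sc (if enat j < M then ip x (f j) else 0) (f j)) \<in> V" for n
      using f(1) by (intro V_diff[OF x] V_sum) (auto intro: V_sc)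
    show "\<forall>\<^sub>F n in sequentially. 0 \<le> N k (x - (\<Sum>j<n. sc (if enat j < M then ip x (f j) else 0) (f j)))"
      using N_ge0[OF V] by simp
    show "\<forall>\<^sub>F n in sequentially. N k (x - (\<Sum>j<n. sc (if enat j < M then ip x (f j) else 0) (f j)))
       \<le> N (\<sigma> k) (x - (\<Sum>j<n. sc (if enat j < M then ip x (f j) else 0) (f j)))"
      using N_mono[OF \<sigma>(1) V] by simp
  qed
  then show ?thesis using f(1,2) by blast
qed

end

subsection \<open>Separating the scales\<close>

text \<open>Index \<open>i\<close> has \<open>i + 1\<close> candidate windows, from
  \<open>yp i s\<close> to \<open>z i s\<close>, in decreasing order and with disjoint interiors,
  whereas only \<open>i\<close> earlier positions \<open>y j (s j)\<close> can fall inside one. So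
  some window is avoided by all of them.\<close>

lemma choose_scales:
  fixes y yp z :: "nat \<Rightarrow> nat \<Rightarrow> nat"
  assumes z: "\<And>i s. i < L \<Longrightarrow> s \<le> i \<Longrightarrow> yp i s \<le> z i s" "\<And>i s. i < L \<Longrightarrow> s < i \<Longrightarrow> z i (Suc s) \<le> yp i s"
  shows "\<exists>s. \<forall>i<L. s i \<le> i \<and> (\<forall>j<i. z i (s i) \<le> y j (s j) \<or> y j (s j) \<le> yp i (s i))"
  using assms
proof (induction L)
  case (Suc L)
  have "\<exists>s. \<forall>i<L. s i \<le> i \<and> (\<forall>j<i. z i (s i) \<le> y j (s j) \<or> y j (s j) \<le> yp i (s i))"
    by (rule Suc.IH) (use Suc.prems in auto)
  then obtain s where s: "\<And>i. i < L \<Longrightarrow> s i \<le> i"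
    "\<And>i j. i < L \<Longrightarrow> j < i \<Longrightarrow> z i (s i) \<le> y j (s j) \<or> y j (s j) \<le> yp i (s i)" by blast
  have "\<exists>t\<le>L. \<forall>j<L. z L t \<le> y j (s j) \<or> y j (s j) \<le> yp L t"
  proof (rule ccontr)
    assume "\<not> ?thesis"
    then have "\<forall>t. \<exists>j. t \<le> L \<longrightarrow> j < L \<and> yp L t < y j (s j) \<and> y j (s j) < z L t" by (meson not_le)
    then obtain J where J: "\<And>t. t \<le> L \<Longrightarrow> J t < L \<and> yp L t < y (J t) (s (J t)) \<and> y (J t) (s (J t)) < z L t" by metis
    have "J ` {..L} \<subseteq> {..<L}" using J by auto
    then have "card (J ` {..L}) \<le> card {..<L}" by (intro card_mono) auto
    then have "card (J ` {..L}) < card {..L}" by simp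
    then have "\<not> inj_on J {..L}" by (rule pigeonhole)
    then obtain t t' where t: "t < t'" "t' \<le> L" "J t = J t'"
      unfolding inj_on_def by (metis atMost_iff linorder_neqE_nat)
    have anti: "z L v \<le> z L u" if "u \<le> v" "v \<le> L" for u v
      using that
    proof (induction rule: dec_induct)
      case (step v)
      then show ?case using Suc.prems(1)[of L v] Suc.prems(2)[of L v] by simp
    qed simp
    have "z L t' \<le> z L (Suc t)" using anti[of "Suc t" t'] t by simp
    also have "\<dots> \<le> yp L t" using Suc.prems(2)[of L t] t by simp
    finally show False using J[of t] J[of t'] t by simp
  qed
  then obtain t where t: "t \<le> L" "\<And>j. j < L \<Longrightarrow> z L t \<le> y j (s j) \<or> y j (s j) \<le> yp L t" by blast
  show ?case
    by (rule exI[of _ "s(L := t)"]) (use s t in \<open>auto simp: less_Suc_eq\<close>)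
qed simp

text \<open>Insertion sort: \<open>L\<close> is placed after the indices with
  \<open>y j \<le> yp L\<close>. For all others separation gives \<open>z L \<le> y j\<close>, which
  is what the relation asks of a later element of smaller index.\<close>

lemma order_scales:
  fixes y yp z :: "nat \<Rightarrow> nat"
  assumes le: "\<And>i. i < L \<Longrightarrow> yp i \<le> y i \<and> y i \<le> z i"
    and sep: "\<And>i j. i < L \<Longrightarrow> j < i \<Longrightarrow> z i \<le> y j \<or> y j \<le> yp i"
  shows "\<exists>l. distinct l \<and> set l = {..<L} \<and>
    sorted_wrt (\<lambda>a b. y a \<le> y b \<and> (b < a \<longrightarrow> z a \<le> y b) \<and> (a < b \<longrightarrow> y a \<le> yp b)) l"
  using assms
proof (induction L)
  case (Suc L)
  let ?G = "\<lambda>a b. y a \<le> y b \<and> (b < a \<longrightarrow> z a \<le> y b) \<and> (a < b \<longrightarrow> y a \<le> yp b)"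
  have "\<exists>l. distinct l \<and> set l = {..<L} \<and> sorted_wrt ?G l"
    by (rule Suc.IH) (use Suc.prems in auto)
  then obtain l where l: "distinct l" "set l = {..<L}" "sorted_wrt ?G l" by blast
  obtain P D where PD: "l = P @ D" "\<And>j. j \<in> set P \<Longrightarrow> y j \<le> yp L" "D = [] \<or> \<not> y (hd D) \<le> yp L"
  proof (rule that)
    show "l = takeWhile (\<lambda>j. y j \<le> yp L) l @ dropWhile (\<lambda>j. y j \<le> yp L) l" by simp
    show "y j \<le> yp L" if "j \<in> set (takeWhile (\<lambda>j. y j \<le> yp L) l)" for j using set_takeWhileD[OF that] by simp
    show "dropWhile (\<lambda>j. y j \<le> yp L) l = [] \<or> \<not> y (hd (dropWhile (\<lambda>j. y j \<le> yp L) l)) \<le> yp L"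
      using hd_dropWhile by blast
  qed
  have sP: "sorted_wrt ?G P" and sD: "sorted_wrt ?G D" and PxD: "\<And>a b. a \<in> set P \<Longrightarrow> b \<in> set D \<Longrightarrow> ?G a b"
    using l(3) unfolding PD(1) sorted_wrt_append by auto
  have lt: "set P \<union> set D = {..<L}" "distinct P" "distinct D" "set P \<inter> set D = {}"
    using l(1,2) unfolding PD(1) by auto
  have PL: "j < L" if "j \<in> set P" for j using that lt(1) by blast
  have DL: "j < L" if "j \<in> set D" for j using that lt(1) by blast
  have D: "yp L < y j" if j: "j \<in> set D" for j
  proof (cases D)
    case (Cons d D')
    have "y d \<le> y j" using sD j unfolding Cons by auto
    then show ?thesis using PD(3) unfolding Cons by simp
  qed (use j in simp)
  have zD: "z L \<le> y j" if j: "j \<in> set D" for j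
    using Suc.prems(2)[of L j] D[OF j] DL[OF j] by linarith
  have yL: "yp L \<le> y L" "y L \<le> z L" using Suc.prems(1)[of L] by simp_all
  have "sorted_wrt ?G (P @ L # D)"
    unfolding sorted_wrt_append sorted_wrt.simps
  proof (intro conjI ballI sP sD)
    fix a c assume a: "a \<in> set P" and c: "c \<in> set (L # D)"
    have "?G a c" using PD(2)[OF a] PL[OF a] PxD[OF a] c yL by (cases "c = L") auto
    then show "y a \<le> y c" "c < a \<longrightarrow> z a \<le> y c" "a < c \<longrightarrow> y a \<le> yp c" by simp_all
  next
    fix c assume c: "c \<in> set D"
    show "y L \<le> y c" "c < L \<longrightarrow> z L \<le> y c" "L < c \<longrightarrow> y L \<le> yp c"
      using zD[OF c] yL DL[OF c] by simp_all
  qed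
  moreover have "distinct (P @ L # D)" using lt(2-4) PL DL by auto
  moreover have "set (P @ L # D) = {..<Suc L}" using lt(1) by (simp add: lessThan_Suc)
  ultimately show ?case by blast
qed simp

subsection \<open>Cuts at a single level\<close>

context graded
begin

lemma proj_sum:
  assumes "fd S" "\<And>i. i \<in> I \<Longrightarrow> f i \<in> V"
  shows "proj S (sum f I) = (\<Sum>i\<in>I. proj S (f i))"
  using assms(2)
proof (induction I rule: infinite_finite_induct)
  case (insert i I)
  have "sum f I \<in> V" using insert by (intro V_sum) auto
  then show ?case using insert proj_add[OF assms(1)] by simp
qed (use proj_id[OF assms(1)] subspace_0[OF fd_sub(1)[OF assms(1)]] in auto)

lemma bern_osum:
  assumes "fd U" "fd W" "\<And>u v. u \<in> U \<Longrightarrow> v \<in> W \<Longrightarrow> ip u v = 0"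
    and "bern k U B" "bern k W C" "0 \<le> B" "0 \<le> C"
  shows "bern k (osum U W) (B + C)"
  unfolding bern_def
proof
  fix s assume "s \<in> osum U W"
  then obtain u v where s: "s = u + v" "u \<in> U" "v \<in> W" by (auto simp: osum_def)
  have uv: "u \<in> V" "v \<in> V" using s fd_V assms by auto
  have "N k s \<le> N k u + N k v" unfolding s(1) by (rule N_tri[OF uv])
  also have "\<dots> \<le> B * n0 u + C * n0 v" using bernD[OF assms(4) s(2)] bernD[OF assms(5) s(3)] by linarith
  also have "\<dots> \<le> B * n0 s + C * n0 s"
    using pythagoras_le[OF uv assms(3)[OF s(2,3)]] pythagoras_le2[OF uv assms(3)[OF s(2,3)]] assms(6,7)
    unfolding s(1) by (intro add_mono mult_left_mono)
  finally show "N k s \<le> (B + C) * n0 s" by (simp add: distrib_right)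
qed

end

text \<open>Here \<open>w n\<close> is the image of the normalised \<open>n\<close>-th unit vector, and \<open>lift\<close> expresses the openness
  of the operator onto its range, applied to truncated preimages.\<close>

locale lifts = graded +
  fixes b :: "nat \<Rightarrow> nat \<Rightarrow> real" and w :: "nat \<Rightarrow> 'b"
  assumes b2: "2 \<le> b k n" and bm: "b k n \<le> b k (Suc n)" and bs: "(b k n)\<^sup>2 \<le> b (Suc k) n"
    and unb: "\<exists>n. C < b 0 n"
    and interpol: "x \<in> V \<Longrightarrow> k \<le> m \<Longrightarrow> N k x \<le> b k z * n0 x + b k (Suc z) / b m (Suc z) * N m x"
    and wV: "w n \<in> V"
    and wN: "N k (\<Sum>n\<le>y. sc (c n) (w n)) \<le> sqrt (\<Sum>n\<le>y. (norm (c n) * b (Suc k) n)\<^sup>2)"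
    and lift: "x \<in> V \<Longrightarrow> 1 \<le> k \<Longrightarrow> \<exists>c. sqrt (\<Sum>n\<le>y. (norm (c n) * b k n)\<^sup>2) \<le> N (k + 3) x \<and>
      b k (Suc y) * n0 (x - (\<Sum>n\<le>y. sc (c n) (w n))) \<le> N (k + 3) x"
begin

lemma bpos: "0 < b k n" using b2[of k n] by linarith

lemma b_le: "k \<le> m \<Longrightarrow> b k n \<le> b m n"
proof (induction rule: dec_induct)
  case (step m)
  have "b m n * 1 \<le> b m n * b m n" using b2[of m n] by (intro mult_left_mono) auto
  then show ?case using step bs[of m n] by (simp add: power2_eq_square)
qed simp

lemma b_mono: "n \<le> n' \<Longrightarrow> b k n \<le> b k n'"
  using lift_Suc_mono_le[of "b k"] bm by blast

lemma b_4: "(b k n) ^ 4 \<le> b (k + 2) n"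
proof -
  have "((b k n)\<^sup>2)\<^sup>2 \<le> (b (Suc k) n)\<^sup>2" using bs by (intro power_mono) auto
  also have "\<dots> \<le> b (k + 2) n" using bs[of "Suc k" n] by simp
  finally show ?thesis by simp
qed

lemma b_8: "(b k n) ^ 8 \<le> b (k + 3) n"
proof -
  have "((b k n) ^ 4)\<^sup>2 \<le> (b (k + 2) n)\<^sup>2" using b_4 bpos[of k n] by (intro power_mono) auto
  also have "\<dots> \<le> b (k + 3) n" using bs[of "k + 2" n] by (simp add: eval_nat_numeral)
  finally show ?thesis by simp
qed

text \<open>Singular values are truncated for the vectors \<open>w m\<close> made orthogonal to
  \<open>U\<close> and divided by the weights \<open>b (Suc M) m\<close>. In these weights
  \<open>lift\<close> bounds the coefficients of \<open>x\<close> by \<open>N (M + 4) x\<close>, so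
  after the division the coefficients satisfy a plain square-sum bound, as \<open>svd\<close> wants
  it.\<close>

lemma add_layer:
  assumes U: "fd U" and \<beta>: "0 < \<beta>" "\<beta> \<le> b M (Suc y)"
  obtains W where "fd W" "\<And>u v. u \<in> U \<Longrightarrow> v \<in> W \<Longrightarrow> ip u v = 0"
    "\<And>k B \<rho>. 0 \<le> \<rho> \<Longrightarrow> 0 \<le> B \<Longrightarrow> bern k U B \<Longrightarrow> (\<And>m. m \<le> y \<Longrightarrow> b (Suc k) m \<le> \<rho> * b (Suc M) m) \<Longrightarrow>
      bern k W (\<beta> * (\<rho> + B))"
    "\<And>x. x \<in> V \<Longrightarrow> \<beta> * n0 (x - proj (osum U W) x) \<le> 2 * N (M + 4) x"
proof -
  let ?b = "\<lambda>m. b (Suc M) m"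
  let ?i = "\<lambda>m. inverse (of_real (?b m)) :: 'a"
  define e where "e = (\<lambda>m. sc (?i m) (w m - proj U (w m)))"
  have PV: "proj U x \<in> V" for x by (rule proj_V[OF U])
  have eV: "e m \<in> V" for m unfolding e_def by (intro V_sc V_diff wV PV)
  define p where "p = (\<lambda>c. \<Sum>m\<le>y. sc (c m) (w m))"
  have pV: "p c \<in> V" for c unfolding p_def by (intro V_sum V_sc wV)
  have R: "(\<Sum>m\<le>y. sc (c m) (e m)) = p (\<lambda>m. c m * ?i m) - proj U (p (\<lambda>m. c m * ?i m))" for c
  proof -
    have "proj U (p (\<lambda>m. c m * ?i m)) = (\<Sum>m\<le>y. sc (c m * ?i m) (proj U (w m)))"
      unfolding p_def using proj_sum[OF U, of "{..y}" "\<lambda>m. sc (c m * ?i m) (w m)"]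
      by (simp add: V_sc wV proj_sc[OF U])
    then show ?thesis
      by (simp add: p_def e_def sum_subtractf scale_right_diff_distrib)
  qed
  obtain W where W: "fd W"
    "\<And>v. v \<in> W \<Longrightarrow> \<exists>c. v = (\<Sum>m\<le>y. sc (c m) (e m)) \<and> sqrt (\<Sum>m\<le>y. (norm (c m))\<^sup>2) \<le> \<beta> * n0 v"
    "\<And>c. n0 ((\<Sum>m\<le>y. sc (c m) (e m)) - proj W (\<Sum>m\<le>y. sc (c m) (e m))) \<le> sqrt (\<Sum>m\<le>y. (norm (c m))\<^sup>2) / \<beta>"
    using svd[of y e \<beta>] eV \<beta>(1) by blast
  have ni: "norm (?i m) = inverse (?b m)" for m using bpos[of "Suc M" m] by (simp add: norm_inverse)
  have orth: "ip u v = 0" if u: "u \<in> U" and v: "v \<in> W" for u v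
  proof -
    obtain c where "v = p c - proj U (p c)" using W(2)[OF v] R by metis
    then have "ip v u = 0" using proj_orth[OF U pV u] by simp
    then show ?thesis using ip_0_sym fd_V[OF U u] fd_V[OF W(1) v] by blast
  qed
  \<comment> \<open>\<open>v\<close> is the part orthogonal to \<open>U\<close> of an image
    \<open>p c'\<close>. The image is estimated by \<open>wN\<close>, but subtracting its projection
    brings in the Bernstein constant of \<open>U\<close>: this is how a layer multiplies the
    constants of those before it.\<close>
  have bW: "bern k W (\<beta> * (\<rho> + B))"
    if \<rho>: "0 \<le> \<rho>" and B: "0 \<le> B" "bern k U B" and le: "\<And>m. m \<le> y \<Longrightarrow> b (Suc k) m \<le> \<rho> * ?b m" for k B \<rho>
    unfolding bern_def
  proof
    fix v assume v: "v \<in> W"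
    obtain c where c: "v = (\<Sum>m\<le>y. sc (c m) (e m))" "sqrt (\<Sum>m\<le>y. (norm (c m))\<^sup>2) \<le> \<beta> * n0 v" using W(2)[OF v] by blast
    define c' where "c' = (\<lambda>m. c m * ?i m)"
    have nc: "norm (c' m) = norm (c m) / ?b m" for m by (simp add: c'_def norm_mult ni divide_inverse)
    let ?n = "sqrt (\<Sum>m\<le>y. (norm (c m))\<^sup>2)"
    have v': "v = p c' - proj U (p c')" using c(1) R by (simp add: c'_def)
    have "n0 (p c') \<le> N M (p c')" by (rule n0_N[OF pV])
    also have "\<dots> \<le> sqrt (\<Sum>m\<le>y. (norm (c' m) * ?b m)\<^sup>2)" unfolding p_def by (rule wN)
    also have "\<dots> = ?n" unfolding nc using bpos by (simp add: less_imp_neq[symmetric])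
    finally have n0p: "n0 (p c') \<le> ?n" .
    have "N k (p c') \<le> sqrt (\<Sum>m\<le>y. (norm (c' m) * b (Suc k) m)\<^sup>2)" unfolding p_def by (rule wN)
    also have "\<dots> \<le> sqrt (\<Sum>m\<le>y. (\<rho> * norm (c m))\<^sup>2)"
    proof (intro real_sqrt_le_mono sum_mono power_mono)
      fix m assume "m \<in> {..y}"
      then have "b (Suc k) m / ?b m \<le> \<rho>" using le[of m] bpos[of "Suc M" m] by (simp add: divide_le_eq)
      then have "norm (c m) * (b (Suc k) m / ?b m) \<le> norm (c m) * \<rho>" by (intro mult_left_mono) auto
      then show "norm (c' m) * b (Suc k) m \<le> \<rho> * norm (c m)" by (simp add: nc mult.commute)
      show "0 \<le> norm (c' m) * b (Suc k) m" using bpos[of "Suc k" m] by simp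
    qed
    also have "\<dots> = \<rho> * ?n" using \<rho> by (simp add: power_mult_distrib real_sqrt_mult flip: sum_distrib_left)
    finally have Np: "N k (p c') \<le> \<rho> * ?n" .
    have "N k v \<le> N k (p c') + N k (proj U (p c'))" unfolding v' by (rule N_diff[OF pV PV])
    also have "N k (proj U (p c')) \<le> B * n0 (proj U (p c'))" by (rule bernD[OF B(2) proj_in[OF U]])
    also have "\<dots> \<le> B * ?n" using n0_proj_le[OF U pV, of c'] n0p B(1) by (intro mult_left_mono) auto
    finally have "N k v \<le> (\<rho> + B) * ?n" using Np by (simp add: distrib_right)
    also have "\<dots> \<le> (\<rho> + B) * (\<beta> * n0 v)" using c(2) \<rho> B by (intro mult_left_mono) auto
    finally show "N k v \<le> \<beta> * (\<rho> + B) * n0 v" by (simp add: mult_ac)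
  qed
  \<comment> \<open>The two errors are the truncation of the lift at \<open>y\<close> and the
    neglect of small singular values; each contributes one \<open>N (M + 4) x\<close>.\<close>
  have J: "\<beta> * n0 (x - proj (osum U W) x) \<le> 2 * N (M + 4) x" if x: "x \<in> V" for x
  proof -
    obtain c where c: "sqrt (\<Sum>n\<le>y. (norm (c n) * ?b n)\<^sup>2) \<le> N (M + 4) x" "?b (Suc y) * n0 (x - p c) \<le> N (M + 4) x"
      using lift[OF x, of "Suc M" y] unfolding p_def by (auto simp: eval_nat_numeral)
    define d where "d = (\<lambda>m. c m * of_real (?b m))"
    have dc: "(\<lambda>m. d m * ?i m) = c" using bpos by (auto simp: d_def less_imp_neq[symmetric])
    have nd: "norm (d m) = norm (c m) * ?b m" for m using bpos[of "Suc M" m] by (simp add: d_def norm_mult)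
    let ?r = "\<Sum>m\<le>y. sc (d m) (e m)"
    have r: "?r = p c - proj U (p c)" using R[of d] dc by simp
    have rV: "?r \<in> V" by (intro V_sum V_sc eV)
    have "proj U (p c) + proj W ?r \<in> osum U W" using proj_in[OF U] proj_in[OF W(1)] by (auto simp: osum_def)
    then have "n0 (x - proj (osum U W) x) \<le> n0 (x - (proj U (p c) + proj W ?r))"
      by (rule proj_best[OF fd_osum[OF U W(1)] x])
    also have "x - (proj U (p c) + proj W ?r) = (x - p c) + (?r - proj W ?r)" unfolding r by simp
    also have "n0 \<dots> \<le> n0 (x - p c) + n0 (?r - proj W ?r)"
      by (intro n0_triangle V_diff x pV rV proj_V[OF W(1)])
    finally have 1: "\<beta> * n0 (x - proj (osum U W) x) \<le> \<beta> * n0 (x - p c) + \<beta> * n0 (?r - proj W ?r)"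
      using \<beta>(1) by (simp flip: distrib_left)
    have "\<beta> \<le> ?b (Suc y)" using \<beta>(2) b_le[of M "Suc M" "Suc y"] by simp
    then have "\<beta> * n0 (x - p c) \<le> ?b (Suc y) * n0 (x - p c)" by (intro mult_right_mono) auto
    moreover have "\<beta> * n0 (?r - proj W ?r) \<le> N (M + 4) x"
    proof -
      have "n0 (?r - proj W ?r) \<le> N (M + 4) x / \<beta>"
        using W(3)[of d] c(1) \<beta>(1) unfolding nd by (meson divide_right_mono less_imp_le order_trans)
      then show ?thesis using \<beta>(1) by (simp add: pos_le_divide_eq mult.commute)
    qed
    ultimately show ?thesis using 1 c(2) by linarith
  qed
  show thesis by (rule that[OF W(1) orth bW J])
qed

text \<open>The last position up to which \<open>b k\<close> stays at most \<open>\<beta>\<close>;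
  the value is 0 also if \<open>b k\<close> exceeds \<open>\<beta>\<close> from the start, hence the
  hypothesis of \<open>top_le\<close>.\<close>

definition top :: "nat \<Rightarrow> real \<Rightarrow> nat" where
  "top k \<beta> = (LEAST m. \<beta> < b k (Suc m))"

lemma top_less: "\<beta> < b k (Suc (top k \<beta>))"
proof -
  obtain n where n: "\<beta> < b 0 n" using unb by blast
  then have "\<beta> < b k (Suc n)" using b_le[of 0 k n] bm[of k n] by linarith
  then show ?thesis unfolding top_def by (rule LeastI)
qed

lemma top_le:
  assumes "b k 0 \<le> \<beta>"
  shows "b k (top k \<beta>) \<le> \<beta>"
proof (cases "top k \<beta>")
  case (Suc m)
  then show ?thesis using not_less_Least[of m "\<lambda>m. \<beta> < b k (Suc m)"] by (auto simp: top_def)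
qed (use assms in simp)

lemma le_topI:
  assumes "b k m \<le> \<beta>"
  shows "m \<le> top k \<beta>"
proof (rule ccontr)
  assume "\<not> ?thesis"
  then have "b k (Suc (top k \<beta>)) \<le> b k m" by (intro b_mono) simp
  then show False using top_less[of \<beta> k] assms by linarith
qed

text \<open>The norm \<open>M i\<close> reaches \<open>\<beta> i\<close> at the position \<open>y i\<close>, and its eighth power at \<open>z i\<close>.
  In the norm \<open>M i\<close>, the layer \<open>j\<close> has the Bernstein constant \<open>2 * b (M i) (z j)\<close> if \<open>i < j\<close>, but
  it multiplies that of the preceding layers by \<open>\<beta> j\<close> if \<open>j < i\<close>; this is harmless since \<open>\<beta> i\<close> exceeds
  powers of \<open>\<beta> j\<close>.\<close>

lemma build_layers:
  fixes \<beta> :: "nat \<Rightarrow> real" and M y z :: "nat \<Rightarrow> nat"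
  defines "\<Phi> \<equiv> \<lambda>i A. \<Prod>j\<in>{j \<in> A. j \<le> i}. 4 * \<beta> j"
  assumes \<beta>2: "\<And>i. i < L \<Longrightarrow> 2 \<le> \<beta> i" and yb: "\<And>i. i < L \<Longrightarrow> \<beta> i \<le> b (M i) (Suc (y i))"
    and zb: "\<And>i. i < L \<Longrightarrow> (\<beta> i) ^ 8 \<le> b (M i) (Suc (z i))"
    and M: "\<And>i j. i < j \<Longrightarrow> j < L \<Longrightarrow> M i + 2 \<le> M j"
    and sm: "\<And>i. i < L \<Longrightarrow> 1 + (1 + 2 * real L) * \<beta> i * (\<Prod>j<i. 4 * \<beta> j) \<le> (\<beta> i) ^ 4"
    and l: "distinct l" "set l \<subseteq> {..<L}"
    and G: "sorted_wrt (\<lambda>a c. (c < a \<longrightarrow> b (M c) (z a) \<le> \<beta> c) \<and> (a < c \<longrightarrow> b (Suc (M c)) (y a) \<le> \<beta> c)) l"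
  shows "\<exists>S. fd S \<and>
    (\<forall>i<L. \<forall>Y\<ge>1. (\<forall>j\<in>set l. (i < j \<longrightarrow> b (M i) (z j) \<le> Y) \<and> (j < i \<longrightarrow> b (Suc (M i)) (y j) \<le> Y)) \<longrightarrow>
      bern (M i) S ((1 + 2 * real (length l)) * Y * \<Phi> i (set l))) \<and>
    (\<forall>i\<in>set l. \<forall>x\<in>V. \<beta> i * n0 (x - proj S x) \<le> 2 * N (M i + 4) x)"
  using l G
proof (induction l rule: rev_induct)
  case Nil
  have "bern k {0} c" for k c by (simp add: bern_def)
  then show ?case using fd_zero by (intro exI[of _ "{0}"]) simp
next
  case (snoc h l)
  have h: "h < L" "h \<notin> set l" and l: "distinct l" "set l \<subseteq> {..<L}" using snoc.prems by auto
  have "sorted_wrt (\<lambda>a c. (c < a \<longrightarrow> b (M c) (z a) \<le> \<beta> c) \<and> (a < c \<longrightarrow> b (Suc (M c)) (y a) \<le> \<beta> c)) l"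
    using snoc.prems(3) unfolding sorted_wrt_append by blast
  from snoc.IH[OF l this] obtain S where S': "fd S \<and>
    (\<forall>i<L. \<forall>Y\<ge>1. (\<forall>j\<in>set l. (i < j \<longrightarrow> b (M i) (z j) \<le> Y) \<and> (j < i \<longrightarrow> b (Suc (M i)) (y j) \<le> Y)) \<longrightarrow>
      bern (M i) S ((1 + 2 * real (length l)) * Y * \<Phi> i (set l))) \<and>
    (\<forall>i\<in>set l. \<forall>x\<in>V. \<beta> i * n0 (x - proj S x) \<le> 2 * N (M i + 4) x)" by (rule exE)
  note S = S'[THEN conjunct1] and SJ = S'[THEN conjunct2, THEN conjunct2, rule_format]
  have SB: "bern (M i) S ((1 + 2 * real (length l)) * Y * \<Phi> i (set l))"
    if "i < L" "1 \<le> Y" "\<And>j. j \<in> set l \<Longrightarrow> (i < j \<longrightarrow> b (M i) (z j) \<le> Y) \<and> (j < i \<longrightarrow> b (Suc (M i)) (y j) \<le> Y)" for i Y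
    by (rule S'[THEN conjunct2, THEN conjunct1, THEN spec, THEN mp, THEN spec, THEN mp, THEN mp])
      (use that in blast)+
  have \<beta>1: "1 \<le> 4 * \<beta> j" if "j < L" for j using \<beta>2[OF that] by linarith
  have \<Phi>1: "1 \<le> \<Phi> i A" if "A \<subseteq> {..<L}" for i A
    unfolding \<Phi>_def using that \<beta>1 by (intro prod_ge_1) auto
  have llen: "length l \<le> L"
    using l card_mono[of "{..<L}" "set l"] distinct_card[of l] by simp
  \<comment> \<open>A Bernstein constant of the layers built so far in the norm \<open>M h\<close>,
    with \<open>\<beta> h\<close> in the place of \<open>Y\<close>; by \<open>sm\<close> it stays
    below the fourth power of \<open>\<beta> h\<close>.\<close>
  define B where "B = (1 + 2 * real (length l)) * \<beta> h * \<Phi> h (set l)"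
  have BS: "bern (M h) S B"
    unfolding B_def using h(1) \<beta>2[OF h(1)] snoc.prems(3) by (intro SB) (auto simp: sorted_wrt_append)
  have B0: "0 \<le> B" unfolding B_def using \<beta>2[OF h(1)] \<Phi>1[OF l(2), of h] by simp
  have B4: "1 + B \<le> (\<beta> h) ^ 4"
  proof -
    have "\<Phi> h (set l) \<le> (\<Prod>j<h. 4 * \<beta> j)"
      unfolding \<Phi>_def
    proof (rule prod_mono2)
      show "{j \<in> set l. j \<le> h} \<subseteq> {..<h}" using h(2) by (auto simp: order_le_less)
      show "1 \<le> 4 * \<beta> j" if "j \<in> {..<h} - {j \<in> set l. j \<le> h}" for j using that h(1) by (intro \<beta>1) auto
      show "0 \<le> 4 * \<beta> j" if "j \<in> {j \<in> set l. j \<le> h}" for j using that l(2) \<beta>1[of j] by auto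
    qed simp
    then have "B \<le> (1 + 2 * real L) * \<beta> h * (\<Prod>j<h. 4 * \<beta> j)"
      unfolding B_def using llen \<beta>2[OF h(1)] \<Phi>1[OF l(2), of h] by (intro mult_mono) auto
    then show ?thesis using sm[OF h(1)] by linarith
  qed
  have \<beta>h: "0 < \<beta> h" using \<beta>2[OF h(1)] by linarith
  obtain W where W: "fd W" "\<And>u v. u \<in> S \<Longrightarrow> v \<in> W \<Longrightarrow> ip u v = 0"
    and WB: "\<And>k B \<rho>. 0 \<le> \<rho> \<Longrightarrow> 0 \<le> B \<Longrightarrow> bern k S B \<Longrightarrow> (\<And>m. m \<le> y h \<Longrightarrow> b (Suc k) m \<le> \<rho> * b (Suc (M h)) m) \<Longrightarrow>
      bern k W (\<beta> h * (\<rho> + B))"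
    and WJ: "\<And>x. x \<in> V \<Longrightarrow> \<beta> h * n0 (x - proj (osum S W) x) \<le> 2 * N (M h + 4) x"
    using add_layer[OF S \<beta>h yb[OF h(1)]] by blast
  have WM: "bern (M h) W (\<beta> h * (1 + B))" by (rule WB[OF _ B0 BS]) auto
  \<comment> \<open>In norms well below \<open>M h\<close> the crude constant is improved by
    splitting at \<open>z h\<close>. Beyond that position \<open>b (M h)\<close> is at least the
    eighth power of \<open>\<beta> h\<close> and the fourth power of \<open>b k\<close>, hence at
    least \<open>b k\<close> times \<open>(\<beta> h) ^ 6\<close>. This beats the
    \<open>(\<beta> h) ^ 5\<close> lost in the norm \<open>M h\<close>.\<close>
  have sharp: "bern k W (2 * b k (z h))" if k: "k + 2 \<le> M h" for k
    unfolding bern_def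
  proof
    fix v assume v: "v \<in> W"
    let ?Z = "b (M h) (Suc (z h))" and ?k = "b k (Suc (z h))"
    have vV: "v \<in> V" using v fd_V[OF W(1)] by blast
    have p: "0 < ?Z" "0 < ?k" using bpos by auto
    have k4: "?k ^ 4 \<le> ?Z" using b_4[of k "Suc (z h)"] b_le[OF k, of "Suc (z h)"] by linarith
    have "(?k * (\<beta> h) ^ 6) ^ 4 = ?k ^ 4 * ((\<beta> h) ^ 8) ^ 3" by (simp add: power_mult_distrib flip: power_mult)
    also have "\<dots> \<le> ?Z * ?Z ^ 3" using k4 zb[OF h(1)] p \<beta>h by (intro mult_mono power_mono) auto
    also have "\<dots> = ?Z ^ 4" by (simp add: eval_nat_numeral)
    finally have "?k * (\<beta> h) ^ 6 \<le> ?Z" by (rule power_mono_iff[THEN iffD1, rotated -1]) (use p \<beta>h in auto)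
    moreover have "(\<beta> h) ^ 5 \<le> (\<beta> h) ^ 6" using \<beta>2[OF h(1)] by (intro power_increasing) auto
    ultimately have "?k * (\<beta> h) ^ 5 \<le> ?Z" using p(2) by (meson mult_left_mono less_imp_le order_trans)
    then have q: "?k / ?Z * (\<beta> h) ^ 5 \<le> 1" using p by (simp add: field_simps)
    have "N (M h) v \<le> \<beta> h * (1 + B) * n0 v" by (rule bernD[OF WM v])
    also have "\<dots> \<le> \<beta> h * (\<beta> h) ^ 4 * n0 v" using B4 \<beta>h by (intro mult_right_mono mult_left_mono) auto
    finally have nM: "N (M h) v \<le> (\<beta> h) ^ 5 * n0 v" by (simp add: eval_nat_numeral mult_ac)
    have "N k v \<le> b k (z h) * n0 v + ?k / ?Z * N (M h) v" using k by (intro interpol vV) simp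
    also have "\<dots> \<le> b k (z h) * n0 v + ?k / ?Z * ((\<beta> h) ^ 5 * n0 v)"
      using nM p by (intro add_left_mono mult_left_mono) auto
    also have "\<dots> = b k (z h) * n0 v + (?k / ?Z * (\<beta> h) ^ 5) * n0 v" by simp
    also have "\<dots> \<le> b k (z h) * n0 v + b k (z h) * n0 v"
      using q b2[of k "z h"] by (intro add_left_mono mult_right_mono) auto
    finally show "N k v \<le> 2 * b k (z h) * n0 v" by (simp add: mult_ac)
  qed
  have inv: "bern (M i) (osum S W) ((1 + 2 * real (length (l @ [h]))) * Y * \<Phi> i (set (l @ [h])))"
    if i: "i < L" and Y: "1 \<le> Y" and c: "\<And>j. j \<in> set (l @ [h]) \<Longrightarrow>
      (i < j \<longrightarrow> b (M i) (z j) \<le> Y) \<and> (j < i \<longrightarrow> b (Suc (M i)) (y j) \<le> Y)" for i Y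
  proof -
    let ?C = "(1 + 2 * real (length l)) * Y * \<Phi> i (set l)"
    let ?D = "(1 + 2 * real (length (l @ [h]))) * Y * \<Phi> i (set (l @ [h]))"
    have C: "bern (M i) S ?C" using c by (intro SB[OF i Y]) auto
    note F1 = \<Phi>1[OF l(2), of i]
    have YF: "1 \<le> Y * \<Phi> i (set l)" using mult_mono[OF Y F1] Y by simp
    have C1: "Y \<le> ?C" 
    proof -
      have "Y * 1 \<le> Y * \<Phi> i (set l)" using F1 Y by (intro mult_left_mono) auto
      also have "\<dots> \<le> (1 + 2 * real (length l)) * (Y * \<Phi> i (set l))"
        using mult_right_mono[of 1 "1 + 2 * real (length l)" "Y * \<Phi> i (set l)"] YF by simp
      finally show ?thesis by (simp add: mult.assoc)
    qed
    have C0: "0 \<le> ?C" using C1 Y by linarith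
    have up: "bern (M i) (osum S W) (?C + c)" if "bern (M i) W c" "0 \<le> c" for c
      by (rule bern_osum[OF S W C that(1) C0 that(2)])
    show ?thesis
    proof (cases "i < h")
      case True
      have FD: "{j \<in> set (l @ [h]). j \<le> i} = {j \<in> set l. j \<le> i}" using True by auto
      \<comment> \<open>The new layer belongs to a larger norm, so its constant is only
        added.\<close>
      have "bern (M i) (osum S W) (?C + 2 * b (M i) (z h))"
        using M[OF True h(1)] bpos[of "M i" "z h"] by (intro up sharp) auto
      moreover have "?C + 2 * b (M i) (z h) \<le> ?D"
      proof -
        have "b (M i) (z h) \<le> Y" using c[of h] True by simp
        also have "Y \<le> Y * \<Phi> i (set l)" using F1 Y by simp
        finally show ?thesis unfolding \<Phi>_def FD by (simp add: algebra_simps)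
      qed
      ultimately show ?thesis by (rule bern_mono)
    next
      case False
      have FD: "{j \<in> set (l @ [h]). j \<le> i} = insert h {j \<in> set l. j \<le> i}" using False by auto
      have F: "\<Phi> i (set (l @ [h])) = 4 * \<beta> h * \<Phi> i (set l)"
        unfolding \<Phi>_def FD using h(2) by (subst prod.insert) auto
      \<comment> \<open>The new layer belongs to the norm \<open>M i\<close> or a smaller one; the
        constant is multiplied, and \<open>4 * \<beta> h\<close> is the factor collected in
        \<open>\<Phi> i\<close>.\<close>
      have WC: "bern (M i) W (\<beta> h * (Y + ?C))"
      proof (rule WB[OF _ C0 C])
        fix m assume m: "m \<le> y h"
        show "b (Suc (M i)) m \<le> Y * b (Suc (M h)) m"
        proof (cases "h = i")
          case True
          then show ?thesis using mult_right_mono[OF Y, of "b (Suc (M h)) m"] bpos[of "Suc (M h)" m] by simp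
        next
          case neq: False
          have "b (Suc (M i)) m \<le> b (Suc (M i)) (y h)" by (rule b_mono[OF m])
          also have "\<dots> \<le> Y" using c[of h] False neq by simp
          also have "\<dots> \<le> Y * b (Suc (M h)) m" using b2[of "Suc (M h)" m] Y by simp
          finally show ?thesis .
        qed
      qed (use Y in simp)
      have "bern (M i) (osum S W) (?C + \<beta> h * (Y + ?C))"
        using \<beta>h C0 Y by (intro up[OF WC]) auto
      moreover have "?C + \<beta> h * (Y + ?C) \<le> ?D"
      proof -
        have aux: "c + \<beta> h * (Y + c) \<le> 4 * (\<beta> h * c)" if "Y \<le> c" "0 \<le> c" for c
        proof -
          have "\<beta> h * Y \<le> \<beta> h * c" using that(1) \<beta>h by (intro mult_left_mono) auto
          moreover have "1 * c \<le> \<beta> h * c" using that(2) \<beta>2[OF h(1)] by (intro mult_right_mono) auto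
          ultimately show ?thesis using that(2) unfolding distrib_left by linarith
        qed
        have "?C + \<beta> h * (Y + ?C) \<le> 4 * (\<beta> h * ?C)" by (rule aux[OF C1 C0])
        also have "\<dots> = (1 + 2 * real (length l)) * (Y * (4 * \<beta> h * \<Phi> i (set l)))" by simp
        also have "\<dots> \<le> (1 + 2 * real (length (l @ [h]))) * (Y * (4 * \<beta> h * \<Phi> i (set l)))"
          using \<beta>h Y F1 by (intro mult_right_mono) auto
        finally show ?thesis unfolding F by simp
      qed
      ultimately show ?thesis by (rule bern_mono)
    qed
  qed
  have J: "\<beta> i * n0 (x - proj (osum S W) x) \<le> 2 * N (M i + 4) x" if i: "i \<in> set (l @ [h])" and x: "x \<in> V" for i x
  proof (cases "i = h")
    case False
    then have il: "i \<in> set l" using i by simp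
    have "n0 (x - proj (osum S W) x) \<le> n0 (x - proj S x)"
      by (rule proj_mono[OF S fd_osum[OF S W(1)] osum_sup(1)[OF S W(1)] x])
    then have "\<beta> i * n0 (x - proj (osum S W) x) \<le> \<beta> i * n0 (x - proj S x)"
      using \<beta>2[of i] il l(2) by (intro mult_left_mono) auto
    then show ?thesis using SJ[OF il x] by linarith
  qed (use WJ x in simp)
  show ?case by (rule exI[of _ "osum S W"]) (use fd_osum[OF S W(1)] inv J in blast)
qed

text \<open>The norm \<open>k\<close> is treated through an index \<open>M k\<close> which exceeds
  \<open>8 * (Suc k)\<^sup>2 + 4\<close> by at most \<open>4 * k\<close>. What remains covers the
  four indices lost in the Jackson estimate and those that absorb constants.\<close>

definition \<tau> :: "nat \<Rightarrow> nat" where "\<tau> k = 8 * (Suc k)\<^sup>2 + 4 * k + 10"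

text \<open>Each \<open>k \<le> L\<close> gets a layer whose threshold is \<open>\<beta> k\<close>,
  the value of \<open>b (R k)\<close> at \<open>Suc n\<close>. The index \<open>M k\<close> is free
  among \<open>k + 1\<close> values, and this freedom lets \<open>choose_scales\<close> keep the
  layers apart.\<close>

lemma cuts_exist:
  "\<exists>T. \<forall>n\<ge>T. \<exists>S. fd S \<and> (\<forall>k\<le>L. bern k S (b (\<tau> k) n) \<and>
    (\<forall>x\<in>V. b k (Suc n) * n0 (x - proj S x) \<le> N (\<tau> k) x))"
proof -
  \<comment> \<open>Quadratic growth leaves room for \<open>i + 1\<close> windows of width 4 between
    \<open>R i\<close> and \<open>R (Suc i)\<close>.\<close>
  define R where "R = (\<lambda>i :: nat. 8 * (Suc i)\<^sup>2)"
  define \<mu> where "\<mu> = (\<lambda>i s. R i + 4 + 4 * s)"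
  \<comment> \<open>Large enough that every \<open>b k\<close> concerned starts below
    \<open>\<beta> i\<close>, as \<open>top_le\<close> requires, and that one factor
    \<open>\<beta> i\<close> absorbs the number of layers.\<close>
  define C where "C = max (b (\<mu> L (Suc L)) 0) (1 + 2 * real (Suc L))"
  have R_Suc: "R i + 8 + 4 * i + 4 \<le> R (Suc i)" for i by (simp add: R_def power2_eq_square)
  have R_mono: "R i \<le> R j" if "i \<le> j" for i j using that by (simp add: R_def power_mono)
  obtain T where T: "C < b 0 T" using unb by blast
  have "\<exists>S. fd S \<and> (\<forall>k\<le>L. bern k S (b (\<tau> k) n) \<and> (\<forall>x\<in>V. b k (Suc n) * n0 (x - proj S x) \<le> N (\<tau> k) x))"
    if n: "T \<le> n" for n
  proof -
    define \<beta> where "\<beta> = (\<lambda>i. b (R i) (Suc n))"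
    have C\<beta>: "C \<le> \<beta> i" for i
      using T b_mono[of T "Suc n" 0] b_le[of 0 "R i" "Suc n"] n by (simp add: \<beta>_def)
    have \<beta>2: "2 \<le> \<beta> i" for i by (simp add: \<beta>_def b2)
    have \<beta>0: "0 \<le> \<beta> i" for i using \<beta>2[of i] by linarith
    have L\<beta>: "1 + 2 * real (Suc L) \<le> \<beta> i" for i using C\<beta>[of i] by (simp add: C_def)
    have b\<beta>: "b k 0 \<le> \<beta> i" if "k \<le> \<mu> L (Suc L)" for k i
      using C\<beta>[of i] b_le[OF that, of 0] by (simp add: C_def)
    have \<beta>8: "\<beta> i \<le> (\<beta> i) ^ 8" for i using power_increasing[of 1 8 "\<beta> i"] \<beta>2[of i] by simp
    have \<mu>L: "Suc (\<mu> i s) \<le> \<mu> L (Suc L)" if "i \<le> L" "s \<le> i" for i s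
      using that R_mono[of i L] by (simp add: \<mu>_def)
    define y yp z where "y = (\<lambda>i s. top (\<mu> i s) (\<beta> i))" and "yp = (\<lambda>i s. top (Suc (\<mu> i s)) (\<beta> i))"
      and "z = (\<lambda>i s. top (\<mu> i s) ((\<beta> i) ^ 8))"
    have yp_y: "yp i s \<le> y i s" if "i \<le> L" "s \<le> i" for i s
      unfolding y_def using top_le[OF b\<beta>[OF \<mu>L[OF that]], of i] b_le[of "\<mu> i s" "Suc (\<mu> i s)" "yp i s"]
      by (intro le_topI) (simp add: yp_def)
    have y_z: "y i s \<le> z i s" if "i \<le> L" "s \<le> i" for i s
      unfolding z_def using top_le[OF b\<beta>[OF Suc_leD[OF \<mu>L[OF that]]], of i] \<beta>8[of i]
      by (intro le_topI) (simp add: y_def)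
    \<comment> \<open>Neighbouring windows do not overlap: three of the four steps in the index give
      an eighth power by \<open>b_8\<close>, which is the gap between the thresholds of
      \<open>z\<close> and \<open>yp\<close>.\<close>
    have z_yp: "z i (Suc s) \<le> yp i s" if "i \<le> L" "s < i" for i s
      unfolding yp_def
    proof (rule le_topI)
      have "b (\<mu> i (Suc s)) 0 \<le> (\<beta> i) ^ 8"
        using b\<beta>[OF Suc_leD[OF \<mu>L[of i "Suc s"]], of i] that \<beta>8[of i] by simp
      then have "b (\<mu> i (Suc s)) (z i (Suc s)) \<le> (\<beta> i) ^ 8" unfolding z_def by (rule top_le)
      moreover have "\<mu> i (Suc s) = Suc (\<mu> i s) + 3" by (simp add: \<mu>_def)
      ultimately have "(b (Suc (\<mu> i s)) (z i (Suc s))) ^ 8 \<le> (\<beta> i) ^ 8"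
        using b_8[of "Suc (\<mu> i s)" "z i (Suc s)"] by simp
      then show "b (Suc (\<mu> i s)) (z i (Suc s)) \<le> \<beta> i"
        using \<beta>0[of i] bpos[of "Suc (\<mu> i s)" "z i (Suc s)"] by (simp add: power_mono_iff)
    qed
    have "\<exists>s. \<forall>i<Suc L. s i \<le> i \<and> (\<forall>j<i. z i (s i) \<le> y j (s j) \<or> y j (s j) \<le> yp i (s i))"
    proof (rule choose_scales)
      show "yp i s \<le> z i s" if "i < Suc L" "s \<le> i" for i s using yp_y[of i s] y_z[of i s] that by simp
      show "z i (Suc s) \<le> yp i s" if "i < Suc L" "s < i" for i s using z_yp[of i s] that by simp
    qed
    then obtain s where s: "\<And>i. i < Suc L \<Longrightarrow> s i \<le> i"
      "\<And>i j. i < Suc L \<Longrightarrow> j < i \<Longrightarrow> z i (s i) \<le> y j (s j) \<or> y j (s j) \<le> yp i (s i)"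
      by blast
    define M where "M = (\<lambda>i. \<mu> i (s i))"
    define y' yp' z' where "y' = (\<lambda>i. y i (s i))" and "yp' = (\<lambda>i. yp i (s i))" and "z' = (\<lambda>i. z i (s i))"
    have M_le: "R i + 4 \<le> M i" "M i \<le> R i + 4 + 4 * i" if "i \<le> L" for i
      using s(1)[of i] that by (auto simp: M_def \<mu>_def)
    have o: "yp' i \<le> y' i \<and> y' i \<le> z' i" if "i < Suc L" for i
      using yp_y[of i "s i"] y_z[of i "s i"] s(1)[OF that] that by (simp add: y'_def yp'_def z'_def)
    obtain l where l: "distinct l" "set l = {..<Suc L}"
      "sorted_wrt (\<lambda>a b. y' a \<le> y' b \<and> (b < a \<longrightarrow> z' a \<le> y' b) \<and> (a < b \<longrightarrow> y' a \<le> yp' b)) l"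
      using order_scales[of "Suc L" yp' y' z', OF o] s(2) by (auto simp: y'_def yp'_def z'_def)
    have bY: "b (M i) (y' i) \<le> \<beta> i" "b (Suc (M i)) (yp' i) \<le> \<beta> i" if "i < Suc L" for i
      using top_le[OF b\<beta>[OF \<mu>L[of i "s i"]], of i] top_le[OF b\<beta>[OF Suc_leD[OF \<mu>L[of i "s i"]]], of i] s(1)[OF that] that
      by (auto simp: M_def y'_def yp'_def y_def yp_def)
    have G: "sorted_wrt (\<lambda>a c. (c < a \<longrightarrow> b (M c) (z' a) \<le> \<beta> c) \<and> (a < c \<longrightarrow> b (Suc (M c)) (y' a) \<le> \<beta> c)) l"
    proof (rule sorted_wrt_mono_rel[OF _ l(3)])
      fix a c assume ac: "a \<in> set l" "c \<in> set l"
        and r: "y' a \<le> y' c \<and> (c < a \<longrightarrow> z' a \<le> y' c) \<and> (a < c \<longrightarrow> y' a \<le> yp' c)"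
      have c: "c < Suc L" using ac l(2) by auto
      show "(c < a \<longrightarrow> b (M c) (z' a) \<le> \<beta> c) \<and> (a < c \<longrightarrow> b (Suc (M c)) (y' a) \<le> \<beta> c)"
        using r bY[OF c] b_mono[of "z' a" "y' c" "M c"] b_mono[of "y' a" "yp' c" "Suc (M c)"] by linarith
    qed
    define P where "P = (\<lambda>i. \<Prod>j<i. 4 * \<beta> j)"
    \<comment> \<open>The \<open>\<beta> i\<close> grow so fast that each dominates the product of
      all previous factors.\<close>
    have P\<beta>: "P i \<le> \<beta> i \<and> 0 \<le> P i" for i
    proof (induction i)
      case 0
      then show ?case using \<beta>2[of 0] by (simp add: P_def)
    next
      case (Suc i)
      have "P (Suc i) = P i * 4 * \<beta> i" by (simp add: P_def)
      also have "\<dots> \<le> \<beta> i * (\<beta> i)\<^sup>2 * \<beta> i"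
        using Suc \<beta>2[of i] power_mono[OF \<beta>2[of i], of 2] by (intro mult_mono) auto
      also have "\<dots> = (\<beta> i) ^ 4" by (simp add: eval_nat_numeral)
      also have "\<dots> \<le> b (R i + 2) (Suc n)" unfolding \<beta>_def by (rule b_4)
      also have "\<dots> \<le> \<beta> (Suc i)" unfolding \<beta>_def using R_Suc[of i] by (intro b_le) simp
      finally show ?case using Suc \<beta>0[of i] by (simp add: P_def)
    qed
    have sm: "1 + (1 + 2 * real (Suc L)) * \<beta> i * P i \<le> (\<beta> i) ^ 4" for i
    proof -
      have "(1 + 2 * real (Suc L)) * \<beta> i * P i \<le> \<beta> i * \<beta> i * \<beta> i"
        using L\<beta>[of i] \<beta>0[of i] P\<beta>[of i] by (intro mult_mono) auto
      then have "(1 + 2 * real (Suc L)) * \<beta> i * P i \<le> (\<beta> i) ^ 3" by (simp add: power3_eq_cube)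
      moreover have "2 * (\<beta> i) ^ 3 \<le> \<beta> i * (\<beta> i) ^ 3" using \<beta>2[of i] by (intro mult_right_mono) auto
      moreover have "1 \<le> (\<beta> i) ^ 3" using \<beta>2[of i] by simp
      moreover have "\<beta> i * (\<beta> i) ^ 3 = (\<beta> i) ^ 4" by (simp add: eval_nat_numeral)
      ultimately show ?thesis by linarith
    qed
    have MM: "M i + 2 \<le> M j" if "i < j" "j < Suc L" for i j
      using M_le[of i] M_le[of j] R_Suc[of i] R_mono[of "Suc i" j] that by simp
    have yb: "\<beta> i \<le> b (M i) (Suc (y' i))" and zb: "(\<beta> i) ^ 8 \<le> b (M i) (Suc (z' i))" for i
      unfolding y'_def z'_def y_def z_def M_def using top_less less_imp_le by blast+
    obtain S where S: "fd S" and SB: "\<And>i Y. i < Suc L \<Longrightarrow> 1 \<le> Y \<Longrightarrow>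
        (\<And>j. j \<in> set l \<Longrightarrow> (i < j \<longrightarrow> b (M i) (z' j) \<le> Y) \<and> (j < i \<longrightarrow> b (Suc (M i)) (y' j) \<le> Y)) \<Longrightarrow>
        bern (M i) S ((1 + 2 * real (length l)) * Y * (\<Prod>j\<in>{j \<in> set l. j \<le> i}. 4 * \<beta> j))"
      and SJ: "\<And>i x. i \<in> set l \<Longrightarrow> x \<in> V \<Longrightarrow> \<beta> i * n0 (x - proj S x) \<le> 2 * N (M i + 4) x"
      using build_layers[of "Suc L" \<beta> M y' z' l, OF \<beta>2 yb zb MM sm[unfolded P_def] l(1) equalityD1[OF l(2)] G] by blast
    have \<beta>8M: "(\<beta> i) ^ 8 \<le> b (R i + 3) (Suc n)" for i unfolding \<beta>_def by (rule b_8)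
    \<comment> \<open>At \<open>Suc n\<close>, \<open>b (M i)\<close> exceeds the eighth power of
      \<open>\<beta> i\<close>, because \<open>M i\<close> is larger than the index
      \<open>R i + 3\<close> supplied by \<open>b_8\<close>; so all layers end at or below
      \<open>n\<close>.\<close>
    have zn: "z' i \<le> n" if i: "i < Suc L" for i
    proof (rule ccontr)
      assume "\<not> z' i \<le> n"
      then have "b (M i) (Suc n) \<le> b (M i) (z' i)" by (intro b_mono) simp
      also have "\<dots> \<le> (\<beta> i) ^ 8" unfolding M_def z'_def z_def
        using b\<beta>[OF Suc_leD[OF \<mu>L[of i "s i"]], of i] s(1)[OF i] i \<beta>8[of i] by (intro top_le) simp
      also have "\<dots> \<le> b (R i + 3) (Suc n)" by (rule \<beta>8M)
      finally have e: "b (M i) (Suc n) \<le> b (R i + 3) (Suc n)" .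
      have "2 * b (R i + 3) (Suc n) \<le> b (Suc (R i + 3)) (Suc n)"
        using bs[of "R i + 3" "Suc n"] mult_right_mono[OF b2[of "R i + 3" "Suc n"], of "b (R i + 3) (Suc n)"] bpos[of "R i + 3" "Suc n"]
        unfolding power2_eq_square by linarith
      also have "\<dots> \<le> b (M i) (Suc n)" using M_le[of i] i by (intro b_le) simp
      finally show False using e bpos[of "M i" "Suc n"] by simp
    qed
    have ll: "length l = Suc L" using distinct_card[OF l(1)] l(2) by simp
    have "bern k S (b (\<tau> k) n)" if k: "k \<le> L" for k
      unfolding bern_def
    proof
      fix v assume v: "v \<in> S"
      have vV: "v \<in> V" using v fd_V[OF S] by blast
      let ?Y = "b (Suc (M k)) n" and ?Z = "b (M k) (Suc n)" and ?k = "b k (Suc n)"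
      have "bern (M k) S ((1 + 2 * real (length l)) * ?Y * (\<Prod>j\<in>{j \<in> set l. j \<le> k}. 4 * \<beta> j))"
      proof (rule SB)
        show "1 \<le> ?Y" using b2[of "Suc (M k)" n] by linarith
        fix j assume "j \<in> set l"
        then have j: "z' j \<le> n" "y' j \<le> n" using zn[of j] o[of j] l(2) by auto
        show "(k < j \<longrightarrow> b (M k) (z' j) \<le> ?Y) \<and> (j < k \<longrightarrow> b (Suc (M k)) (y' j) \<le> ?Y)"
          using b_mono[OF j(1), of "M k"] b_le[of "M k" "Suc (M k)" n] b_mono[OF j(2), of "Suc (M k)"] by simp
      qed (use k in simp)
      moreover have "{j \<in> set l. j \<le> k} = {..<Suc k}" unfolding l(2) using k by auto
      then have "(\<Prod>j\<in>{j \<in> set l. j \<le> k}. 4 * \<beta> j) = P k * (4 * \<beta> k)" by (simp add: P_def)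
      ultimately have NM: "N (M k) v \<le> (1 + 2 * real (Suc L)) * ?Y * (P k * (4 * \<beta> k)) * n0 v"
        using bernD[OF _ v] ll by simp
      \<comment> \<open>The factors accumulated over the layers are beaten by \<open>?Z\<close> in
        the interpolation at \<open>n\<close> between \<open>n0\<close> and the norm
        \<open>M k\<close>.\<close>
      have kZ: "?k * ((1 + 2 * real (Suc L)) * (P k * (4 * \<beta> k))) \<le> ?Z"
      proof -
        have "?k \<le> \<beta> k" unfolding \<beta>_def by (rule b_le) (simp add: R_def power2_eq_square)
        then have "?k * ((1 + 2 * real (Suc L)) * (P k * (4 * \<beta> k))) \<le> \<beta> k * (\<beta> k * (\<beta> k * ((\<beta> k)\<^sup>2 * \<beta> k)))"
          using L\<beta>[of k] P\<beta>[of k] \<beta>0[of k] power_mono[OF \<beta>2[of k], of 2] bpos[of k "Suc n"]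
          by (intro mult_mono mult_nonneg_nonneg) auto
        also have "\<dots> = (\<beta> k) ^ 6" by (simp add: eval_nat_numeral)
        also have "\<dots> \<le> (\<beta> k) ^ 8" using \<beta>2[of k] by (intro power_increasing) auto
        also have "\<dots> \<le> b (R k + 3) (Suc n)" by (rule \<beta>8M)
        also have "\<dots> \<le> ?Z" using M_le[OF k] by (intro b_le) simp
        finally show ?thesis .
      qed
      have kM: "k \<le> M k" using M_le[OF k] by (simp add: R_def power2_eq_square)
      have "N k v \<le> b k n * n0 v + ?k / ?Z * N (M k) v" by (rule interpol[OF vV kM])
      also have "?k / ?Z * N (M k) v \<le> ?k / ?Z * ((1 + 2 * real (Suc L)) * ?Y * (P k * (4 * \<beta> k)) * n0 v)"
        using NM bpos[of k "Suc n"] bpos[of "M k" "Suc n"] by (intro mult_left_mono) auto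
      also have "\<dots> = (?k * ((1 + 2 * real (Suc L)) * (P k * (4 * \<beta> k))) / ?Z) * (?Y * n0 v)" by simp
      also have "\<dots> \<le> 1 * (?Y * n0 v)"
        using kZ bpos[of "M k" "Suc n"] bpos[of "Suc (M k)" n] by (intro mult_right_mono) (auto simp: pos_divide_le_eq)
      also have "b k n * n0 v + 1 * (?Y * n0 v) \<le> ?Y * n0 v + ?Y * n0 v"
        unfolding mult_1 by (rule add_right_mono[OF mult_right_mono[OF b_le[OF le_SucI[OF kM]] n0_ge0]])
      also have "\<dots> = (2 * ?Y) * n0 v" by simp
      also have "\<dots> \<le> b (\<tau> k) n * n0 v"
      proof (rule mult_right_mono)
        have "2 * ?Y \<le> ?Y\<^sup>2" using b2[of "Suc (M k)" n] bpos[of "Suc (M k)" n] by (simp add: power2_eq_square)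
        also have "\<dots> \<le> b (Suc (Suc (M k))) n" by (rule bs)
        also have "\<dots> \<le> b (\<tau> k) n" using M_le[OF k] by (intro b_le) (simp add: \<tau>_def R_def)
        finally show "2 * ?Y \<le> b (\<tau> k) n" .
      qed simp
      finally show "N k v \<le> b (\<tau> k) n * n0 v" by simp
    qed
    moreover have "b k (Suc n) * n0 (x - proj S x) \<le> N (\<tau> k) x" if k: "k \<le> L" and x: "x \<in> V" for k x
    proof -
      have "2 * b k (Suc n) \<le> (b k (Suc n))\<^sup>2" using b2[of k "Suc n"] bpos[of k "Suc n"] by (simp add: power2_eq_square)
      also have "\<dots> \<le> b (Suc k) (Suc n)" by (rule bs)
      also have "\<dots> \<le> \<beta> k" unfolding \<beta>_def by (rule b_le) (simp add: R_def power2_eq_square)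
      finally have "2 * b k (Suc n) * n0 (x - proj S x) \<le> \<beta> k * n0 (x - proj S x)" by (intro mult_right_mono) auto
      also have "\<dots> \<le> 2 * N (M k + 4) x" using k l(2) by (intro SJ x) auto
      also have "N (M k + 4) x \<le> N (\<tau> k) x" using M_le[OF k] by (intro N_mono x) (simp add: \<tau>_def R_def)
      finally show ?thesis by simp
    qed
    ultimately show ?thesis using S by blast
  qed
  then show ?thesis by blast
qed

theorem basis_exists:
  "\<exists>(M :: enat) f. (\<forall>j. enat j < M \<longrightarrow> f j \<in> V) \<and>
    (\<forall>i j. enat i < M \<longrightarrow> enat j < M \<longrightarrow> ip (f i) (f j) = (if i = j then 1 else 0)) \<and>
    (\<forall>x\<in>V. \<forall>k. (\<lambda>n. N k (x - (\<Sum>j<n. sc (if enat j < M then ip x (f j) else 0) (f j)))) \<longlonglongrightarrow> 0)"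
proof (rule basis_of_cuts[of b \<tau>])
  show "\<exists>n. C < b k n" for k C
    using unb[of C] b_le[of 0 k] less_le_trans by blast
  show "k < \<tau> k" for k by (simp add: \<tau>_def)
qed (rule b2 bm bs cuts_exist)+

end

subsection \<open>Koethe spaces as Frechet spaces\<close>

lemma kothe_norm_0D:
  assumes A: "kothe_matrix A" and x: "x \<in> kothe A" and 0: "kothe_norm A k x \<le> 0"
  shows "x = 0"
proof
  fix n
  have "norm (x n) * A k n \<le> 0" using kothe_norm_coord[OF A x, of n k] 0 by linarith
  moreover have "0 < A k n" using A by (simp add: kothe_matrix_def)
  ultimately show "x n = 0 n" by (simp add: mult_le_0_iff)
qed

lemma kothe_complete:
  fixes x :: "nat \<Rightarrow> nat \<Rightarrow> 'a::{real_normed_field,banach}"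
  assumes A: "kothe_matrix A" and x: "\<And>n. x n \<in> kothe A"
    and C: "\<And>k e. 0 < e \<Longrightarrow> \<exists>M. \<forall>m\<ge>M. \<forall>n\<ge>M. kothe_norm A k (x m - x n) < e"
  obtains l where "l \<in> kothe A" "\<And>k. (\<lambda>n. kothe_norm A k (x n - l)) \<longlonglongrightarrow> 0"
proof -
  have Apos: "\<And>k n. 0 < A k n" using A by (simp add: kothe_matrix_def)
  have "Cauchy (\<lambda>n. x n i)" for i
  proof (rule metric_CauchyI)
    fix e :: real assume e: "0 < e"
    obtain M where M: "\<And>m n. m \<ge> M \<Longrightarrow> n \<ge> M \<Longrightarrow> kothe_norm A 0 (x m - x n) < e * A 0 i"
      using C[of "e * A 0 i" 0] e Apos[of 0 i] by auto
    have "dist (x m i) (x n i) < e" if "m \<ge> M" "n \<ge> M" for m n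
    proof -
      have "norm ((x m - x n) i) * A 0 i < e * A 0 i"
        using kothe_norm_coord[OF A kothe_diff[OF A x x], of m n i 0] M[OF that] by linarith
      then show ?thesis using Apos[of 0 i] by (simp add: dist_norm)
    qed
    then show "\<exists>M. \<forall>m\<ge>M. \<forall>n\<ge>M. dist (x m i) (x n i) < e" by blast
  qed
  then have "\<forall>i. \<exists>a. (\<lambda>n. x n i) \<longlonglongrightarrow> a" using Cauchy_convergent unfolding convergent_def by blast
  then obtain l where "\<forall>i. (\<lambda>n. x n i) \<longlonglongrightarrow> l i" by (rule choice[THEN exE])
  then have l: "\<And>i. (\<lambda>n. x n i) \<longlonglongrightarrow> l i" by (rule spec)
  have key: "summable (\<lambda>i. norm ((x m - l) i) * A k i) \<and> kothe_norm A k (x m - l) \<le> e"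
    if m: "m \<ge> M" and M: "\<And>m n. m \<ge> M \<Longrightarrow> n \<ge> M \<Longrightarrow> kothe_norm A k (x m - x n) < e" for m M k e
  proof -
    have b: "(\<Sum>i<J. norm ((x m - l) i) * A k i) \<le> e" for J
    proof (rule LIMSEQ_le_const2)
      show "(\<lambda>n. \<Sum>i<J. norm ((x m - x n) i) * A k i) \<longlonglongrightarrow> (\<Sum>i<J. norm ((x m - l) i) * A k i)"
        unfolding minus_apply by (intro tendsto_intros l)
      have "(\<Sum>i<J. norm ((x m - x n) i) * A k i) \<le> e" if "n \<ge> M" for n
      proof -
        have "(\<Sum>i<J. norm ((x m - x n) i) * A k i) \<le> kothe_norm A k (x m - x n)"
          unfolding kothe_norm_def using kothe_diff[OF A x x, of m n] Apos
          by (intro sum_le_suminf) (auto simp: kothe_def less_imp_le)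
        then show ?thesis using M[OF m that] by linarith
      qed
      then show "\<exists>N. \<forall>n\<ge>N. (\<Sum>i<J. norm ((x m - x n) i) * A k i) \<le> e" by blast
    qed
    have s: "summable (\<lambda>i. norm ((x m - l) i) * A k i)"
      by (rule summableI_nonneg_bounded[OF _ b]) (use Apos in \<open>simp add: less_imp_le\<close>)
    then show ?thesis unfolding kothe_norm_def using suminf_le_const[OF s b] by simp
  qed
  have lk: "summable (\<lambda>n. norm (l n) * A k n)" for k
  proof -
    obtain M where M: "\<And>m n. m \<ge> M \<Longrightarrow> n \<ge> M \<Longrightarrow> kothe_norm A k (x m - x n) < 1" using C[of 1 k] by auto
    have s: "summable (\<lambda>n. norm ((x M - l) n) * A k n + norm (x M n) * A k n)"
      using key[OF order_refl M] x[of M] by (intro summable_add) (auto simp: kothe_def)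
    show ?thesis
    proof (rule summable_comparison_test'[OF s, of 0])
      fix n
      have "norm (l n) \<le> norm ((x M - l) n) + norm (x M n)"
        using norm_triangle_ineq4[of "x M n" "(x M - l) n"] by simp
      then have "norm (l n) * A k n \<le> (norm ((x M - l) n) + norm (x M n)) * A k n"
        using Apos[of k n] by (intro mult_right_mono) auto
      then show "norm (norm (l n) * A k n) \<le> norm ((x M - l) n) * A k n + norm (x M n) * A k n"
        using Apos[of k n] by (simp add: distrib_right)
    qed
  qed
  then have lA: "l \<in> kothe A" by (simp add: kothe_def)
  have "(\<lambda>n. kothe_norm A k (x n - l)) \<longlonglongrightarrow> 0" for k
  proof (rule LIMSEQ_I)
    fix e :: real assume e: "0 < e"
    obtain M where M: "\<And>m n. m \<ge> M \<Longrightarrow> n \<ge> M \<Longrightarrow> kothe_norm A k (x m - x n) < e / 2" using C[of "e / 2" k] e by auto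
    have "norm (kothe_norm A k (x n - l) - 0) < e" if "n \<ge> M" for n
      using key[OF that M] kothe_norm_nonneg[OF A kothe_diff[OF A x lA], of k n] e by force
    then show "\<exists>no. \<forall>n\<ge>no. norm (kothe_norm A k (x n - l) - 0) < e" by blast
  qed
  then show thesis using that lA by blast
qed

lemma limitin_kothe_iff:
  assumes A: "kothe_matrix A" and x: "\<And>n. x n \<in> kothe A" and l: "l \<in> kothe A"
  shows "limitin (kothe_topology A) x l sequentially \<longleftrightarrow> (\<forall>k. (\<lambda>n. kothe_norm A k (x n - l)) \<longlonglongrightarrow> 0)"
proof
  assume lim: "limitin (kothe_topology A) x l sequentially"
  show "\<forall>k. (\<lambda>n. kothe_norm A k (x n - l)) \<longlonglongrightarrow> 0"
  proof (intro allI tendstoI)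
    fix k and e :: real assume e: "0 < e"
    let ?U = "{y \<in> kothe A. kothe_norm A k (y - l) < e}"
    have "openin (kothe_topology A) ?U"
      unfolding kothe_topology_def using l e by (intro topology_generated_by_Basis) blast
    moreover have "l \<in> ?U" using l e by simp
    ultimately have "\<forall>\<^sub>F n in sequentially. x n \<in> ?U" using lim unfolding limitin_def by blast
    then show "\<forall>\<^sub>F n in sequentially. dist (kothe_norm A k (x n - l)) 0 < e"
      by (rule eventually_mono) (use kothe_norm_nonneg[OF A kothe_diff[OF A x l]] in \<open>simp add: dist_real_def\<close>)
  qed
next
  assume c: "\<forall>k. (\<lambda>n. kothe_norm A k (x n - l)) \<longlonglongrightarrow> 0"
  show "limitin (kothe_topology A) x l sequentially"
    unfolding limitin_def
  proof (intro conjI allI impI)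
    show "l \<in> topspace (kothe_topology A)" using l by simp
    fix U assume U: "openin (kothe_topology A) U \<and> l \<in> U"
    then obtain k e where ke: "0 < e" "\<And>y. y \<in> kothe A \<Longrightarrow> kothe_norm A k (y - l) < e \<Longrightarrow> y \<in> U"
      unfolding openin_kothe_iff[OF A] by blast
    have "\<forall>\<^sub>F n in sequentially. kothe_norm A k (x n - l) < e" using c ke(1) by (intro order_tendstoD(2)) auto
    then show "\<forall>\<^sub>F n in sequentially. x n \<in> U" by (rule eventually_mono) (use ke x in blast)
  qed
qed

lemma closedin_kotheD:
  assumes A: "kothe_matrix A" and F: "closedin (kothe_topology A) F" and x: "\<And>n. x n \<in> F" and l: "l \<in> kothe A"
    and c: "\<And>k. (\<lambda>n. kothe_norm A k (x n - l)) \<longlonglongrightarrow> 0"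
  shows "l \<in> F"
proof (rule ccontr)
  assume "l \<notin> F"
  have FA: "F \<subseteq> kothe A" using closedin_subset[OF F] by simp
  have "limitin (kothe_topology A) x l sequentially"
    using limitin_kothe_iff[OF A _ l, of x] x FA c by blast
  moreover have "openin (kothe_topology A) (kothe A - F)" using F by (simp add: closedin_def)
  ultimately have "\<forall>\<^sub>F n in sequentially. x n \<in> kothe A - F" using \<open>l \<notin> F\<close> l unfolding limitin_def by blast
  then show False using x by (auto simp: eventually_sequentially)
qed

lemma continuous_kothe_bounded:
  fixes T :: "(nat \<Rightarrow> 'a::real_normed_field) \<Rightarrow> (nat \<Rightarrow> 'a)"
  assumes A: "kothe_matrix A" and T: "linear_map_on (kothe A) T" "continuous_map (kothe_topology A) (kothe_topology A) T"
  obtains m C where "0 < C" "\<And>x. x \<in> kothe A \<Longrightarrow> kothe_norm A k (T x) \<le> C * kothe_norm A m x"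
proof -
  have TA: "T x \<in> kothe A" if "x \<in> kothe A" for x
    using continuous_map_image_subset_topspace[OF T(2)] that by auto
  have "continuous_map (kothe_topology A) euclideanreal (kothe_norm A k :: (nat \<Rightarrow> 'a) \<Rightarrow> real)"
    using continuous_seminorm_kothe_norm[where 'a = 'a, OF A, of 1 k] by (simp add: continuous_seminorm_def)
  then have "continuous_map (kothe_topology A) euclideanreal (kothe_norm A k \<circ> T)"
    by (rule continuous_map_compose[OF T(2)])
  moreover have "seminorm_on (kothe A) (kothe_norm A k \<circ> T)"
    using T(1) TA unfolding seminorm_on_def linear_map_on_def
    by (auto simp: kothe_norm_scale kothe_norm_triangle[OF A])
  ultimately have "continuous_seminorm (kothe_topology A) (kothe_norm A k \<circ> T)"
    by (simp add: continuous_seminorm_def)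
  from continuous_seminorm_bounded[OF A this] show thesis using that by auto
qed

subsection \<open>The open mapping theorem\<close>

locale kothe_map =
  fixes A :: "nat \<Rightarrow> nat \<Rightarrow> real" and T :: "(nat \<Rightarrow> 'a::{real_normed_field,banach}) \<Rightarrow> (nat \<Rightarrow> 'a)"
  assumes A: "kothe_matrix A" and lin: "linear_map_on (kothe A) T"
    and cont: "continuous_map (kothe_topology A) (kothe_topology A) T"
    and closed: "closedin (kothe_topology A) (T ` kothe A)"
begin

abbreviation q :: "nat \<Rightarrow> (nat \<Rightarrow> 'a) \<Rightarrow> real" where "q \<equiv> kothe_norm A"

definition F :: "(nat \<Rightarrow> 'a) set" where "F = T ` kothe A"

lemma T_add: "x \<in> kothe A \<Longrightarrow> y \<in> kothe A \<Longrightarrow> T (x + y) = T x + T y"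
  and T_scale: "x \<in> kothe A \<Longrightarrow> T (scale_seq c x) = scale_seq c (T x)"
  using lin by (auto simp: linear_map_on_def)

lemma T_0: "T 0 = 0"
  using T_scale[OF kothe_zero, of 0] by (simp add: scale_seq_def zero_fun_def)

lemma diff_scale: "x - y = x + scale_seq (-1) (y :: nat \<Rightarrow> 'a)"
  by (auto simp: scale_seq_def)

lemma T_diff: "x \<in> kothe A \<Longrightarrow> y \<in> kothe A \<Longrightarrow> T (x - y) = T x - T y"
  unfolding diff_scale by (simp add: T_add T_scale kothe_scale)

lemma F_kothe: "x \<in> F \<Longrightarrow> x \<in> kothe A"
  using closedin_subset[OF closed] by (auto simp: F_def)

lemma F_T: "x \<in> kothe A \<Longrightarrow> T x \<in> F" by (simp add: F_def)

lemma F_add: "x \<in> F \<Longrightarrow> y \<in> F \<Longrightarrow> x + y \<in> F"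
  unfolding F_def using T_add kothe_add[OF A] by (metis (no_types, opaque_lifting) imageE imageI)

lemma F_scale: "x \<in> F \<Longrightarrow> scale_seq c x \<in> F"
  unfolding F_def using T_scale kothe_scale by (metis (no_types, opaque_lifting) imageE imageI)

lemma F_diff: "x \<in> F \<Longrightarrow> y \<in> F \<Longrightarrow> x - y \<in> F"
  unfolding diff_scale by (intro F_add F_scale)

lemmas q_nonneg = kothe_norm_nonneg[OF A] and q_mono = kothe_norm_mono[OF A]
  and q_tri = kothe_norm_triangle[OF A] and q_dist = kothe_norm_dist_triangle[OF A]

lemma q_diff: "x \<in> kothe A \<Longrightarrow> y \<in> kothe A \<Longrightarrow> q k (x - y) \<le> q k x + q k y"
  unfolding diff_scale using q_tri[of x "scale_seq (-1) y"] by (simp add: kothe_scale kothe_norm_scale)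

text \<open>The closure of the image of a large multiple of the unit ball of \<open>q k\<close> has interior, since
  otherwise nested balls would shrink to a point of the range that avoids all multiples.\<close>

lemma baire:
  "\<exists>c::nat. \<exists>x\<in>F. \<exists>m. \<exists>e>0. \<forall>z\<in>F. q m (z - x) \<le> e \<longrightarrow>
    (\<forall>m'. \<forall>e'>0. \<exists>\<xi>\<in>kothe A. q k \<xi> \<le> real c \<and> q m' (z - T \<xi>) < e')"
proof (rule ccontr)
  assume neg: "\<not> ?thesis"
  have ex: "\<exists>z\<in>F. \<exists>m' e'. q m (z - x) \<le> e \<and> 0 < e' \<and> (\<forall>\<xi>\<in>kothe A. q k \<xi> \<le> real c \<longrightarrow> e' \<le> q m' (z - T \<xi>))"
    if "x \<in> F" "0 < e" for c x m e
  proof (rule ccontr)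
    assume n: "\<not> ?thesis"
    have "\<exists>\<xi>\<in>kothe A. q k \<xi> \<le> real c \<and> q m' (z - T \<xi>) < e'" if z: "z \<in> F" "q m (z - x) \<le> e" "0 < e'" for z m' e'
    proof (rule ccontr)
      assume "\<not> ?thesis"
      then have "\<forall>\<xi>\<in>kothe A. q k \<xi> \<le> real c \<longrightarrow> e' \<le> q m' (z - T \<xi>)" by (simp add: not_less)
      then show False using n z by blast
    qed
    then show False using neg that by blast
  qed
  \<comment> \<open>The triples are balls: centre in the range, index of the norm, radius. The
    factor 2 in \<open>?Q\<close> matters at the limit, which is only known to lie within one radius
    of the centre.\<close>
  let ?P = "\<lambda>n (p :: (nat \<Rightarrow> 'a) \<times> nat \<times> real). fst p \<in> F \<and> n \<le> fst (snd p) \<and> 0 < snd (snd p) \<and> snd (snd p) \<le> 1 / 2 ^ n"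
  let ?Q = "\<lambda>n (p :: (nat \<Rightarrow> 'a) \<times> nat \<times> real) (p' :: (nat \<Rightarrow> 'a) \<times> nat \<times> real).
    q (fst (snd p)) (fst p' - fst p) \<le> snd (snd p) / 2 \<and> fst (snd p) \<le> fst (snd p') \<and> snd (snd p') \<le> snd (snd p) / 2 \<and>
    (\<forall>\<xi>\<in>kothe A. q k \<xi> \<le> real n \<longrightarrow> 2 * snd (snd p') \<le> q (fst (snd p')) (fst p' - T \<xi>))"
  have "\<exists>f. \<forall>n. ?P n (f n) \<and> ?Q n (f n) (f (Suc n))"
  proof (rule dependent_nat_choice)
    show "\<exists>p. ?P 0 p" by (rule exI[of _ "(0, 0, 1)"]) (use F_T[OF kothe_zero] T_0 in simp)
    fix p n assume p: "?P n p"
    obtain x m e where pe: "p = (x, m, e)" by (cases p) auto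
    have x: "x \<in> F" and e: "0 < e" "n \<le> m" "e \<le> 1 / 2 ^ n" using p pe by auto
    obtain z m' e' where z: "z \<in> F" "q m (z - x) \<le> e / 2" "0 < e'"
      "\<And>\<xi>. \<xi> \<in> kothe A \<Longrightarrow> q k \<xi> \<le> real n \<Longrightarrow> e' \<le> q m' (z - T \<xi>)" using ex[OF x, of "e / 2" m n] e by auto
    define M where "M = max (max m m') (Suc n)"
    have "?P (Suc n) (z, M, min (e / 2) (e' / 2))" using z e by (auto simp: M_def min_def)
    moreover have "?Q n p (z, M, min (e / 2) (e' / 2))"
    proof -
      have "2 * min (e / 2) (e' / 2) \<le> q M (z - T \<xi>)" if \<xi>: "\<xi> \<in> kothe A" "q k \<xi> \<le> real n" for \<xi>
      proof -
        have "q m' (z - T \<xi>) \<le> q M (z - T \<xi>)"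
          by (intro q_mono kothe_diff A F_kothe[OF z(1)] F_kothe[OF F_T[OF \<xi>(1)]]) (auto simp: M_def)
        then show ?thesis using z(4)[OF \<xi>] by (auto simp: min_def)
      qed
      then show ?thesis using z by (simp add: pe M_def min_def le_max_iff_disj)
    qed
    ultimately show "\<exists>p'. ?P (Suc n) p' \<and> ?Q n p p'" by blast
  qed
  then obtain f where f: "\<And>n. ?P n (f n)" "\<And>n. ?Q n (f n) (f (Suc n))" by blast
  define x m e where "x = (\<lambda>n. fst (f n))" and "m = (\<lambda>n. fst (snd (f n)))" and "e = (\<lambda>n. snd (snd (f n)))"
  have x: "x n \<in> F" "x n \<in> kothe A" "n \<le> m n" "0 < e n" "e n \<le> 1 / 2 ^ n" for n
    using f(1)[of n] F_kothe by (auto simp: x_def m_def e_def)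
  have st: "q (m n) (x (Suc n) - x n) \<le> e n / 2" "m n \<le> m (Suc n)" "e (Suc n) \<le> e n / 2"
    "\<And>\<xi>. \<xi> \<in> kothe A \<Longrightarrow> q k \<xi> \<le> real n \<Longrightarrow> 2 * e (Suc n) \<le> q (m (Suc n)) (x (Suc n) - T \<xi>)" for n
    using f(2)[of n] by (auto simp: x_def m_def e_def)
  have nest: "q (m n) (x (n + j) - x n) \<le> e n" for n j
  proof (induction j arbitrary: n)
    case 0
    have "x (n + 0) - x n = 0" by simp
    then show ?case using x(4)[of n] by (simp only: kothe_norm_zero less_imp_le)
  next
    case (Suc j)
    have "q (m n) (x (Suc n + j) - x (Suc n)) \<le> q (m (Suc n)) (x (Suc n + j) - x (Suc n))"
      by (intro q_mono st kothe_diff A x)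
    also have "\<dots> \<le> e n / 2" using Suc.IH[of "Suc n"] st(3)[of n] by linarith
    finally have "q (m n) (x (Suc n + j) - x (Suc n)) \<le> e n / 2" .
    then show ?case using q_dist[OF x(2) x(2) x(2), of "m n" "Suc n + j" n "Suc n"] st(1)[of n]
      unfolding add_Suc_shift by linarith
  qed
  have small: "\<exists>M\<ge>k. e M < d" if d: "0 < d" for k and d :: real
  proof -
    obtain M0 where "(1 / 2) ^ M0 < d" using real_arch_pow_inv[of d "1 / 2"] d by auto
    then have "1 / 2 ^ M0 < d" by (simp add: power_divide)
    moreover have "(1::real) / 2 ^ max k M0 \<le> 1 / 2 ^ M0" by (intro divide_left_mono power_increasing) auto
    ultimately show ?thesis using x(5)[of "max k M0"] by (intro exI[of _ "max k M0"]) auto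
  qed
  obtain l where l: "l \<in> kothe A" "\<And>k. (\<lambda>n. q k (x n - l)) \<longlonglongrightarrow> 0"
  proof (rule kothe_complete[OF A x(2)])
    fix k and d :: real assume d: "0 < d"
    obtain M where M: "k \<le> M" "e M < d / 2" using small[of "d / 2" k] d by auto
    have near: "q k (x n - x M) < d / 2" if "n \<ge> M" for n
    proof -
      have "q k (x n - x M) \<le> q (m M) (x n - x M)"
        using M(1) x(3)[of M] by (intro q_mono kothe_diff A x) simp
      also have "\<dots> \<le> e M" using nest[of M "n - M"] that by simp
      finally show ?thesis using M by linarith
    qed
    have "q k (x i - x j) < d" if "i \<ge> M" "j \<ge> M" for i j
      using q_dist[OF x(2) x(2) x(2), of k i j M] near[OF that(1)] near[OF that(2)] kothe_norm_minus_commute[of A k "x M" "x j"] by simp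
    then show "\<exists>M. \<forall>i\<ge>M. \<forall>j\<ge>M. q k (x i - x j) < d" by blast
  qed (rule that)
  have "l \<in> F" unfolding F_def
    by (rule closedin_kotheD[OF A closed _ l]) (use x(1) in \<open>simp add: F_def\<close>)
  then obtain \<xi> where \<xi>: "\<xi> \<in> kothe A" "l = T \<xi>" by (auto simp: F_def)
  obtain n where n: "q k \<xi> \<le> real n" using real_arch_simple by blast
  have "q (m (Suc n)) (x (Suc n) - l) \<le> e (Suc n)"
  proof (rule LIMSEQ_le_const[of "\<lambda>j. e (Suc n) + q (m (Suc n)) (x j - l)" "e (Suc n)"])
    show "(\<lambda>j. e (Suc n) + q (m (Suc n)) (x j - l)) \<longlonglongrightarrow> e (Suc n)"
      using tendsto_add[OF tendsto_const l(2)] by fastforce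
    have "q (m (Suc n)) (x (Suc n) - l) \<le> e (Suc n) + q (m (Suc n)) (x j - l)" if "j \<ge> Suc n" for j
      using q_dist[OF x(2) x(2) l(1), of "m (Suc n)" "Suc n" j] nest[of "Suc n" "j - Suc n"] that
        kothe_norm_minus_commute[of A "m (Suc n)" "x j" "x (Suc n)"] by simp
    then show "\<exists>N. \<forall>j\<ge>N. q (m (Suc n)) (x (Suc n) - l) \<le> e (Suc n) + q (m (Suc n)) (x j - l)" by blast
  qed
  then show False using st(4)[OF \<xi>(1) n] x(4)[of "Suc n"] \<xi>(2) by simp
qed

text \<open>Differences of approximate preimages of \<open>x\<close> plus a multiple of
  \<open>z\<close> and of \<open>x\<close> are approximate preimages of that multiple. This moves
  the interior point to 0, and scaling gives the bound for all \<open>z\<close>.\<close>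

lemma almost_open:
  "\<exists>m. \<exists>D>0. \<forall>z\<in>F. \<forall>m'. \<forall>e'>0. \<exists>\<xi>\<in>kothe A. q k \<xi> \<le> D * q m z \<and> q m' (z - T \<xi>) < e'"
proof -
  obtain c x m e where x: "x \<in> F" and e: "0 < e" and
    b: "\<And>z m' e'. z \<in> F \<Longrightarrow> q m (z - x) \<le> e \<Longrightarrow> 0 < e' \<Longrightarrow> \<exists>\<xi>\<in>kothe A. q k \<xi> \<le> real c \<and> q m' (z - T \<xi>) < e'"
    using baire[of k] by blast
  define D where "D = 2 * (real c + 1) / e"
  have D: "0 < D" using e by (simp add: D_def)
  have "\<exists>\<xi>\<in>kothe A. q k \<xi> \<le> D * q m z \<and> q m' (z - T \<xi>) < e'" if z: "z \<in> F" and e': "0 < e'" for z m' e'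
  proof (cases "q m z \<le> 0")
    case True
    then have "z = 0" using kothe_norm_0D[OF A F_kothe[OF z]] by blast
    then show ?thesis using T_0 e' D by (intro bexI[of _ 0]) (auto simp: kothe_zero)
  next
    case False
    define s where "s = e / q m z"
    have s: "0 < s" using False e by (simp add: s_def)
    let ?z = "scale_seq (of_real s) z"
    have zA: "z \<in> kothe A" "?z \<in> F" "?z \<in> kothe A" "x \<in> kothe A" using z x F_kothe F_scale by auto
    have "q m ?z = norm (of_real s :: 'a) * q m z" by (rule kothe_norm_scale[OF zA(1)])
    also have "\<dots> = e" unfolding norm_of_real using s e False by (simp add: s_def)
    finally have "q m ?z = e" .
    then have 1: "q m (x + ?z - x) \<le> e" by simp
    obtain \<xi>1 where \<xi>1: "\<xi>1 \<in> kothe A" "q k \<xi>1 \<le> real c" "q m' (x + ?z - T \<xi>1) < s * e' / 2"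
      using b[OF F_add[OF x zA(2)] 1, of "s * e' / 2" m'] s e' by auto
    obtain \<xi>2 where \<xi>2: "\<xi>2 \<in> kothe A" "q k \<xi>2 \<le> real c" "q m' (x - T \<xi>2) < s * e' / 2"
      using b[OF x, of "s * e' / 2" m'] e s e' by auto
    let ?i = "of_real (inverse s) :: 'a"
    let ?\<xi> = "scale_seq ?i (\<xi>1 - \<xi>2)"
    have d: "\<xi>1 - \<xi>2 \<in> kothe A" by (intro kothe_diff A \<xi>1 \<xi>2)
    have ni: "norm ?i = inverse s" unfolding norm_of_real using s by simp
    have "q k ?\<xi> = inverse s * q k (\<xi>1 - \<xi>2)" using kothe_norm_scale[OF d, of k ?i] ni by simp
    also have "\<dots> \<le> inverse s * (2 * (real c + 1))"
      using q_diff[OF \<xi>1(1) \<xi>2(1), of k] \<xi>1(2) \<xi>2(2) s by (intro mult_left_mono) auto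
    also have "\<dots> = D * q m z" using False e by (simp add: D_def s_def field_simps)
    finally have 2: "q k ?\<xi> \<le> D * q m z" .
    let ?r = "(x + ?z - T \<xi>1) - (x - T \<xi>2)"
    have TF: "T \<xi>1 \<in> F" "T \<xi>2 \<in> F" using F_T \<xi>1 \<xi>2 by auto
    have rA: "x + ?z - T \<xi>1 \<in> kothe A" "x - T \<xi>2 \<in> kothe A" using F_kothe F_diff F_add x zA TF by auto
    have "z - T ?\<xi> = scale_seq ?i ?r"
      unfolding T_scale[OF d] T_diff[OF \<xi>1(1) \<xi>2(1)]
    proof
      fix j
      have ring: "i * ((x j + t * z j - a) - (x j - b)) = (i * t) * z j - i * (a - b)" for i t a b :: 'a
        by (simp add: algebra_simps)
      have "?i * of_real s = 1" using s by simp
      then show "(z - scale_seq ?i (T \<xi>1 - T \<xi>2)) j = scale_seq ?i ?r j"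
        using ring[of ?i "of_real s" "T \<xi>1 j" "T \<xi>2 j"] unfolding scale_seq_def minus_apply plus_fun_apply by (simp only: mult_1_left)
    qed
    then have "q m' (z - T ?\<xi>) = inverse s * q m' ?r" using kothe_norm_scale[OF kothe_diff[OF A rA], of m' ?i] ni by simp
    also have "\<dots> < inverse s * (s * e')"
      using q_diff[OF rA, of m'] \<xi>1(3) \<xi>2(3) s by (intro mult_strict_left_mono) auto
    also have "\<dots> = e'" using s by simp
    finally show ?thesis using 2 kothe_scale[OF d] by blast
  qed
  then show ?thesis using D by blast
qed

text \<open>Successive approximation. The correction number \<open>i\<close> is controlled in the
  norm \<open>k + i\<close> and not in a fixed one, since the series must converge in every norm of
  the space.\<close>

theorem open_mapping:
  "\<exists>m. \<exists>D>0. \<forall>z\<in>F. \<exists>\<xi>\<in>kothe A. T \<xi> = z \<and> q k \<xi> \<le> D * q m z"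
proof -
  have "\<forall>i::nat. \<exists>m D. 0 < D \<and> (\<forall>z\<in>F. \<forall>m'. \<forall>e'>0. \<exists>\<xi>\<in>kothe A. q (k + i) \<xi> \<le> D * q m z \<and> q m' (z - T \<xi>) < e')"
    using almost_open by blast
  then obtain m :: "nat \<Rightarrow> nat" and D :: "nat \<Rightarrow> real" where D: "\<And>i::nat. 0 < D i"
    and ao: "\<And>(i::nat) z m' e'. z \<in> F \<Longrightarrow> 0 < e' \<Longrightarrow> \<exists>\<xi>\<in>kothe A. q (k + i) \<xi> \<le> D i * q (m i) z \<and> q m' (z - T \<xi>) < e'"
    by metis
  have "\<exists>\<xi>\<in>kothe A. T \<xi> = z \<and> q k \<xi> \<le> (D 0 + 1) * q (m 0) z" if z: "z \<in> F" for z
  proof (cases "q (m 0) z \<le> 0")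
    case True
    then have "z = 0" using kothe_norm_0D[OF A F_kothe[OF z]] by blast
    then show ?thesis using T_0 by (intro bexI[of _ 0]) (auto simp: kothe_zero)
  next
    case False
    define t where "t = q (m 0) z"
    have t: "0 < t" using False by (simp add: t_def)
    \<comment> \<open>Chosen so that the next correction, bounded by \<open>D (Suc i)\<close> times
      the residual, is at most \<open>t / 2 ^ Suc i\<close>, and so is the residual.\<close>
    define \<epsilon> where "\<epsilon> = (\<lambda>i. t / (2 ^ (Suc i) * (1 + D (Suc i))))"
    have \<epsilon>: "0 < \<epsilon> i" "D (Suc i) * \<epsilon> i \<le> t / 2 ^ Suc i" "\<epsilon> i \<le> t / 2 ^ Suc i" for i
    proof -
      have D1: "0 < D (Suc i)" "0 < 1 + D (Suc i)" using D[of "Suc i"] by auto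
      show "0 < \<epsilon> i" using t D1 by (simp add: \<epsilon>_def)
      have e: "\<epsilon> i * (1 + D (Suc i)) = t / 2 ^ Suc i" using D1 by (simp add: \<epsilon>_def)
      have "0 < \<epsilon> i * D (Suc i)" using \<open>0 < \<epsilon> i\<close> D1 by simp
      then show "D (Suc i) * \<epsilon> i \<le> t / 2 ^ Suc i" "\<epsilon> i \<le> t / 2 ^ Suc i"
        using e \<open>0 < \<epsilon> i\<close> by (simp_all add: distrib_left mult.commute)
    qed
    let ?P = "\<lambda>i r. r \<in> F \<and> (i = 0 \<longrightarrow> r = z)"
    \<comment> \<open>The residual is made small both in the norm that bounds the next correction
      and in the norm \<open>i\<close>, the latter so that it tends to 0.\<close>
    let ?Q = "\<lambda>i r r'. \<exists>\<xi>\<in>kothe A. r' = r - T \<xi> \<and> q (k + i) \<xi> \<le> D i * q (m i) r \<and> q (max (m (Suc i)) i) r' < \<epsilon> i"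
    have "\<exists>r. \<forall>i. ?P i (r i) \<and> ?Q i (r i) (r (Suc i))"
    proof (rule dependent_nat_choice)
      show "\<exists>r. ?P 0 r" using z by blast
      fix r :: "nat \<Rightarrow> 'a" and i :: nat assume r: "?P i r"
      obtain \<xi> where \<xi>: "\<xi> \<in> kothe A" "q (k + i) \<xi> \<le> D i * q (m i) r" "q (max (m (Suc i)) i) (r - T \<xi>) < \<epsilon> i"
        using ao[of r "\<epsilon> i" i "max (m (Suc i)) i"] r \<epsilon>(1) by blast
      show "\<exists>r'. ?P (Suc i) r' \<and> ?Q i r r'"
        by (rule exI[of _ "r - T \<xi>"]) (use r \<xi> F_diff F_T in blast)
    qed
    then obtain r :: "nat \<Rightarrow> nat \<Rightarrow> 'a" where r: "\<And>i. r i \<in> F" "r 0 = z" and "\<And>i. ?Q i (r i) (r (Suc i))" by blast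
    then obtain \<xi> :: "nat \<Rightarrow> nat \<Rightarrow> 'a" where \<xi>: "\<And>i. \<xi> i \<in> kothe A" "\<And>i. r (Suc i) = r i - T (\<xi> i)"
      "\<And>i::nat. q (k + i) (\<xi> i) \<le> D i * q (m i) (r i)" "\<And>i. q (max (m (Suc i)) i) (r (Suc i)) < \<epsilon> i" by metis
    have rA: "r i \<in> kothe A" for i using r F_kothe by blast
    have rm: "q (m (Suc i)) (r (Suc i)) \<le> \<epsilon> i" "q i (r (Suc i)) \<le> \<epsilon> i" for i
      using \<xi>(4)[of i] q_mono[OF _ rA[of "Suc i"], of "m (Suc i)" "max (m (Suc i)) i"]
        q_mono[OF _ rA[of "Suc i"], of i "max (m (Suc i)) i"] by auto
    have \<xi>b: "q (k + Suc i) (\<xi> (Suc i)) \<le> t / 2 ^ Suc i" for i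
    proof -
      have "q (k + Suc i) (\<xi> (Suc i)) \<le> D (Suc i) * q (m (Suc i)) (r (Suc i))" by (rule \<xi>(3))
      also have "\<dots> \<le> D (Suc i) * \<epsilon> i" using rm(1) D[of "Suc i"] by (intro mult_left_mono) auto
      finally show ?thesis using \<epsilon>(2)[of i] by linarith
    qed
    define s where "s = (\<lambda>n. \<Sum>i<n. \<xi> i)"
    have sA: "s n \<in> kothe A" for n unfolding s_def by (intro kothe_sum A \<xi>)
    have s_Suc: "s (Suc n) = s n + \<xi> n" for n by (simp add: s_def)
    have Ts: "T (s n) = z - r n" for n
    proof (induction n)
      case 0
      have "s 0 = 0" by (simp add: s_def)
      then show ?case by (simp only: T_0 r(2) diff_self)
    next
      case (Suc n)
      show ?case unfolding s_Suc T_add[OF sA \<xi>(1)] Suc \<xi>(2)[of n] by (rule ext) (simp add: algebra_simps)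
    qed
    have tail: "q j (s (Suc n + i) - s (Suc n)) \<le> t / 2 ^ n - t / 2 ^ (n + i)" if "j \<le> k + n" for j n i
    proof (induction i)
      case 0
      show ?case by (simp only: add_0_right diff_self kothe_norm_zero order_refl)
    next
      case (Suc i)
      have e: "s (Suc n + Suc i) - s (Suc n) = (s (Suc n + i) - s (Suc n)) + \<xi> (Suc n + i)"
        using s_Suc[of "Suc n + i"] by simp
      have "q j (s (Suc n + Suc i) - s (Suc n)) \<le> q j (s (Suc n + i) - s (Suc n)) + q j (\<xi> (Suc n + i))"
        unfolding e by (rule q_tri[OF kothe_diff[OF A sA sA] \<xi>(1)])
      moreover have "q j (\<xi> (Suc n + i)) \<le> q (k + Suc (n + i)) (\<xi> (Suc (n + i)))"
        unfolding add_Suc by (intro q_mono \<xi>) (use that in simp)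
      moreover have "t / 2 ^ (n + i) = t / 2 ^ Suc (n + i) + t / 2 ^ Suc (n + i)" by simp
      ultimately show ?case using Suc.IH \<xi>b[of "n + i"] unfolding add_Suc_right add_Suc by linarith
    qed
    have tail': "q j (s (Suc n + i) - s (Suc n)) \<le> t / 2 ^ n" if "j \<le> k + n" for j n i
    proof -
      have "0 \<le> t / 2 ^ (n + i)" using t by simp
      then show ?thesis using tail[OF that, of i] by linarith
    qed
    have halves: "(\<lambda>n. t / 2 ^ n) \<longlonglongrightarrow> 0"
      using tendsto_mult[OF tendsto_const[of t] LIMSEQ_power_zero[of "1 / 2 :: real"]] by (simp add: power_divide)
    obtain l where l: "l \<in> kothe A" "\<And>j. (\<lambda>n. q j (s n - l)) \<longlonglongrightarrow> 0"
    proof (rule kothe_complete[OF A sA])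
      fix j and d :: real assume d: "0 < d"
      obtain N where N: "\<And>n. n \<ge> N \<Longrightarrow> t / 2 ^ n < d / 2"
        using order_tendstoD(2)[OF halves, of "d / 2"] d unfolding eventually_sequentially by auto
      define M where "M = max N j"
      have near: "q j (s n - s (Suc M)) < d / 2" if "n \<ge> Suc M" for n
      proof -
        have "j \<le> k + M" by (simp add: M_def)
        then have "q j (s n - s (Suc M)) \<le> t / 2 ^ M" using tail'[of j M "n - Suc M"] that by simp
        moreover have "t / 2 ^ M < d / 2" by (rule N) (simp add: M_def)
        ultimately show ?thesis by linarith
      qed
      have "q j (s a - s b) < d" if "a \<ge> Suc M" "b \<ge> Suc M" for a b
        using q_dist[OF sA sA sA, of j a b "Suc M"] near[OF that(1)] near[OF that(2)]
          kothe_norm_minus_commute[of A j "s (Suc M)" "s b"] by simp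
      then show "\<exists>M. \<forall>a\<ge>M. \<forall>b\<ge>M. q j (s a - s b) < d" by blast
    qed (rule that)
    have "T l = z"
    proof -
      obtain m' C where C: "0 < C" "\<And>x. x \<in> kothe A \<Longrightarrow> q 0 (T x) \<le> C * q m' x"
        using continuous_kothe_bounded[OF A lin cont, of 0] by blast
      have TlA: "T l \<in> kothe A" using F_kothe F_T l by blast
      have b: "q 0 (z - T l) \<le> C * q m' (s (Suc n) - l) + t / 2 ^ Suc n" for n
      proof -
        have "z - T l = T (s (Suc n) - l) + r (Suc n)" unfolding T_diff[OF sA l(1)] Ts by simp
        then have "q 0 (z - T l) \<le> q 0 (T (s (Suc n) - l)) + q 0 (r (Suc n))"
          using q_tri[OF F_kothe[OF F_T[OF kothe_diff[OF A sA l(1)]]] rA] by simp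
        moreover have "q 0 (r (Suc n)) \<le> q n (r (Suc n))" by (intro q_mono rA) simp
        ultimately show ?thesis using C(2)[OF kothe_diff[OF A sA l(1)], of "Suc n"] rm(2)[of n] \<epsilon>(3)[of n] by linarith
      qed
      have "(\<lambda>n. C * q m' (s (Suc n) - l) + t / 2 ^ Suc n) \<longlonglongrightarrow> C * 0 + 0"
        by (intro tendsto_intros LIMSEQ_Suc[OF l(2)] LIMSEQ_Suc[OF halves])
      then have "q 0 (z - T l) \<le> C * 0 + 0" by (rule LIMSEQ_le_const) (use b in blast)
      then have "z - T l = 0" using kothe_norm_0D[OF A kothe_diff[OF A F_kothe[OF z] TlA]] by simp
      then show ?thesis by simp
    qed
    moreover have "q k l \<le> (D 0 + 1) * t"
    proof -
      have b: "q k l \<le> D 0 * t + t + q k (s (Suc n) - l)" for n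
      proof -
        have "l = (s (Suc n) - (s (Suc n) - l))" by simp
        then have "q k l \<le> q k (s (Suc n)) + q k (s (Suc n) - l)" using q_diff[OF sA kothe_diff[OF A sA l(1)]] by metis
        moreover have "s (Suc n) = (s (Suc 0 + n) - s (Suc 0)) + s (Suc 0)" by simp
        then have "q k (s (Suc n)) \<le> q k (s (Suc 0 + n) - s (Suc 0)) + q k (s (Suc 0))"
          using q_tri[OF kothe_diff[OF A sA sA] sA] by metis
        moreover have "s (Suc 0) = \<xi> 0" by (simp add: s_def)
        moreover have "q k (\<xi> 0) \<le> D 0 * t" using \<xi>(3)[of 0] r by (simp add: t_def)
        ultimately show ?thesis using tail'[of k 0 n] by simp
      qed
      have "(\<lambda>n. D 0 * t + t + q k (s (Suc n) - l)) \<longlonglongrightarrow> D 0 * t + t + 0"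
        by (intro tendsto_intros LIMSEQ_Suc[OF l(2)])
      then have "q k l \<le> D 0 * t + t + 0" by (rule LIMSEQ_le_const) (use b in blast)
      then show ?thesis by (simp add: distrib_right)
    qed
    ultimately show ?thesis using l(1) unfolding t_def by blast
  qed
  moreover have "0 < D 0 + 1" using D[of 0] by linarith
  ultimately show ?thesis by blast
qed

end

subsection \<open>Choosing the norms\<close>

text \<open>Regularity compares neighbouring norms; multiplying the quotients from \<open>k\<close>
  up to \<open>m\<close> gives the general case.\<close>

lemma ratio_mono:
  assumes A: "kothe_matrix A" and reg: "regular_matrix A" and km: "k \<le> m"
  shows "n \<le> n' \<Longrightarrow> A k n' / A m n' \<le> A k n / A m n"
proof -
  have pos: "0 < A k n" for k n using A by (simp add: kothe_matrix_def)
  have "A k (Suc n) / A m (Suc n) \<le> A k n / A m n" for n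
    using km
  proof (induction rule: dec_induct)
    case base
    then show ?case using pos[of k n] pos[of k "Suc n"] by simp
  next
    case (step m)
    have "(A k (Suc n) / A m (Suc n)) * (A m (Suc n) / A (Suc m) (Suc n)) \<le> (A k n / A m n) * (A m n / A (Suc m) n)"
      using step.IH reg pos by (intro mult_mono) (auto simp: regular_matrix_def less_imp_le)
    then show ?case using pos[of m n] pos[of m "Suc n"] by simp
  qed
  then show "n \<le> n' \<Longrightarrow> A k n' / A m n' \<le> A k n / A m n"
    using lift_Suc_antimono_le[of "\<lambda>n. A k n / A m n"] by blast
qed

locale kothe_range = kothe_map A T + conj_scalar cj
  for A and T :: "(nat \<Rightarrow> 'a::{real_normed_field,banach,heine_borel}) \<Rightarrow> (nat \<Rightarrow> 'a)" and cj :: "'a \<Rightarrow> 'a" +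
  fixes p :: nat
  assumes reg: "regular_matrix A" and nuc: "\<And>k. \<exists>m. summable (\<lambda>n. A k n / A m n)"
    and d1: "\<And>k. \<exists>r. \<exists>C>0. \<forall>n. (A k n)\<^sup>2 \<le> C * A p n * A r n"
begin

lemma Apos: "0 < A k n" using A by (simp add: kothe_matrix_def)

lemma A_mono: "k \<le> m \<Longrightarrow> A k n \<le> A m n" by (rule kothe_matrix_mono[OF A])

text \<open>Ratios scaled to be at most 1 dominate their squares. With bound 1 this makes sup norms
  control Hilbert norms of lower index.\<close>

lemma nuclear_squares:
  "\<exists>m D. 1 \<le> D \<and> (\<forall>r\<ge>m. \<forall>C C' y. 0 < C \<longrightarrow> C * D \<le> C' \<longrightarrow> (\<Sum>n<y. (C * A k n / (C' * A r n))\<^sup>2) \<le> 1)"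
proof -
  obtain m where m: "summable (\<lambda>n. A k n / A m n)" using nuc by blast
  define D where "D = 1 + (\<Sum>n. A k n / A m n)"
  have nn: "0 \<le> A k n / A m n" for n using Apos[of k n] Apos[of m n] by simp
  have D: "1 \<le> D" using suminf_nonneg[OF m nn] by (simp add: D_def)
  have "(\<Sum>n<y. (C * A k n / (C' * A r n))\<^sup>2) \<le> 1" if r: "m \<le> r" and C: "0 < C" "C * D \<le> C'" for r C C' y
  proof -
    have C': "0 < C'" using C D by (smt (verit) mult_pos_pos)
    have le: "C * A k n / (C' * A r n) \<le> (A k n / A m n) / D" for n
    proof -
      have "C / C' \<le> 1 / D" using C C' D by (simp add: field_simps)
      moreover have "A k n / A r n \<le> A k n / A m n"
        using Apos A_mono[OF r] by (intro divide_left_mono mult_pos_pos) (auto simp: less_imp_le)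
      ultimately have "(C / C') * (A k n / A r n) \<le> (1 / D) * (A k n / A m n)"
        using nn D Apos[of k n] Apos[of r n] by (intro mult_mono) auto
      then show ?thesis by (simp add: mult.commute)
    qed
    have part: "(\<Sum>n<y. A k n / A m n) \<le> D" using sum_le_suminf[OF m, of "{..<y}"] nn by (simp add: D_def)
    have one: "A k n / A m n \<le> D" for n using sum_le_suminf[OF m, of "{n}"] nn by (simp add: D_def)
    have "(C * A k n / (C' * A r n))\<^sup>2 \<le> (A k n / A m n) / D" for n
    proof -
      have z: "0 \<le> C * A k n / (C' * A r n)" using C C' Apos[of k n] Apos[of r n] by simp
      have "C * A k n / (C' * A r n) \<le> 1" using le[of n] one[of n] D by (smt (verit) divide_le_eq_1_pos)
      then have "(C * A k n / (C' * A r n)) * (C * A k n / (C' * A r n)) \<le> (C * A k n / (C' * A r n)) * 1"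
        using z by (intro mult_left_mono)
      then show ?thesis unfolding power2_eq_square using le[of n] by linarith
    qed
    then have "(\<Sum>n<y. (C * A k n / (C' * A r n))\<^sup>2) \<le> (\<Sum>n<y. (A k n / A m n) / D)" by (intro sum_mono)
    also have "\<dots> = (\<Sum>n<y. A k n / A m n) / D" by (simp add: sum_divide_distrib)
    also have "\<dots> \<le> 1" using part D by simp
    finally show ?thesis .
  qed
  then show ?thesis using D by blast
qed

text \<open>Serves to transfer continuity and openness of \<open>T\<close>, which are known for
  summed norms, to sup norms of higher index.\<close>

lemma kothe_norm_le_sup:
  "\<exists>m. \<exists>D>0. \<forall>x\<in>kothe A. \<forall>M. (\<forall>n. norm (x n :: 'a) * A m n \<le> M) \<longrightarrow> q k x \<le> D * M"
proof -
  obtain m where m: "summable (\<lambda>n. A k n / A m n)" using nuc by blast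
  define D where "D = 1 + (\<Sum>n. A k n / A m n)"
  have nn: "0 \<le> A k n / A m n" for n using Apos[of k n] Apos[of m n] by simp
  have D: "0 < D" using suminf_nonneg[OF m nn] by (simp add: D_def)
  have "q k x \<le> D * M" if x: "x \<in> kothe A" and M: "\<And>n. norm (x n) * A m n \<le> M" for x :: "nat \<Rightarrow> 'a" and M
  proof -
    have M0: "0 \<le> M" using M[of 0] Apos[of m 0] by (smt (verit) mult_nonneg_nonneg norm_ge_zero)
    have s: "summable (\<lambda>n. A k n / A m n * M)" by (rule summable_mult2[OF m])
    have "q k x \<le> (\<Sum>n. A k n / A m n * M)"
      unfolding kothe_norm_def
    proof (rule suminf_le[OF _ _ s])
      fix n
      have "A k n / A m n * (norm (x n) * A m n) \<le> A k n / A m n * M" by (rule mult_left_mono[OF M nn])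
      then show "norm (x n) * A k n \<le> A k n / A m n * M" using Apos[of m n] by (simp add: mult.commute)
    qed (use x in \<open>simp add: kothe_def\<close>)
    also have "\<dots> = (\<Sum>n. A k n / A m n) * M" by (rule suminf_mult2[OF m, symmetric])
    also have "\<dots> \<le> D * M" using M0 by (intro mult_right_mono) (auto simp: D_def)
    finally show ?thesis .
  qed
  then show ?thesis using D by blast
qed

text \<open>The next norm is chosen so large that (DN), nuclearity, continuity and openness all hold with
  constant 1.\<close>

definition step :: "nat \<Rightarrow> real \<Rightarrow> nat \<Rightarrow> real \<Rightarrow> bool" where
  "step r C r' C' \<longleftrightarrow> r < r' \<and> C \<le> C' \<and> (\<forall>n. (C * A r n)\<^sup>2 \<le> C' * A r' n * A p n) \<and>
    (\<forall>y. (\<Sum>n<y. (C * A r n / (C' * A r' n))\<^sup>2) \<le> 1) \<and>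
    (\<forall>\<xi>\<in>kothe A. \<forall>M. (\<forall>n. norm (\<xi> n) * (C' * A r' n) \<le> M) \<longrightarrow> (\<forall>n. norm (T \<xi> n) * (C * A r n) \<le> M)) \<and>
    (\<forall>x\<in>F. \<forall>M. (\<forall>n. norm (x n) * (C' * A r' n) \<le> M) \<longrightarrow>
      (\<exists>\<xi>\<in>kothe A. T \<xi> = x \<and> (\<forall>n. norm (\<xi> n) * (C * A r n) \<le> M)))"

lemma step_exists:
  assumes C: "0 < C"
  shows "\<exists>r' C'. 0 < C' \<and> step r C r' C'"
proof -
  obtain r1 C1 where 1: "0 < C1" "\<And>n. (A r n)\<^sup>2 \<le> C1 * A p n * A r1 n" using d1 by blast
  obtain r2 D2 where 2: "1 \<le> D2" "\<And>s C C' y. r2 \<le> s \<Longrightarrow> 0 < C \<Longrightarrow> C * D2 \<le> C' \<Longrightarrow> (\<Sum>n<y. (C * A r n / (C' * A s n))\<^sup>2) \<le> 1"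
    using nuclear_squares[of r] by blast
  obtain m3 C3 where 3: "0 < C3" "\<And>x. x \<in> kothe A \<Longrightarrow> q r (T x) \<le> C3 * q m3 x"
    using continuous_kothe_bounded[OF A lin cont, of r] by blast
  obtain r3 D3 where h3: "0 < D3" "\<And>x M. x \<in> kothe A \<Longrightarrow> (\<And>n. norm (x n :: 'a) * A r3 n \<le> M) \<Longrightarrow> q m3 x \<le> D3 * M"
    using kothe_norm_le_sup[of m3] by blast
  obtain m4 C4 where 4: "0 < C4" "\<And>z. z \<in> F \<Longrightarrow> \<exists>\<xi>\<in>kothe A. T \<xi> = z \<and> q r \<xi> \<le> C4 * q m4 z"
    using open_mapping[of r] by blast
  obtain r4 D4 where h4: "0 < D4" "\<And>x M. x \<in> kothe A \<Longrightarrow> (\<And>n. norm (x n :: 'a) * A r4 n \<le> M) \<Longrightarrow> q m4 x \<le> D4 * M"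
    using kothe_norm_le_sup[of m4] by blast
  \<comment> \<open>Every clause of \<open>step\<close> is preserved when \<open>r'\<close> and
    \<open>C'\<close> grow, so maxima satisfy all of them at once.\<close>
  define r' where "r' = Max {Suc r, r1, r2, r3, r4}"
  have r': "r < r'" "r1 \<le> r'" "r2 \<le> r'" "r3 \<le> r'" "r4 \<le> r'" unfolding Suc_le_eq[symmetric] by (auto simp: r'_def)
  define C' where "C' = Max {C, C\<^sup>2 * C1, C * D2, C * (C3 * D3), C * (C4 * D4)}"
  have C': "C \<le> C'" "C\<^sup>2 * C1 \<le> C'" "C * D2 \<le> C'" "C * (C3 * D3) \<le> C'" "C * (C4 * D4) \<le> C'"
    by (auto simp: C'_def)
  have C'0: "0 < C'" using C C'(1) by linarith
  have sup: "norm (x n) * A s n \<le> M / C'" if "\<And>n. norm (x n :: 'a) * (C' * A r' n) \<le> M" "s \<le> r'" for x M s n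
  proof -
    have "C' * (norm (x n) * A s n) \<le> C' * (norm (x n) * A r' n)"
      using A_mono[OF that(2), of n] C'0 by (intro mult_left_mono) auto
    also have "\<dots> \<le> M" using that(1)[of n] by (simp add: mult_ac)
    finally show ?thesis using C'0 by (simp add: pos_le_divide_eq mult.commute)
  qed
  have fin: "C * (E * (M / C')) \<le> M" if "0 \<le> M" "C * E \<le> C'" for E M
  proof -
    have "(C * E) * (M / C') \<le> C' * (M / C')" using that C'0 by (intro mult_right_mono) auto
    then show ?thesis using C'0 by (simp add: mult.assoc)
  qed
  have M0: "0 \<le> M" if "\<And>n. norm (x n :: 'a) * (C' * A r' n) \<le> M" for x M
    using that[of 0] C'0 Apos[of r' 0] by (smt (verit) mult_nonneg_nonneg norm_ge_zero)
  have "step r C r' C'"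
    unfolding step_def
  proof (intro conjI allI ballI impI)
    fix n
    have "(C * A r n)\<^sup>2 = C\<^sup>2 * (A r n)\<^sup>2" by (simp add: power_mult_distrib)
    also have "\<dots> \<le> C\<^sup>2 * (C1 * A p n * A r1 n)" using 1 by (intro mult_left_mono) auto
    also have "\<dots> = (C\<^sup>2 * C1) * A r1 n * A p n" by simp
    also have "\<dots> \<le> C' * A r' n * A p n"
      using C' A_mono[OF r'(2), of n] Apos[of r1 n] Apos[of p n] C'0 by (intro mult_right_mono mult_mono) auto
    finally show "(C * A r n)\<^sup>2 \<le> C' * A r' n * A p n" .
  next
    show "(\<Sum>n<y. (C * A r n / (C' * A r' n))\<^sup>2) \<le> 1" for y by (rule 2(2)[OF r'(3) C C'(3)])
  next
    fix \<xi> :: "nat \<Rightarrow> 'a" and M n assume \<xi>: "\<xi> \<in> kothe A" and M: "\<forall>n. norm (\<xi> n) * (C' * A r' n) \<le> M"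
    have "norm (T \<xi> n) * A r n \<le> q r (T \<xi>)" using \<xi> F_kothe F_T by (intro kothe_norm_coord[OF A]) blast
    also have "\<dots> \<le> C3 * q m3 \<xi>" by (rule 3(2)[OF \<xi>])
    also have "\<dots> \<le> C3 * (D3 * (M / C'))" using 3(1) M r' by (intro mult_left_mono h3(2)[OF \<xi>] sup) auto
    finally have "norm (T \<xi> n) * A r n \<le> C3 * (D3 * (M / C'))" .
    from mult_left_mono[OF this less_imp_le[OF C]]
    have "C * (norm (T \<xi> n) * A r n) \<le> C * ((C3 * D3) * (M / C'))" by (simp only: mult.assoc)
    also have "\<dots> \<le> M" using M0 M C' by (intro fin) blast+
    finally show "norm (T \<xi> n) * (C * A r n) \<le> M" by (simp add: mult_ac)
  next
    fix x :: "nat \<Rightarrow> 'a" and M assume x: "x \<in> F" and M: "\<forall>n. norm (x n) * (C' * A r' n) \<le> M"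
    obtain \<xi> where \<xi>: "\<xi> \<in> kothe A" "T \<xi> = x" "q r \<xi> \<le> C4 * q m4 x" using 4(2)[OF x] by blast
    have "norm (\<xi> n) * (C * A r n) \<le> M" for n
    proof -
      have "norm (\<xi> n) * A r n \<le> q r \<xi>" by (rule kothe_norm_coord[OF A \<xi>(1)])
      also have "\<dots> \<le> C4 * (D4 * (M / C'))"
        using \<xi>(3) mult_left_mono[OF h4(2)[OF F_kothe[OF x] sup[of x M r4]], of C4] 4(1) M r' by fastforce
      finally have "norm (\<xi> n) * A r n \<le> C4 * (D4 * (M / C'))" .
      from mult_left_mono[OF this less_imp_le[OF C]]
      have "C * (norm (\<xi> n) * A r n) \<le> C * ((C4 * D4) * (M / C'))" by (simp only: mult.assoc)
      also have "\<dots> \<le> M" using M0 M C' by (intro fin) blast+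
      finally show ?thesis by (simp add: mult_ac)
    qed
    then show "\<exists>\<xi>\<in>kothe A. T \<xi> = x \<and> (\<forall>n. norm (\<xi> n) * (C * A r n) \<le> M)" using \<xi> by blast
  qed (use r' C' in auto)
  then show ?thesis using C'0 by blast
qed

lemma step_sequence:
  "\<exists>\<rho> C. p \<le> \<rho> 0 \<and> 2 \<le> C 0 \<and> (\<forall>y. (\<Sum>n<y. (A p n / (C 0 * A (\<rho> 0) n))\<^sup>2) \<le> 1) \<and>
    (\<forall>k. step (\<rho> k) (C k) (\<rho> (Suc k)) (C (Suc k)))"
proof -
  obtain m D where D: "1 \<le> D" "\<And>r C C' y. m \<le> r \<Longrightarrow> 0 < C \<Longrightarrow> C * D \<le> C' \<Longrightarrow> (\<Sum>n<y. (C * A p n / (C' * A r n))\<^sup>2) \<le> 1"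
    using nuclear_squares[of p] by blast
  \<comment> \<open>The 2 keeps all quotients \<open>b\<close> at 2 or above; \<open>m\<close> and
    \<open>D\<close> let the first sup norm dominate the Hilbert norm with weights
    \<open>A p\<close>.\<close>
  let ?s = "(max p m, 2 + D)"
  have "\<exists>f. \<forall>k. (0 < snd (f k) \<and> (k = 0 \<longrightarrow> f k = ?s)) \<and> step (fst (f k)) (snd (f k)) (fst (f (Suc k))) (snd (f (Suc k)))"
  proof (rule dependent_nat_choice)
    show "\<exists>x. 0 < snd x \<and> ((0::nat) = 0 \<longrightarrow> x = ?s)" using D by (intro exI[of _ ?s]) auto
    fix x :: "nat \<times> real" and k :: nat assume "0 < snd x \<and> (k = 0 \<longrightarrow> x = ?s)"
    then show "\<exists>y. (0 < snd y \<and> (Suc k = 0 \<longrightarrow> y = ?s)) \<and> step (fst x) (snd x) (fst y) (snd y)"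
      using step_exists[of "snd x" "fst x"] by auto
  qed
  then obtain f where f: "f 0 = ?s" "\<And>k. step (fst (f k)) (snd (f k)) (fst (f (Suc k))) (snd (f (Suc k)))" by blast
  have "(\<Sum>n<y. (A p n / ((2 + D) * A (max p m) n))\<^sup>2) \<le> 1" for y using D(2)[of "max p m" 1 "2 + D" y] by simp
  then show ?thesis using f D(1) by (intro exI[of _ "\<lambda>k. fst (f k)"] exI[of _ "\<lambda>k. snd (f k)"]) auto
qed

end

section \<open>Weights and norms of the chosen sequence\<close>

locale kothe_steps = kothe_range +
  fixes \<rho> :: "nat \<Rightarrow> nat" and C :: "nat \<Rightarrow> real"
  assumes \<rho>0: "p \<le> \<rho> 0" and C0: "2 \<le> C 0" and sq0: "(\<Sum>n<y. (A p n / (C 0 * A (\<rho> 0) n))\<^sup>2) \<le> 1"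
    and st: "step (\<rho> k) (C k) (\<rho> (Suc k)) (C (Suc k))"
begin

text \<open>\<open>e\<close> weights the Hilbert norm, which stands for the dominating norm of (DN),
  and \<open>w k\<close> weights the sup norm \<open>N k\<close>. The abstract argument sees these
  weights through their quotient \<open>b k\<close>.\<close>

definition e :: "nat \<Rightarrow> real" where "e = A p"
definition w :: "nat \<Rightarrow> nat \<Rightarrow> real" where "w k n = C k * A (\<rho> k) n"
definition b :: "nat \<Rightarrow> nat \<Rightarrow> real" where "b k n = w k n / e n"
definition N :: "nat \<Rightarrow> (nat \<Rightarrow> 'a) \<Rightarrow> real" where "N k x = (SUP n. norm (x n) * w k n)"
definition ip :: "(nat \<Rightarrow> 'a) \<Rightarrow> (nat \<Rightarrow> 'a) \<Rightarrow> 'a" where "ip x y = (\<Sum>n. x n * cj (y n) * of_real ((e n)\<^sup>2))"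

lemma \<rho>_Suc: "\<rho> k \<le> \<rho> (Suc k)" and C_Suc: "C k \<le> C (Suc k)"
  using st[of k] by (simp_all add: step_def)

lemma \<rho>_ge: "k \<le> \<rho> k"
proof (induction k)
  case (Suc k)
  then show ?case using st[of k] by (simp add: step_def)
qed simp

lemma \<rho>_mono: "k \<le> m \<Longrightarrow> \<rho> k \<le> \<rho> m" by (rule lift_Suc_mono_le[of \<rho>, OF \<rho>_Suc])

lemma C2: "2 \<le> C k"
  using lift_Suc_mono_le[of C 0 k, OF C_Suc] C0 by simp

lemma epos: "0 < e n" by (simp add: e_def Apos)
lemma wpos: "0 < w k n" using C2[of k] Apos[of "\<rho> k" n] by (simp add: w_def)

lemma b_ge2: "2 \<le> b k n"
proof -
  have "e n \<le> A (\<rho> k) n" unfolding e_def using \<rho>0 \<rho>_mono[of 0 k] by (intro A_mono) simp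
  then have "2 * e n \<le> w k n" unfolding w_def using C2[of k] epos[of n] by (intro mult_mono) auto
  then show ?thesis using epos[of n] by (simp add: b_def pos_le_divide_eq)
qed

text \<open>This is regularity between the indices \<open>p\<close> and \<open>\<rho> k\<close>; it
  needs \<open>p \<le> \<rho> k\<close>.\<close>

lemma b_Suc: "b k n \<le> b k (Suc n)"
proof -
  have p: "p \<le> \<rho> k" using \<rho>0 \<rho>_mono[of 0 k] by simp
  have "A p (Suc n) / A (\<rho> k) (Suc n) \<le> A p n / A (\<rho> k) n" by (rule ratio_mono[OF A reg p]) simp
  then have "A (\<rho> k) n / A p n \<le> A (\<rho> k) (Suc n) / A p (Suc n)"
    using Apos by (simp add: divide_simps mult.commute)
  then have "C k * (A (\<rho> k) n / A p n) \<le> C k * (A (\<rho> k) (Suc n) / A p (Suc n))" using C2[of k] by (intro mult_left_mono) auto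
  then show ?thesis by (simp add: b_def w_def e_def)
qed

lemma b_sq: "(b k n)\<^sup>2 \<le> b (Suc k) n"
proof -
  have "(w k n)\<^sup>2 \<le> w (Suc k) n * e n" using st[of k] by (simp add: step_def w_def e_def)
  then have "(w k n)\<^sup>2 / (e n)\<^sup>2 \<le> (w (Suc k) n * e n) / (e n)\<^sup>2" by (intro divide_right_mono) auto
  then show ?thesis using epos[of n] by (simp add: b_def power_divide power2_eq_square)
qed

text \<open>The squares of \<open>1 / b 0 n\<close> are summable by nuclearity, hence tend to
  0.\<close>

lemma b_unb: "\<exists>n. c < b 0 n"
proof -
  have s: "(\<Sum>n<y. (1 / b 0 n)\<^sup>2) \<le> 1" for y using sq0[of y] by (simp add: b_def w_def e_def)
  have "summable (\<lambda>n. (1 / b 0 n)\<^sup>2)" by (rule summableI_nonneg_bounded[OF _ s]) simp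
  then have "(\<lambda>n. (1 / b 0 n)\<^sup>2) \<longlonglongrightarrow> 0" by (rule summable_LIMSEQ_zero)
  moreover have "0 < (1 / (\<bar>c\<bar> + 1))\<^sup>2" by simp
  ultimately have "\<forall>\<^sub>F n in sequentially. (1 / b 0 n)\<^sup>2 < (1 / (\<bar>c\<bar> + 1))\<^sup>2" by (rule order_tendstoD(2))
  then obtain n where "(1 / b 0 n)\<^sup>2 < (1 / (\<bar>c\<bar> + 1))\<^sup>2" by (auto simp: eventually_sequentially)
  then have "1 / b 0 n < 1 / (\<bar>c\<bar> + 1)" by (rule power2_less_imp_less) simp
  then have "\<bar>c\<bar> + 1 < b 0 n" using b_ge2[of 0 n] by (simp add: field_simps)
  then show ?thesis by (intro exI[of _ n]) linarith
qed

lemma w_ratio: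
  assumes km: "k \<le> m" and n: "n \<le> n'"
  shows "w k n' / w m n' \<le> w k n / w m n"
proof -
  have "A (\<rho> k) n' / A (\<rho> m) n' \<le> A (\<rho> k) n / A (\<rho> m) n" by (rule ratio_mono[OF A reg \<rho>_mono[OF km] n])
  then have "(C k / C m) * (A (\<rho> k) n' / A (\<rho> m) n') \<le> (C k / C m) * (A (\<rho> k) n / A (\<rho> m) n)"
    using C2[of k] C2[of m] by (intro mult_left_mono) auto
  then show ?thesis by (simp add: w_def)
qed

lemma N_upper:
  assumes x: "x \<in> kothe A"
  shows "norm (x n) * w k n \<le> N k x"
  unfolding N_def
proof (rule cSUP_upper)
  have "norm (x n) * w k n \<le> C k * q (\<rho> k) x" for n
    using mult_left_mono[OF kothe_norm_coord[OF A x, of n "\<rho> k"], of "C k"] C2[of k] by (simp add: w_def mult_ac)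
  then show "bdd_above (range (\<lambda>n. norm (x n) * w k n))" by (auto simp: bdd_above_def)
qed simp

lemma N_le: "(\<And>n. norm (x n) * w k n \<le> M) \<Longrightarrow> N k x \<le> M"
  unfolding N_def by (rule cSUP_least) auto

lemma N_le_q: "x \<in> kothe A \<Longrightarrow> N k x \<le> C k * q (\<rho> k) x"
  using mult_left_mono[OF kothe_norm_coord[OF A, of x _ "\<rho> k"], of "C k"] C2[of k]
  by (intro N_le) (simp add: w_def mult_ac)

lemma N_nonneg: "x \<in> kothe A \<Longrightarrow> 0 \<le> N k x"
  using N_upper[of x 0 k] wpos[of k 0] by (smt (verit) mult_nonneg_nonneg norm_ge_zero)

lemma N_add:
  assumes "x \<in> kothe A" "y \<in> kothe A"
  shows "N k (x + y) \<le> N k x + N k y"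
proof (rule N_le)
  fix n
  have "norm ((x + y) n) * w k n \<le> (norm (x n) + norm (y n)) * w k n"
    using wpos[of k n] norm_triangle_ineq[of "x n" "y n"] by (intro mult_right_mono) auto
  also have "\<dots> \<le> N k x + N k y" using N_upper[OF assms(1), of n k] N_upper[OF assms(2), of n k] by (simp add: distrib_right)
  finally show "norm ((x + y) n) * w k n \<le> N k x + N k y" .
qed

lemma N_scale:
  assumes x: "x \<in> kothe A"
  shows "N k (scale_seq c x) = norm c * N k x"
proof -
  have le: "N k (scale_seq c x) \<le> norm c * N k x" if "x \<in> kothe A" for c x
    using mult_left_mono[OF N_upper[OF that, of _ k], of "norm c"]
    by (intro N_le) (simp add: scale_seq_def norm_mult mult.assoc)
  show ?thesis
  proof (cases "c = 0")
    case True
    then show ?thesis using le[OF x, of 0] N_nonneg[OF kothe_scale[OF x], of k 0] by simp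
  next
    case False
    have "scale_seq (inverse c) (scale_seq c x) = x" using False by (auto simp: scale_seq_def)
    then have "N k x \<le> norm (inverse c) * N k (scale_seq c x)" using le[OF kothe_scale[OF x], of "inverse c" c] by simp
    then have "norm c * N k x \<le> N k (scale_seq c x)" using False by (simp add: norm_inverse norm_divide field_simps)
    then show ?thesis using le[OF x, of c] by simp
  qed
qed

lemma wE: "w k n = e n * b k n" using epos[of n] by (simp add: b_def)

lemma ip_abs_summable:
  assumes x: "x \<in> kothe A" and y: "y \<in> kothe A"
  shows "summable (\<lambda>n. norm (x n * cj (y n) * of_real ((e n)\<^sup>2)))"
proof (rule summable_comparison_test')
  show "summable (\<lambda>n. q p y * (norm (x n) * e n))" using x by (intro summable_mult) (simp add: kothe_def e_def)
  fix n
  have "norm (y n) * e n \<le> q p y" unfolding e_def by (rule kothe_norm_coord[OF A y])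
  then have "(norm (y n) * e n) * (norm (x n) * e n) \<le> q p y * (norm (x n) * e n)"
    using epos[of n] by (intro mult_right_mono) auto
  then show "norm (norm (x n * cj (y n) * of_real ((e n)\<^sup>2))) \<le> q p y * (norm (x n) * e n)"
    using epos[of n] by (simp add: norm_mult power2_eq_square mult_ac del: of_real_power)
qed

lemmas ip_summable = summable_norm_cancel[OF ip_abs_summable]

lemma ip_self: "ip x x = (\<Sum>n. of_real ((norm (x n) * e n)\<^sup>2))"
  unfolding ip_def mult_cj by (simp add: power_mult_distrib)

lemma sq_summable:
  assumes x: "(x :: nat \<Rightarrow> 'a) \<in> kothe A"
  shows "summable (\<lambda>n. (norm (x n) * e n)\<^sup>2)"
  using ip_abs_summable[OF x x] epos
  by (simp add: norm_mult power_mult_distrib power2_eq_square mult_ac del: of_real_power)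

lemma ip_self': "x \<in> kothe A \<Longrightarrow> ip x x = of_real (\<Sum>n. (norm (x n) * e n)\<^sup>2)"
  unfolding ip_self by (rule suminf_of_real[OF sq_summable, symmetric])

lemma cj_suminf:
  assumes "summable f"
  shows "cj (\<Sum>n. f n) = (\<Sum>n. cj (f n))"
proof -
  have "isCont cj (\<Sum>n. f n)" using continuous_on_cj[of UNIV] by (simp add: continuous_on_eq_continuous_at)
  then have "(\<lambda>m. cj (\<Sum>n<m. f n)) \<longlonglongrightarrow> cj (\<Sum>n. f n)"
    by (rule isCont_tendsto_compose[OF _ summable_LIMSEQ[OF assms]])
  then have "(\<lambda>n. cj (f n)) sums cj (\<Sum>n. f n)" unfolding cj_sum sums_def .
  then show ?thesis by (rule sums_unique)
qed

definition u :: "nat \<Rightarrow> nat \<Rightarrow> 'a" where "u n = T (scale_seq (inverse (of_real (e n))) (unit_seq n))"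

definition trunc :: "nat \<Rightarrow> (nat \<Rightarrow> 'a) \<Rightarrow> nat \<Rightarrow> 'a" where
  "trunc y c = (\<lambda>n. if n \<le> y then c n * inverse (of_real (e n)) else 0)"

lemma T_sum: "(\<And>i. i \<in> I \<Longrightarrow> f i \<in> kothe A) \<Longrightarrow> T (sum f I) = (\<Sum>i\<in>I. T (f i))"
proof (induction I rule: infinite_finite_induct)
  case (insert i I)
  have V: "f i \<in> kothe A" "sum f I \<in> kothe A" using insert by (auto intro: kothe_sum A)
  have IH: "T (sum f I) = (\<Sum>i\<in>I. T (f i))" using insert by blast
  show ?case unfolding sum.insert[OF insert(1,2)] IH[symmetric] by (rule T_add[OF V])
qed (simp_all add: T_0)

lemma trunc_sum: "trunc y c = (\<Sum>n\<le>y. scale_seq (c n) (scale_seq (inverse (of_real (e n))) (unit_seq n)))"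
proof
  fix i
  have "(\<Sum>n\<le>y. scale_seq (c n) (scale_seq (inverse (of_real (e n))) (unit_seq n))) i
      = (\<Sum>n\<le>y. if n = i then c n * inverse (of_real (e n)) else 0)"
    unfolding sum_fun_apply by (intro sum.cong) (auto simp: scale_seq_def unit_seq_def)
  then show "trunc y c i = (\<Sum>n\<le>y. scale_seq (c n) (scale_seq (inverse (of_real (e n))) (unit_seq n))) i"
    by (simp add: trunc_def)
qed

lemma trunc_kothe: "trunc y c \<in> kothe A"
  unfolding trunc_sum by (intro kothe_sum A kothe_scale unit_seq_kothe)

lemma T_trunc: "T (trunc y c) = (\<Sum>n\<le>y. scale_seq (c n) (u n))"
  unfolding trunc_sum u_def by (subst T_sum) (auto simp: kothe_scale unit_seq_kothe T_scale)

lemma N_T: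
  assumes "\<xi> \<in> kothe A" "\<And>n. norm (\<xi> n) * w (Suc k) n \<le> M"
  shows "N k (T \<xi>) \<le> M"
proof (rule N_le)
  fix n
  have "\<forall>\<xi>\<in>kothe A. \<forall>M. (\<forall>n. norm (\<xi> n) * w (Suc k) n \<le> M) \<longrightarrow> (\<forall>n. norm (T \<xi> n) * w k n \<le> M)"
    using st[of k] unfolding step_def w_def by blast
  then show "norm (T \<xi> n) * w k n \<le> M" using assms by blast
qed

lemma N_lift:
  assumes x: "x \<in> F"
  shows "\<exists>\<xi>\<in>kothe A. T \<xi> = x \<and> (\<forall>n. norm (\<xi> n) * w k n \<le> N (Suc k) x)"
proof -
  have "\<forall>x\<in>F. \<forall>M. (\<forall>n. norm (x n) * w (Suc k) n \<le> M) \<longrightarrow> (\<exists>\<xi>\<in>kothe A. T \<xi> = x \<and> (\<forall>n. norm (\<xi> n) * w k n \<le> M))"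
    using st[of k] unfolding step_def w_def by blast
  then show ?thesis using x N_upper[OF F_kothe[OF x]] by blast
qed

sublocale I: ips cj scale_seq F ip
proof -
  interpret vs: vector_space "scale_seq :: 'a \<Rightarrow> _" by (rule vector_space_scale_seq)
  show "ips cj scale_seq F ip"
  proof unfold_locales
    show "vs.subspace F"
      unfolding vs.subspace_def using F_add F_scale F_T[OF kothe_zero] T_0 by simp
    fix x y z :: "nat \<Rightarrow> 'a" and c
    show "ip (x + y) z = ip x z + ip y z" if "x \<in> F" "y \<in> F" "z \<in> F"
      unfolding ip_def using suminf_add[OF ip_summable ip_summable, of x z y z] that F_kothe by (simp add: distrib_right)
    show "ip (scale_seq c x) z = c * ip x z" if "x \<in> F" "z \<in> F"
      unfolding ip_def scale_seq_def using suminf_mult[OF ip_summable, of x z c] that F_kothe by (simp add: mult.assoc)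
    show "ip y x = cj (ip x y)" if "x \<in> F" "y \<in> F"
    proof -
      have "cj (ip x y) = (\<Sum>n. cj (x n * cj (y n) * of_real ((e n)\<^sup>2)))"
        unfolding ip_def by (rule cj_suminf[OF ip_summable]) (use that F_kothe in auto)
      also have "\<dots> = ip y x" unfolding ip_def by (simp add: cj_mult cj_cj cj_of_real mult_ac del: of_real_power)
      finally show ?thesis ..
    qed
    show "\<exists>r\<ge>0. ip x x = of_real r" if "x \<in> F"
      using ip_self'[OF F_kothe[OF that]] suminf_nonneg[OF sq_summable[OF F_kothe[OF that]]] by auto
    show "x = 0" if x: "x \<in> F" "ip x x = 0"
    proof
      fix n
      note s = sq_summable[OF F_kothe[OF x(1)]]
      have "(\<Sum>n. (norm (x n) * e n)\<^sup>2) = 0" using x(2) ip_self'[OF F_kothe[OF x(1)]] by (simp del: of_real_power)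
      then have "(norm (x n) * e n)\<^sup>2 = 0" using suminf_eq_zero_iff[OF s] by simp
      then show "x n = 0 n" using epos[of n] by simp
    qed
  qed
qed

lemma n0_sq: "x \<in> F \<Longrightarrow> (I.n0 x)\<^sup>2 = (\<Sum>n. (norm (x n) * e n)\<^sup>2)"
  by (rule I.n0_eqI) (simp_all add: ip_self' F_kothe)

lemma n0_coord:
  assumes x: "x \<in> F"
  shows "norm (x n) * e n \<le> I.n0 x"
proof (rule power2_le_imp_le)
  have "(\<Sum>n\<in>{n}. (norm (x n) * e n)\<^sup>2) \<le> (I.n0 x)\<^sup>2"
    unfolding n0_sq[OF x] by (intro sum_le_suminf sq_summable F_kothe x) auto
  then show "(norm (x n) * e n)\<^sup>2 \<le> (I.n0 x)\<^sup>2" by simp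
qed simp

lemma N_Suc: "x \<in> kothe A \<Longrightarrow> N k x \<le> N (Suc k) x"
proof (rule N_le)
  fix n assume x: "x \<in> kothe A"
  have "w k n \<le> w (Suc k) n" unfolding w_def
    using C_Suc[of k] C2[of k] A_mono[OF \<rho>_Suc, of k n] Apos[of "\<rho> k" n] by (intro mult_mono) auto
  then have "norm (x n) * w k n \<le> norm (x n) * w (Suc k) n" by (intro mult_left_mono) auto
  then show "norm (x n) * w k n \<le> N (Suc k) x" using N_upper[OF x, of n "Suc k"] by linarith
qed

lemma n0_le_N: "x \<in> F \<Longrightarrow> I.n0 x \<le> N k x"
proof -
  assume x: "x \<in> F"
  note xA = F_kothe[OF x]
  have "I.n0 x \<le> N 0 x"
  proof (rule power2_le_imp_le)
    show "0 \<le> N 0 x" by (rule N_nonneg[OF xA])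
    show "(I.n0 x)\<^sup>2 \<le> (N 0 x)\<^sup>2"
      unfolding n0_sq[OF x]
    proof (rule suminf_le_const[OF sq_summable[OF xA]])
      fix y
      have "(\<Sum>n<y. (norm (x n) * e n)\<^sup>2) = (\<Sum>n<y. (norm (x n) * w 0 n)\<^sup>2 * (e n / w 0 n)\<^sup>2)"
        using wpos by (intro sum.cong) (simp_all add: power_mult_distrib power_divide less_imp_neq[symmetric])
      also have "\<dots> \<le> (\<Sum>n<y. (N 0 x)\<^sup>2 * (e n / w 0 n)\<^sup>2)"
        using N_upper[OF xA] wpos by (intro sum_mono mult_right_mono power_mono) (auto simp: less_imp_le)
      also have "\<dots> \<le> (N 0 x)\<^sup>2 * 1"
        unfolding sum_distrib_left[symmetric] using sq0[of y] by (intro mult_left_mono) (simp_all add: e_def w_def)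
      finally show "(\<Sum>n<y. (norm (x n) * e n)\<^sup>2) \<le> (N 0 x)\<^sup>2" by simp
    qed
  qed
  also have "\<dots> \<le> N k x" using lift_Suc_mono_le[of "\<lambda>k. N k x" 0 k] N_Suc[OF xA] by simp
  finally show ?thesis .
qed

sublocale K: lifts cj scale_seq F ip N b u
proof unfold_locales
  fix x y :: "nat \<Rightarrow> 'a" and k :: nat and c
  show "0 \<le> N k x" if "x \<in> F" by (rule N_nonneg[OF F_kothe[OF that]])
  show "N k (x + y) \<le> N k x + N k y" if "x \<in> F" "y \<in> F" using that by (intro N_add F_kothe)
  show "N k (scale_seq c x) = norm c * N k x" if "x \<in> F" by (rule N_scale[OF F_kothe[OF that]])
  show "N k x \<le> N (Suc k) x" if "x \<in> F" by (rule N_Suc[OF F_kothe[OF that]])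
  show "I.n0 x \<le> N k x" if "x \<in> F" by (rule n0_le_N[OF that])
  show "(N k x)\<^sup>2 \<le> I.n0 x * N (Suc k) x" if x: "x \<in> F"
  proof -
    have nn: "0 \<le> I.n0 x * N (Suc k) x" using N_nonneg[OF F_kothe[OF x]] by simp
    have "N k x \<le> sqrt (I.n0 x * N (Suc k) x)"
    proof (rule N_le, rule real_le_rsqrt)
      fix n
      have "(norm (x n) * w k n)\<^sup>2 = (norm (x n) * e n) * (norm (x n) * (e n * (b k n)\<^sup>2))"
        unfolding wE by (simp add: power2_eq_square mult_ac)
      also have "\<dots> \<le> I.n0 x * (norm (x n) * (e n * b (Suc k) n))"
        using n0_coord[OF x, of n] b_sq[of k n] epos[of n] by (intro mult_mono mult_left_mono) auto
      also have "\<dots> \<le> I.n0 x * N (Suc k) x"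
        using N_upper[OF F_kothe[OF x], of n "Suc k"] unfolding wE by (intro mult_left_mono) auto
      finally show "(norm (x n) * w k n)\<^sup>2 \<le> I.n0 x * N (Suc k) x" .
    qed
    then have "(N k x)\<^sup>2 \<le> (sqrt (I.n0 x * N (Suc k) x))\<^sup>2" using N_nonneg[OF F_kothe[OF x]] by (rule power_mono)
    then show ?thesis using nn by simp
  qed
next
  fix k n show "2 \<le> b k n" by (rule b_ge2)
  show "b k n \<le> b k (Suc n)" by (rule b_Suc)
  show "(b k n)\<^sup>2 \<le> b (Suc k) n" by (rule b_sq)
  show "u n \<in> F" unfolding u_def by (intro F_T kothe_scale unit_seq_kothe)
next
  fix c show "\<exists>n. c < b 0 n" by (rule b_unb)
next
  fix x :: "nat \<Rightarrow> 'a" and k m z :: nat assume x: "x \<in> F" and km: "k \<le> m"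
  have bp: "0 < b k n" for k n using b_ge2[of k n] by linarith
  have bw: "b k n / b m n = w k n / w m n" for n using epos[of n] by (simp add: b_def)
  have pos: "0 \<le> b k z * I.n0 x" "0 \<le> b k (Suc z) / b m (Suc z) * N m x"
    using bp[of k z] bp[of k "Suc z"] bp[of m "Suc z"] N_nonneg[OF F_kothe[OF x], of m] by simp_all
  \<comment> \<open>Coordinates up to \<open>z\<close> are estimated by the Hilbert norm, the others
    by the norm \<open>m\<close>: beyond \<open>z\<close>, regularity makes the quotient of the
    weights largest at \<open>Suc z\<close>.\<close>
  show "N k x \<le> b k z * I.n0 x + b k (Suc z) / b m (Suc z) * N m x"
  proof (rule N_le)
    fix n
    show "norm (x n) * w k n \<le> b k z * I.n0 x + b k (Suc z) / b m (Suc z) * N m x"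
    proof (cases "n \<le> z")
      case True
      have "norm (x n) * w k n = b k n * (norm (x n) * e n)" unfolding wE by simp
      also have "\<dots> \<le> b k z * I.n0 x"
        using lift_Suc_mono_le[of "b k", OF b_Suc True] n0_coord[OF x] bp epos[of n]
        by (intro mult_mono) (auto simp: less_imp_le)
      finally show ?thesis using pos by linarith
    next
      case False
      have "norm (x n) * w k n = (w k n / w m n) * (norm (x n) * w m n)" using wpos[of m n] by simp
      also have "\<dots> \<le> (w k (Suc z) / w m (Suc z)) * N m x"
        using w_ratio[OF km, of "Suc z" n] False N_upper[OF F_kothe[OF x]] wpos
        by (intro mult_mono) (auto simp: less_imp_le)
      finally show ?thesis unfolding bw using pos by linarith
    qed
  qed
next
  fix k y :: nat and c :: "nat \<Rightarrow> 'a"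
  let ?M = "sqrt (\<Sum>n\<le>y. (norm (c n) * b (Suc k) n)\<^sup>2)"
  have "N k (T (trunc y c)) \<le> ?M"
  proof (rule N_T[OF trunc_kothe])
    fix n
    show "norm (trunc y c n) * w (Suc k) n \<le> ?M"
    proof (cases "n \<le> y")
      case True
      then have "norm (trunc y c n) * w (Suc k) n = norm (c n) * b (Suc k) n"
        using epos[of n] by (simp add: trunc_def wE norm_mult norm_inverse)
      also have "\<dots> \<le> ?M"
        using True by (intro real_le_rsqrt member_le_sum[of n "{..y}" "\<lambda>n. (norm (c n) * b (Suc k) n)\<^sup>2"]) auto
      finally show ?thesis .
    qed (simp add: trunc_def sum_nonneg)
  qed
  then show "N k (\<Sum>n\<le>y. scale_seq (c n) (u n)) \<le> ?M" unfolding T_trunc .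
next
  fix x :: "nat \<Rightarrow> 'a" and k y :: nat assume x: "x \<in> F" and k: "1 \<le> k"
  have bp: "0 < b k n" for k n using b_ge2[of k n] by linarith
  let ?M = "N (Suc (Suc k)) x"
  have M: "0 \<le> ?M" "?M \<le> N (k + 3) x" using N_nonneg N_Suc[of x "Suc (Suc k)"] F_kothe[OF x] by (auto simp: eval_nat_numeral)
  obtain \<xi> where \<xi>: "\<xi> \<in> kothe A" "T \<xi> = x" "\<And>n. norm (\<xi> n) * w (Suc k) n \<le> ?M" using N_lift[OF x, of "Suc k"] by blast
  define c where "c = (\<lambda>n. \<xi> n * of_real (e n))"
  have tr: "trunc y c n = (if n \<le> y then \<xi> n else 0)" for n using epos[of n] by (simp add: trunc_def c_def)
  \<comment> \<open>The preimage is bounded in the sup norm of index \<open>Suc k\<close>; the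
    square-sum clause of \<open>step\<close> turns this into a Hilbert bound of index
    \<open>k\<close>.\<close>
  have "sqrt (\<Sum>n\<le>y. (norm (c n) * b k n)\<^sup>2) \<le> ?M"
  proof (rule real_le_lsqrt)
    have "(\<Sum>n\<le>y. (norm (c n) * b k n)\<^sup>2) \<le> (\<Sum>n\<le>y. ?M\<^sup>2 * (w k n / w (Suc k) n)\<^sup>2)"
    proof (rule sum_mono)
      fix n
      have eq: "norm (c n) * b k n = (norm (\<xi> n) * w (Suc k) n) * (w k n / w (Suc k) n)"
        using bp[of "Suc k" n] epos[of n] by (simp add: c_def wE norm_mult)
      have "(norm (c n) * b k n)\<^sup>2 = (norm (\<xi> n) * w (Suc k) n)\<^sup>2 * (w k n / w (Suc k) n)\<^sup>2"
        unfolding eq by (rule power_mult_distrib)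
      also have "\<dots> \<le> ?M\<^sup>2 * (w k n / w (Suc k) n)\<^sup>2"
        using \<xi>(3)[of n] wpos[of "Suc k" n] by (intro mult_right_mono power_mono) auto
      finally show "(norm (c n) * b k n)\<^sup>2 \<le> ?M\<^sup>2 * (w k n / w (Suc k) n)\<^sup>2" .
    qed
    also have "\<dots> \<le> ?M\<^sup>2 * 1"
      unfolding sum_distrib_left[symmetric]
    proof (rule mult_left_mono)
      have "(\<Sum>n<Suc y. (w k n / w (Suc k) n)\<^sup>2) \<le> 1" using st[of k] unfolding step_def w_def by blast
      then show "(\<Sum>n\<le>y. (w k n / w (Suc k) n)\<^sup>2) \<le> 1" unfolding lessThan_Suc_atMost .
    qed simp
    finally show "(\<Sum>n\<le>y. (norm (c n) * b k n)\<^sup>2) \<le> ?M\<^sup>2" by simp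
  qed (use M in \<open>auto intro: sum_nonneg\<close>)
  moreover have "b k (Suc y) * I.n0 (x - (\<Sum>n\<le>y. scale_seq (c n) (u n))) \<le> ?M"
  proof -
    let ?\<eta> = "\<xi> - trunc y c"
    have \<eta>: "?\<eta> \<in> kothe A" by (rule kothe_diff[OF A \<xi>(1) trunc_kothe])
    have "x - (\<Sum>n\<le>y. scale_seq (c n) (u n)) = T ?\<eta>"
      unfolding T_diff[OF \<xi>(1) trunc_kothe] T_trunc \<xi>(2) ..
    then have "I.n0 (x - (\<Sum>n\<le>y. scale_seq (c n) (u n))) \<le> N 0 (T ?\<eta>)" using n0_le_N[OF F_T[OF \<eta>], of 0] by simp
    also have "\<dots> \<le> ?M / b k (Suc y)"
    proof (rule N_T[OF \<eta>])
      fix n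
      show "norm (?\<eta> n) * w (Suc 0) n \<le> ?M / b k (Suc y)"
      proof (cases "n \<le> y")
        case True
        then show ?thesis using tr[of n] M bp[of k "Suc y"] by simp
      next
        case False
        \<comment> \<open>Beyond \<open>y\<close> the weight of index \<open>Suc k\<close> dominates
          the product of \<open>b k (Suc y)\<close> and the weight of index 1, the one that controls
          the image under \<open>T\<close> in \<open>n0\<close>. This is where
          \<open>1 \<le> k\<close> enters.\<close>
        have "b (Suc 0) n \<le> b k n" using k
        proof (induction rule: dec_induct)
          case (step m)
          have "b m n * 1 \<le> b m n * b m n" using b_ge2[of m n] by (intro mult_left_mono) auto
          then show ?case using step.IH b_sq[of m n] unfolding power2_eq_square by linarith
        qed simp
        then have "b (Suc 0) n * b k n \<le> b k n * b k n" using bp[of k n] by (intro mult_right_mono) auto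
        also have "\<dots> \<le> b (Suc k) n" using b_sq[of k n] by (simp add: power2_eq_square)
        finally have "b (Suc 0) n * b k n \<le> b (Suc k) n" .
        moreover have "b k (Suc y) \<le> b k n" using lift_Suc_mono_le[of "b k" "Suc y" n, OF b_Suc] False by simp
        then have "b (Suc 0) n * b k (Suc y) \<le> b (Suc 0) n * b k n" using bp[of "Suc 0" n] by (intro mult_left_mono) auto
        ultimately have "b (Suc 0) n * b k (Suc y) \<le> b (Suc k) n" by linarith
        then have "(norm (\<xi> n) * e n) * (b (Suc 0) n * b k (Suc y)) \<le> (norm (\<xi> n) * e n) * b (Suc k) n"
          using epos[of n] by (intro mult_left_mono) auto
        also have "\<dots> \<le> ?M" using \<xi>(3)[of n] unfolding wE by (simp add: mult_ac)
        finally have "(norm (\<xi> n) * w (Suc 0) n) * b k (Suc y) \<le> ?M" unfolding wE by (simp add: mult_ac)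
        then have "norm (\<xi> n) * w (Suc 0) n \<le> ?M / b k (Suc y)" using bp[of k "Suc y"] by (simp add: pos_le_divide_eq)
        then show ?thesis using False tr[of n] by simp
      qed
    qed
    finally show ?thesis using bp[of k "Suc y"] by (simp add: pos_le_divide_eq mult.commute)
  qed
  ultimately show "\<exists>c. sqrt (\<Sum>n\<le>y. (norm (c n) * b k n)\<^sup>2) \<le> N (k + 3) x \<and>
      b k (Suc y) * I.n0 (x - (\<Sum>n\<le>y. scale_seq (c n) (u n))) \<le> N (k + 3) x"
    using M(2) by (meson order_trans)
qed

subsection \<open>The basis of the range\<close>

text \<open>Convergence passes from the sup norms to the norms of the space by nuclearity. The
  coefficients are unique because the inner product with \<open>f m\<close> is continuous and reads
  off the coefficient \<open>m\<close> from every partial sum that contains it.\<close>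

theorem range_has_basis: "has_schauder_basis (subtopology (kothe_topology A) F)"
proof -
  obtain M :: enat and f where f: "\<And>j. enat j < M \<Longrightarrow> f j \<in> F"
    "\<And>i j. enat i < M \<Longrightarrow> enat j < M \<Longrightarrow> ip (f i) (f j) = (if i = j then 1 else 0)"
    "\<And>x k. x \<in> F \<Longrightarrow> (\<lambda>n. N k (x - (\<Sum>j<n. scale_seq (if enat j < M then ip x (f j) else 0) (f j)))) \<longlonglongrightarrow> 0"
    using K.basis_exists by blast
  let ?s = "\<lambda>c n. \<Sum>j<n. scale_seq (c j) (f j)"
  have sF: "?s c n \<in> F" if "\<And>j. M \<le> enat j \<Longrightarrow> c j = 0" for c n
  proof (rule I.V_sum)
    fix j
    show "scale_seq (c j) (f j) \<in> F"
    proof (cases "enat j < M")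
      case True
      then show ?thesis by (intro F_scale f)
    next
      case False
      then have "scale_seq (c j) (f j) = 0" using that[of j] by (auto simp: scale_seq_def)
      then show ?thesis by (simp only: I.V_0)
    qed
  qed
  have lim: "limitin (subtopology (kothe_topology A) F) (?s c) x sequentially \<longleftrightarrow>
      (\<forall>k. (\<lambda>n. q k (?s c n - x)) \<longlonglongrightarrow> 0)" if x: "x \<in> F" and c: "\<And>j. M \<le> enat j \<Longrightarrow> c j = 0" for x c
    using limitin_kothe_iff[OF A F_kothe[OF sF[OF c]] F_kothe[OF x]] x sF[OF c]
    by (simp add: limitin_subtopology)
  have "\<exists>!c. (\<forall>j. M \<le> enat j \<longrightarrow> c j = 0) \<and> limitin (subtopology (kothe_topology A) F) (?s c) x sequentially"
    if x: "x \<in> F" for x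
  proof (rule ex1I)
    define c where "c = (\<lambda>j. if enat j < M then ip x (f j) else 0)"
    have c0: "c j = 0" if "M \<le> enat j" for j using that by (simp add: c_def not_less)
    have "(\<lambda>n. q k (?s c n - x)) \<longlonglongrightarrow> 0" for k
    proof -
      obtain m D where D: "0 < D" "\<And>y M. y \<in> kothe A \<Longrightarrow> (\<And>n. norm (y n :: 'a) * A m n \<le> M) \<Longrightarrow> q k y \<le> D * M"
        using kothe_norm_le_sup[of k] by blast
      have le: "q k y \<le> D * N m y" if y: "y \<in> kothe A" for y
      proof (rule D(2)[OF y])
        fix n
        have "1 * A m n \<le> w m n"
          unfolding w_def using A_mono[OF \<rho>_ge, of m n] C2[of m] Apos[of m n] by (intro mult_mono) auto
        then have "norm (y n) * A m n \<le> norm (y n) * w m n" by (intro mult_left_mono) auto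
        then show "norm (y n) * A m n \<le> N m y" using N_upper[OF y, of n m] by linarith
      qed
      show ?thesis
      proof (rule tendsto_sandwich[OF _ _ tendsto_const])
        have V: "?s c n \<in> kothe A" for n by (rule F_kothe[OF sF[OF c0]])
        show "\<forall>\<^sub>F n in sequentially. 0 \<le> q k (?s c n - x)"
          by (intro always_eventually allI q_nonneg kothe_diff A V F_kothe[OF x])
        show "\<forall>\<^sub>F n in sequentially. q k (?s c n - x) \<le> D * N m (x - ?s c n)"
          unfolding kothe_norm_minus_commute[of A k _ x]
          by (intro always_eventually allI le kothe_diff A V F_kothe[OF x])
        have "(\<lambda>n. D * N m (x - ?s c n)) \<longlonglongrightarrow> D * 0" unfolding c_def by (intro tendsto_mult tendsto_const f(3) x)
        then show "(\<lambda>n. D * N m (x - ?s c n)) \<longlonglongrightarrow> 0" by simp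
      qed
    qed
    then show "(\<forall>j. M \<le> enat j \<longrightarrow> c j = 0) \<and> limitin (subtopology (kothe_topology A) F) (?s c) x sequentially"
      using lim[of x c, OF x c0] c0 by simp
    fix d assume d: "(\<forall>j. M \<le> enat j \<longrightarrow> d j = 0) \<and> limitin (subtopology (kothe_topology A) F) (?s d) x sequentially"
    have d0: "d j = 0" if "M \<le> enat j" for j by (rule d[THEN conjunct1, rule_format, OF that])
    have dq: "(\<lambda>n. q (\<rho> 0) (?s d n - x)) \<longlonglongrightarrow> 0" using lim[of x d, OF x d0] d by simp
    show "d = c"
    proof
      fix m
      show "d m = c m"
      proof (cases "enat m < M")
        case False
        then show ?thesis using c0[of m] d0[of m] by simp
      next
        case m: True
        have fm: "f m \<in> F" "I.n0 (f m) = 1" using f(1)[OF m] f(2)[OF m m] by (auto simp: I.n0_def)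
        have ipd: "ip (?s d n) (f m) = d m" if n: "m < n" for n
        proof -
          have ipj: "ip (scale_seq (d j) (f j)) (f m) = (if j = m then d m else 0)" for j
          proof (cases "enat j < M")
            case True
            then show ?thesis using f(2)[OF True m] I.ip_sc[OF f(1)[OF True] fm(1)] by simp
          next
            case False
            then have "scale_seq (d j) (f j) = 0" using d0[of j] by (auto simp: scale_seq_def)
            then show ?thesis using False m by (auto simp only: I.ip_zero(1)[OF fm(1)] split: if_splits)
          qed
          have V: "scale_seq (d j) (f j) \<in> F" for j
          proof (cases "enat j < M")
            case False
            then have "scale_seq (d j) (f j) = 0" using d0[of j] by (auto simp: scale_seq_def)
            then show ?thesis by (simp only: I.V_0)
          qed (intro F_scale f)
          have "ip (?s d n) (f m) = (\<Sum>j<n. ip (scale_seq (d j) (f j)) (f m))" by (rule I.ip_sum[OF V fm(1)])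
          also have "\<dots> = d m" unfolding ipj using n by simp
          finally show ?thesis .
        qed
        have b: "norm (d m - ip x (f m)) \<le> C 0 * q (\<rho> 0) (?s d n - x)" if n: "m < n" for n
        proof -
          have V: "?s d n \<in> F" by (rule sF[OF d0])
          have y: "?s d n - x \<in> F" by (rule F_diff[OF V x])
          have "d m - ip x (f m) = ip (?s d n - x) (f m)" unfolding I.ip_diff[OF V x fm(1)] ipd[OF n] ..
          then have "norm (d m - ip x (f m)) \<le> I.n0 (?s d n - x)" using I.cauchy_schwarz[OF y fm(1)] fm(2) by simp
          also have "\<dots> \<le> N 0 (?s d n - x)" by (rule n0_le_N[OF y])
          also have "\<dots> \<le> C 0 * q (\<rho> 0) (?s d n - x)" by (rule N_le_q[OF F_kothe[OF y]])
          finally show ?thesis .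
        qed
        have "(\<lambda>n. C 0 * q (\<rho> 0) (?s d n - x)) \<longlonglongrightarrow> C 0 * 0" by (intro tendsto_mult tendsto_const dq)
        then have "norm (d m - ip x (f m)) \<le> C 0 * 0"
          by (rule LIMSEQ_le_const) (use b in \<open>meson Suc_le_eq\<close>)
        then show ?thesis using m by (simp add: c_def)
      qed
    qed
  qed
  then have "schauder_basis (subtopology (kothe_topology A) F) M f"
    unfolding schauder_basis_def using f(1) F_kothe by (auto simp: topspace_subtopology)
  then show ?thesis unfolding has_schauder_basis_def by blast
qed

end

section \<open>The theorem for real and complex scalars\<close>

context kothe_range
begin

theorem has_basis: "has_schauder_basis (subtopology (kothe_topology A) (T ` kothe A))"
proof -
  obtain \<rho> C where "p \<le> \<rho> 0 \<and> (2::real) \<le> C 0 \<and> (\<forall>y. (\<Sum>n<y. (A p n / (C 0 * A (\<rho> 0) n))\<^sup>2) \<le> 1) \<and>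
    (\<forall>k. step (\<rho> k) (C k) (\<rho> (Suc k)) (C (Suc k)))"
    using step_sequence by blast
  then interpret S: kothe_steps A T cj p \<rho> C
    by unfold_locales auto
  show ?thesis using S.range_has_basis by (simp add: F_def)
qed

end

lemma kothe_range_has_basis:
  fixes T :: "(nat \<Rightarrow> 'a::{real_normed_field,banach,heine_borel}) \<Rightarrow> (nat \<Rightarrow> 'a)"
  assumes "conj_scalar (cj :: 'a \<Rightarrow> 'a)" and A: "kothe_matrix A" and "regular_matrix A" and d1: "type_d1 A"
    and nuc: "nuclear_space (kothe_topology A :: (nat \<Rightarrow> 'a) topology)"
    and T: "linear_map_on (kothe A) T" "continuous_map (kothe_topology A) (kothe_topology A) T"
      "closedin (kothe_topology A) (T ` kothe A)"
  shows "has_schauder_basis (subtopology (kothe_topology A) (T ` kothe A))"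
proof -
  interpret conj_scalar cj by fact
  obtain p where p: "\<And>k. \<exists>r. \<exists>C>0. \<forall>n. (A k n)\<^sup>2 \<le> C * A p n * A r n" using d1 unfolding type_d1_def by blast
  have "\<exists>m. summable (\<lambda>n. A k n / A m n)" for k using nuc nuclear_kothe_iff[OF A] by blast
  then interpret kothe_range A T cj p
    by unfold_locales (use assms p in auto)
  show ?thesis by (rule has_basis)
qed

lemma conj_scalar_real: "conj_scalar (id :: real \<Rightarrow> real)"
  by unfold_locales (simp_all add: power2_eq_square)

lemma conj_scalar_complex: "conj_scalar cnj"
proof unfold_locales
  show "x * cnj x = of_real ((norm x)\<^sup>2)" for x by (rule complex_norm_square[symmetric])
qed simp_all

theorem mainTheorem1:
  fixes A :: "nat \<Rightarrow> nat \<Rightarrow> real"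
  assumes "kothe_matrix A"
    and "regular_matrix A"
    and "type_d1 A"
  shows
    "(\<forall>T :: (nat \<Rightarrow> real) \<Rightarrow> (nat \<Rightarrow> real).
        nuclear_space (kothe_topology A :: (nat \<Rightarrow> real) topology) \<longrightarrow>
        linear_map_on (kothe A) T \<longrightarrow>
        continuous_map (kothe_topology A) (kothe_topology A) T \<longrightarrow>
        closedin (kothe_topology A) (T ` kothe A) \<longrightarrow>
        has_schauder_basis (subtopology (kothe_topology A) (T ` kothe A)))
     \<and>
     (\<forall>T :: (nat \<Rightarrow> complex) \<Rightarrow> (nat \<Rightarrow> complex).
        nuclear_space (kothe_topology A :: (nat \<Rightarrow> complex) topology) \<longrightarrow>
        linear_map_on (kothe A) T \<longrightarrow>
        continuous_map (kothe_topology A) (kothe_topology A) T \<longrightarrow>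
        closedin (kothe_topology A) (T ` kothe A) \<longrightarrow>
        has_schauder_basis (subtopology (kothe_topology A) (T ` kothe A)))"
  using kothe_range_has_basis[OF conj_scalar_real assms] kothe_range_has_basis[OF conj_scalar_complex assms]
  by blast

end
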